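(* Let $s\in\mathbb{Z}\setminus\{0\}$. If $2\le y\le z\le x$, then $$H(x,y,z;P_s)=\frac{x}{\log x}\Bigl(1+O_s\Bigl(\frac{\log y}{\log z}\Bigr)\Bigr).$$
   Context: For $y\le z$, $x\ge1$ and a set $\mathscr{A}$ of natural numbers, $H(x,y,z;\mathscr{A})$ is the number of $n\in[0,x]\cap\mathscr{A}$ having a divisor $d$ with $y<d\le z$. $P_s=\{p+s:p\text{ prime}\}$. The implied constant in $O_s$ depends only on $s$. *)

theory Defs
  imports Complex_Main "HOL-Computational_Algebra.Primes"
begin

text \<open>
  The number of \<open>n \<in> [0,x] \<inter> A\<close> having a divisor \<open>d\<close> with \<open>y < d \<le> z\<close>. Like the interval
  \<open>[0,x]\<close>, the count includes \<open>n = 0\<close> (if \<open>0 \<in> A\<close>), which every \<open>d\<close> divides.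
\<close>

definition H :: "real \<Rightarrow> real \<Rightarrow> real \<Rightarrow> nat set \<Rightarrow> nat" where
  "H x y z A = card {n \<in> A. real n \<le> x \<and> (\<exists>d. y < real d \<and> real d \<le> z \<and> d dvd n)}"

text \<open>
  The shifted primes \<open>p + s\<close>. The shift may be negative, so the equation is one between integers;
  negative values \<open>p + s\<close> are dropped, as they never lie in \<open>[0,x]\<close>.
\<close>

definition shifted_primes :: "int \<Rightarrow> nat set" where
  "shifted_primes s = {n. \<exists>p::nat. prime p \<and> int n = int p + s}"

end

(*
  The number of shifted primes up to x differs from H only by the primes p for which p + s has no
  divisor in (y,z].

  The prime number theorem with relative error O(1 / log x) is proved by contour integration on
  Re s > 1 only.  With D(s) = sum (Lambda(n) - 1) n^-s = - zeta'/zeta - zeta, the second derivative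
  of D is O((1 + |t|)^(1/2)) uniformly for 1 < Re s <= 2: for large t by Cauchy's inequality on discs
  of radius a small negative power of t, where the inequality 3 + 4 cos u + cos 2u >= 0 bounds zeta
  from below, and for bounded t by compactness.  Perron's formula with the kernel 1 / (s (s + 1)),
  integrated over Re s = 1 + 1 / log x, then bounds sum_{n <= x} (Lambda(n) - 1) (log n)^2 (x - n) by
  O(x^2), and the smoothing is removed because the Lambda-part of the sum is increasing.

  The exceptional primes are estimated with the Selberg sieve of level x^(1/12), removing the class 0
  modulo every prime and also the class -s modulo the primes in (y,z].  The sieve sum is bounded
  below by a product of two harmonic sums, over all integers and over integers free of primes <= y;
  Mertens' estimate for prod_{p <= y} (1 - 1/p) turns it into a multiple of log x log z / log y.
*)

theory Submission
  imports Defs "HOL-Complex_Analysis.Complex_Analysis" "HOL-Number_Theory.Cong" "HOL-Number_Theory.Prime_Powers"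
begin

section \<open>Dirichlet series\<close>


text \<open>The allowed relative error ln y / ln z is at least ln 2 / ln x, so a prime number
  theorem with relative error O(1 / ln x) suffices, and bounds up to the line Re s = 1 yield it. The
  second derivative is the right one to take: bounding it improves the trivial estimate of the
  smoothed sum by (ln x)^2, and removing the smoothing keeps only the square root of that gain, one
  logarithm. Subtracting 1 from Lambda cancels the pole at s = 1. The growth exponent 1/2 has to
  stay below 1, so that the kernel, of size t^-2, makes the integral converge. All exponents descend
  from 1/30 in the bound for zeta: zeta' has the same exponent, 1 / zeta has 4/30, the radius of the
  Cauchy discs has -5/30, and D'' has 5/30 + 2 * 5/30 = 1/2. In the sieve, the class -s modulo p
  expresses that p divides q + s, which would give q + s a divisor in (y,z]. Primes dividing s must
  be exempted, because for them the two classes coincide; this costs a constant depending on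
  s.\<close>

definition abs_conv :: "(nat \<Rightarrow> real) \<Rightarrow> bool" where
  "abs_conv a \<longleftrightarrow> (\<forall>\<sigma>>1. summable (\<lambda>n. \<bar>a n\<bar> * real n powr (-\<sigma>)))"

text \<open>The term \<open>n = 0\<close> vanishes, because \<open>0 powr z = 0\<close>.\<close>

definition dser :: "(nat \<Rightarrow> real) \<Rightarrow> complex \<Rightarrow> complex" where
  "dser a s = (\<Sum>n. of_real (a n) * of_nat n powr (-s))"

lemma norm_of_nat_powr: "norm (of_nat n powr s :: complex) = real n powr Re s"
  using norm_powr_real_powr[of "of_nat n" s] by simp

lemma dser_summable_norm:
  assumes "abs_conv a" "Re s > 1"
  shows "summable (\<lambda>n. norm (of_real (a n) * of_nat n powr (-s) :: complex))"
  using assms by (simp add: abs_conv_def norm_mult norm_of_nat_powr)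

lemma dser_sums:
  assumes "abs_conv a" "Re s > 1"
  shows "(\<lambda>n. of_real (a n) * of_nat n powr (-s)) sums dser a s"
  unfolding dser_def using summable_norm_cancel[OF dser_summable_norm[OF assms]] by (rule summable_sums)

lemma abs_conv_le:
  assumes "abs_conv b" "\<And>n. n > 0 \<Longrightarrow> \<bar>a n\<bar> \<le> \<bar>b n\<bar>"
  shows "abs_conv a"
  unfolding abs_conv_def
proof (intro allI impI)
  fix \<sigma> :: real assume "\<sigma> > 1"
  then have "summable (\<lambda>n. \<bar>b n\<bar> * real n powr (-\<sigma>))" using assms(1) by (auto simp: abs_conv_def)
  then show "summable (\<lambda>n. \<bar>a n\<bar> * real n powr (-\<sigma>))"
  proof (rule summable_comparison_test[rotated], intro exI[of _ 0] allI impI)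
    fix n show "norm (\<bar>a n\<bar> * real n powr (-\<sigma>)) \<le> \<bar>b n\<bar> * real n powr (-\<sigma>)"
      using assms(2)[of n] by (cases "n = 0") (auto intro!: mult_right_mono simp: abs_mult)
  qed
qed

lemma abs_conv_ln:
  assumes "abs_conv a"
  shows "abs_conv (\<lambda>n. a n * ln (real n))"
  unfolding abs_conv_def
proof (intro allI impI)
  fix \<sigma> :: real assume s: "\<sigma> > 1"
  \<comment> \<open>Half of the margin \<open>\<sigma> - 1\<close> pays for the logarithm, through
    ln n <= n^e / e.\<close>
  define e where "e = (\<sigma> - 1) / 2"
  have e: "e > 0" using s by (simp add: e_def)
  have "summable (\<lambda>n. \<bar>a n\<bar> * real n powr (-(1 + e)))" using assms e unfolding abs_conv_def by (metis less_add_same_cancel1)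
  then have "summable (\<lambda>n. (1 / e) * (\<bar>a n\<bar> * real n powr (-(1 + e))))" by (rule summable_mult)
  then show "summable (\<lambda>n. \<bar>a n * ln (real n)\<bar> * real n powr (-\<sigma>))"
  proof (rule summable_comparison_test[rotated], intro exI[of _ 0] allI impI)
    fix n
    show "norm (\<bar>a n * ln (real n)\<bar> * real n powr (-\<sigma>)) \<le> (1 / e) * (\<bar>a n\<bar> * real n powr (-(1 + e)))"
    proof (cases "n = 0")
      case False
      then have n: "real n \<ge> 1" by simp
      have "norm (\<bar>a n * ln (real n)\<bar> * real n powr (-\<sigma>)) = \<bar>a n\<bar> * real n powr (-\<sigma>) * ln (real n)"
        using n by (simp add: abs_mult)
      also have "\<dots> \<le> \<bar>a n\<bar> * real n powr (-\<sigma>) * (real n powr e / e)"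
        by (intro mult_left_mono ln_powr_bound n e) auto
      also have "\<dots> = (1 / e) * (\<bar>a n\<bar> * real n powr (-\<sigma> + e))" unfolding powr_add by simp
      also have "-\<sigma> + e = -(1 + e)" by (simp add: e_def field_simps)
      finally show ?thesis .
    qed auto
  qed
qed

lemma abs_conv_one: "abs_conv (\<lambda>n. 1)"
  by (auto simp: abs_conv_def summable_real_powr_iff)

lemma abs_conv_mangoldt: "abs_conv mangoldt"
  by (rule abs_conv_le[OF abs_conv_ln[OF abs_conv_one]])
     (auto simp: mangoldt_le intro: order.trans[OF mangoldt_le])

lemma abs_conv_diff:
  assumes "abs_conv a" "abs_conv b"
  shows "abs_conv (\<lambda>n. a n - b n)"
  unfolding abs_conv_def
proof (intro allI impI)
  fix \<sigma> :: real assume s: "\<sigma> > 1"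
  have "summable (\<lambda>n. \<bar>a n\<bar> * real n powr (-\<sigma>) + \<bar>b n\<bar> * real n powr (-\<sigma>))"
    using assms s by (intro summable_add) (auto simp: abs_conv_def)
  then show "summable (\<lambda>n. \<bar>a n - b n\<bar> * real n powr (-\<sigma>))"
    by (rule summable_comparison_test[rotated], intro exI[of _ 0] allI impI)
       (auto simp: abs_mult distrib_right[symmetric] intro!: mult_right_mono)
qed

lemma dser_diff:
  assumes "abs_conv a" "abs_conv b" "Re s > 1"
  shows "dser (\<lambda>n. a n - b n) s = dser a s - dser b s"
proof (rule sums_unique2)
  show "(\<lambda>n. of_real (a n - b n) * of_nat n powr (-s)) sums dser (\<lambda>n. a n - b n) s"
    by (rule dser_sums[OF abs_conv_diff]) fact+
  show "(\<lambda>n. of_real (a n - b n) * of_nat n powr (-s)) sums (dser a s - dser b s)"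
    using sums_diff[OF dser_sums[OF assms(1,3)] dser_sums[OF assms(2,3)]] by (simp add: algebra_simps)
qed

text \<open>Termwise differentiation on the half-plane to the right of the midpoint \<open>c\<close>
  of 1 and Re s, where the terms have a summable majorant independent of the point.\<close>

lemma dser_has_field_derivative:
  assumes "abs_conv a" "Re s > 1"
  shows "(dser a has_field_derivative - dser (\<lambda>n. a n * ln (real n)) s) (at s)"
proof -
  define c where "c = (1 + Re s) / 2"
  have c: "c > 1" "Re s > c" using assms by (auto simp: c_def field_simps)
  define S where "S = {z. Re z > c}"
  have S: "open S" "s \<in> S" using c by (auto simp: S_def open_halfspace_Re_gt)
  define f where "f = (\<lambda>n z. complex_of_real (a n) * of_nat n powr (-z))"
  define f' where "f' = (\<lambda>n z. - (complex_of_real (a n * ln (real n)) * of_nat n powr (-z)))"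
  have der: "(f n has_field_derivative f' n z) (at z)" for n z
  proof (cases "n = 0")
    case False
    then have "((\<lambda>z. of_nat n powr (-z)) has_field_derivative Ln (of_nat n) * of_nat n powr (-z) * (-1)) (at z)"
      by (intro DERIV_chain2[OF has_field_derivative_powr_right]) (auto intro!: derivative_eq_intros)
    from DERIV_cmult[OF this, of "of_real (a n)"] False show ?thesis unfolding f_def f'_def
      by (simp add: Ln_of_nat mult_ac)
  qed (auto simp: f_def f'_def)
  have h: "summable (\<lambda>n. \<bar>a n\<bar> * real n powr (-c))" using assms c by (auto simp: abs_conv_def)
  have le: "norm (f n z) \<le> \<bar>a n\<bar> * real n powr (-c)" if "z \<in> S" for n z
    using that by (cases "n = 0") (auto simp: f_def norm_mult norm_of_nat_powr S_def intro!: mult_left_mono powr_mono)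
  obtain g g' where
    g: "\<And>x. x \<in> S \<Longrightarrow> (\<lambda>n. f n x) sums g x \<and> (\<lambda>n. f' n x) sums g' x \<and> (g has_field_derivative g' x) (at x)"
    by (rule series_and_derivative_comparison[OF S(1) h der, where n2 = "\<lambda>n. n"]) (use le in auto)
  have "g x = dser a x" if "x \<in> S" for x
    using g[OF that] dser_sums[OF assms(1), of x] that c unfolding f_def S_def by (auto dest: sums_unique2)
  moreover have "g' s = - dser (\<lambda>n. a n * ln (real n)) s"
    using g[OF S(2)] sums_minus[OF dser_sums[OF abs_conv_ln[OF assms(1)] assms(2)]] unfolding f'_def
    by (auto dest: sums_unique2)
  ultimately show ?thesis using g[OF S(2)] S
    by (metis has_field_derivative_transform_within_open)
qed

text \<open>Dirichlet convolution with 1. The double series over pairs (d, m) is absolutely summable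
  and may be regrouped by n = d * m, the pair being recorded as (n, d). The index 0 is left out
  because it has infinitely many divisors; its terms vanish.\<close>

lemma dser_mult_one:
  assumes a: "abs_conv a" and s: "Re s > 1"
    and conv: "abs_conv (\<lambda>n. \<Sum>d | d dvd n. a d)"
  shows "dser a s * dser (\<lambda>n. 1) s = dser (\<lambda>n. \<Sum>d | d dvd n. a d) s"
proof -
  define A where "A = {0::nat<..}"
  define F where "F = (\<lambda>n. complex_of_real (a n) * of_nat n powr (-s))"
  define Z where "Z = (\<lambda>n::nat. of_nat n powr (-s) :: complex)"
  define X where "X = (\<lambda>n. of_real (\<Sum>d | d dvd n. a d) * of_nat n powr (-s) :: complex)"
  have F: "(F has_sum dser a s) A" "(\<lambda>x. norm (F x)) summable_on A"
  proof -
    have "(F has_sum dser a s) UNIV" unfolding F_def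
      by (rule norm_summable_imp_has_sum[OF dser_summable_norm dser_sums]) fact+
    then show "(F has_sum dser a s) A"
      by (rule has_sum_cong_neutral[THEN iffD1, rotated -1]) (auto simp: A_def F_def)
    have "(\<lambda>x. norm (F x)) summable_on UNIV" unfolding F_def
      using dser_summable_norm[OF a s] by (simp add: summable_on_UNIV_nonneg_real_iff)
    then show "(\<lambda>x. norm (F x)) summable_on A" by (rule summable_on_subset_banach) auto
  qed
  have Z: "(Z has_sum dser (\<lambda>n. 1) s) A" "(\<lambda>x. norm (Z x)) summable_on A"
  proof -
    have "(Z has_sum dser (\<lambda>n. 1) s) UNIV" unfolding Z_def
      using norm_summable_imp_has_sum[OF dser_summable_norm[OF abs_conv_one s] dser_sums[OF abs_conv_one s]] by simp
    then show "(Z has_sum dser (\<lambda>n. 1) s) A"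
      by (rule has_sum_cong_neutral[THEN iffD1, rotated -1]) (auto simp: A_def Z_def)
    have "(\<lambda>x. norm (Z x)) summable_on UNIV" unfolding Z_def
      using dser_summable_norm[OF abs_conv_one s] by (simp add: summable_on_UNIV_nonneg_real_iff)
    then show "(\<lambda>x. norm (Z x)) summable_on A" by (rule summable_on_subset_banach) auto
  qed
  have "(\<lambda>x. F (fst x) * Z (snd x)) summable_on A \<times> A"
  proof (rule abs_summable_summable, unfold Infinite_Sum.abs_summable_on_Sigma_iff, safe)
    fix d show "(\<lambda>y. norm (F (fst (d, y)) * Z (snd (d, y)))) summable_on A"
      using summable_on_cmult_right[OF Z(2), of "norm (F d)"] by (simp add: norm_mult)
    have "(\<lambda>d. norm (F d) * (\<Sum>\<^sub>\<infinity>m\<in>A. norm (Z m))) summable_on A"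
      by (rule summable_on_cmult_left[OF F(2)])
    then show "(\<lambda>x. norm (\<Sum>\<^sub>\<infinity>y\<in>A. norm (F (fst (x, y)) * Z (snd (x, y))))) summable_on A"
      using Z(2) by (simp add: norm_mult infsum_cmult_right abs_mult infsum_nonneg)
  qed
  then have sm: "(\<lambda>(d, m). F d * Z m) summable_on A \<times> A" by (simp add: case_prod_unfold)
  have "((\<lambda>(d, m). F d * Z m) has_sum (dser a s * dser (\<lambda>n. 1) s)) (A \<times> A)"
    by (rule has_sum_SigmaI[OF _ has_sum_cmult_left[OF F(1)] sm]) (use has_sum_cmult_right[OF Z(1)] in auto)
  also have "?this \<longleftrightarrow> ((\<lambda>(n, d). F d * Z (n div d)) has_sum (dser a s * dser (\<lambda>n. 1) s)) (SIGMA n:A. {d. d dvd n})"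
    by (rule has_sum_reindex_bij_witness[where j = "\<lambda>(d, m). (d * m, d)" and i = "\<lambda>(n, d). (d, n div d)"])
       (auto simp: A_def dest: dvd_div_eq_0_iff[THEN iffD1] intro!: Nat.gr0I)
  finally have "(X has_sum (dser a s * dser (\<lambda>n. 1) s)) A"
  proof (rule has_sum_SigmaD)
    fix n assume n: "n \<in> A"
    have "((\<lambda>d. F d * Z (n div d)) has_sum (\<Sum>d | d dvd n. F d * Z (n div d))) {d. d dvd n}"
      using n by (intro has_sum_finite) (auto simp: A_def)
    also have "(\<Sum>d | d dvd n. F d * Z (n div d)) = X n"
      unfolding X_def of_real_sum sum_distrib_right
    proof (rule sum.cong)
      fix d assume "d \<in> {d. d dvd n}"
      then obtain m where m: "n = d * m" by auto
      have "of_nat d powr (-s) * of_nat m powr (-s) = (of_nat n powr (-s) :: complex)"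
        unfolding m of_nat_mult using n m by (subst powr_times_real) (auto simp: A_def)
      then show "F d * Z (n div d) = of_real (a d) * of_nat n powr - s"
        using n m by (auto simp: F_def Z_def A_def)
    qed auto
    finally show "((\<lambda>d. case (n, d) of (n, d) \<Rightarrow> F d * Z (n div d)) has_sum X n) {d. d dvd n}" by simp
  qed
  then have "(X has_sum (dser a s * dser (\<lambda>n. 1) s)) UNIV"
    by (rule has_sum_cong_neutral[THEN iffD1, rotated -1]) (auto simp: A_def X_def)
  then have "X sums (dser a s * dser (\<lambda>n. 1) s)" by (rule has_sum_imp_sums)
  with dser_sums[OF conv s] show ?thesis unfolding X_def by (rule sums_unique2[symmetric])
qed

text \<open>The identity 1 * Lambda = ln, read as a product of Dirichlet series. It gives the
  logarithmic derivative of zeta on Re s > 1 without an Euler product.\<close>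

lemma dser_mangoldt_mult:
  assumes "Re s > 1"
  shows "dser mangoldt s * dser (\<lambda>n. 1) s = dser (\<lambda>n. ln (real n)) s"
proof -
  have eq: "(\<Sum>d | d dvd n. mangoldt d) = ln (real n)" if "n > 0" for n
    using mangoldt_sum[of n, where 'a = real] that by simp
  have conv: "abs_conv (\<lambda>n. \<Sum>d | d dvd n. mangoldt d)"
    by (rule abs_conv_le[OF abs_conv_ln[OF abs_conv_one]]) (auto simp: eq)
  have "dser (\<lambda>n. \<Sum>d | d dvd n. mangoldt d) s = dser (\<lambda>n. ln (real n)) s"
    unfolding dser_def by (intro suminf_cong) (metis eq gr0I mult_zero_right of_nat_0 powr_0)
  with dser_mult_one[OF abs_conv_mangoldt assms conv] show ?thesis by simp
qed

lemma deriv_dser_one: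
  assumes "Re s > 1"
  shows "(dser (\<lambda>n. 1) has_field_derivative - (dser mangoldt s * dser (\<lambda>n. 1) s)) (at s)"
  using dser_has_field_derivative[OF abs_conv_one assms] dser_mangoldt_mult[OF assms] by simp

section \<open>The zeta function to the right of the line Re s = 0\<close>


text \<open>This is (s - 1) times the integral of n^-s - (n + u)^-s over 0 <= u <= 1, so it inherits
  every bound for that difference of powers.\<close>

definition zeta_term :: "nat \<Rightarrow> complex \<Rightarrow> complex" where
  "zeta_term n s = (s - 1) * of_nat n powr (-s) - of_nat n powr (1 - s) + of_nat (Suc n) powr (1 - s)"

text \<open>
  This is \<open>(s - 1) * zeta s\<close>: the telescoping sum of \<open>(n + 1) powr (1 - s) - n powr (1 - s)\<close> is subtracted
  from the Dirichlet series, so that the terms are \<open>O(n powr (- Re s - 1))\<close>.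
\<close>

definition zeta_reg :: "complex \<Rightarrow> complex" where
  "zeta_reg s = 1 + (\<Sum>n. zeta_term (Suc n) s)"

text \<open>At the pole s = 1 division by zero yields the value 0, so the point 1 is removed from
  the domain wherever holomorphy is asserted.\<close>

definition zeta :: "complex \<Rightarrow> complex" where
  "zeta s = zeta_reg s / (s - 1)"

lemma norm_powr_diff_le:
  assumes "0 < n" "real n \<le> x" "Re s > 0"
  shows "norm (of_nat n powr (-s) - of_real x powr (-s)) \<le> norm s * real n powr (- Re s - 1) * (x - real n)"
proof -
  let ?S = "closed_segment (of_real (real n)) (of_real x) :: complex set"
  have S: "?S = of_real ` {real n..x}"
    using assms(2) by (simp only: closed_segment_of_real closed_segment_eq_real_ivl if_True)
  have "norm ((\<lambda>w. w powr (-s)) (of_real x) - (\<lambda>w. w powr (-s)) (of_real (real n)))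
      \<le> norm s * real n powr (- Re s - 1) * norm (of_real x - of_real (real n) :: complex)"
  proof (rule field_differentiable_bound)
    show "convex ?S" by simp
    fix w assume "w \<in> ?S"
    then obtain u where u: "w = of_real u" "real n \<le> u" "u \<le> x" using S by auto
    have "u > 0" using u assms by linarith
    then have "w \<notin> \<real>\<^sub>\<le>\<^sub>0" using u by auto
    then show "((\<lambda>w. w powr (-s)) has_field_derivative (-s) * w powr (-s - 1)) (at w within ?S)"
      by (rule has_field_derivative_at_within[OF has_field_derivative_powr])
    have "norm ((-s) * w powr (-s - 1)) = norm s * u powr (- Re s - 1)"
      using \<open>u > 0\<close> u by (simp add: norm_mult norm_powr_real_powr)
    also have "\<dots> \<le> norm s * real n powr (- Re s - 1)"
      using u assms by (intro mult_left_mono powr_mono2') auto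
    finally show "norm ((-s) * w powr (-s - 1)) \<le> norm s * real n powr (- Re s - 1)" .
  qed auto
  also have "norm (of_real x - of_real (real n) :: complex) = x - real n"
    using assms(2) by (simp only: of_real_diff[symmetric] norm_of_real)
  finally show ?thesis by (simp add: norm_minus_commute)
qed

text \<open>The mean value inequality for the function \<open>k\<close> of the proof stands in for
  the integral representation: its increment over [0,1] is the term, and its derivative is (s - 1)
  times the difference of powers.\<close>

lemma norm_zeta_term_aux:
  assumes "0 < n" "\<And>x. real n \<le> x \<Longrightarrow> x \<le> real n + 1 \<Longrightarrow> norm (of_nat n powr (-s) - of_real x powr (-s)) \<le> B"
  shows "norm (zeta_term n s) \<le> norm (s - 1) * B"
proof -
  let ?S = "closed_segment (of_real 0) (of_real 1) :: complex set"
  have S: "?S = of_real ` {0..1}"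
    by (simp only: closed_segment_of_real closed_segment_eq_real_ivl) simp
  define k where "k = (\<lambda>u. (s - 1) * u * of_nat n powr (-s) + (of_nat n + u) powr (1 - s))"
  have "norm (k (of_real 1) - k (of_real 0)) \<le> norm (s - 1) * B * norm (of_real 1 - of_real 0 :: complex)"
  proof (rule field_differentiable_bound)
    show "convex ?S" by (rule convex_closed_segment)
    fix w assume "w \<in> ?S"
    then obtain u where u: "w = of_real u" "0 \<le> u" "u \<le> 1" using S by auto
    have eq: "of_nat n + w = of_real (real n + u)" using u by simp
    have "real n + u > 0" using u assms by simp
    then have "of_nat n + w \<notin> \<real>\<^sub>\<le>\<^sub>0" unfolding eq using nonpos_Reals_of_real_iff by (metis not_le)
    then have "((\<lambda>w. (of_nat n + w) powr (1 - s)) has_field_derivative (1 - s) * (of_nat n + w) powr ((1 - s) - 1) * 1) (at w within ?S)"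
      by (rule DERIV_chain2[OF has_field_derivative_powr]) (auto intro!: derivative_eq_intros)
    then show "(k has_field_derivative (s - 1) * (of_nat n powr (-s) - (of_nat n + w) powr (-s))) (at w within ?S)"
      unfolding k_def
      by (rule DERIV_cong[OF DERIV_add[OF DERIV_cmult_right[OF DERIV_cmult[OF DERIV_ident]]]]) (simp add: algebra_simps)
    show "norm ((s - 1) * (of_nat n powr (-s) - (of_nat n + w) powr (-s))) \<le> norm (s - 1) * B"
      unfolding norm_mult eq using assms(2)[of "real n + u"] u by (intro mult_left_mono) auto
  qed auto
  also have "k (of_real 1) - k (of_real 0) = zeta_term n s"
    by (simp add: k_def zeta_term_def add.commute)
  finally show ?thesis by simp
qed

lemma norm_zeta_term_le1:
  assumes "0 < n" "Re s > 0"
  shows "norm (zeta_term n s) \<le> norm (s - 1) * (norm s * real n powr (- Re s - 1))"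
proof (rule norm_zeta_term_aux[OF assms(1)])
  fix x assume x: "real n \<le> x" "x \<le> real n + 1"
  show "norm (of_nat n powr (-s) - of_real x powr (-s)) \<le> norm s * real n powr (- Re s - 1)"
    using norm_powr_diff_le[OF assms(1) x(1) assms(2)] 
    by (rule order.trans) (use x in \<open>intro mult_left_le; auto\<close>)
qed

lemma norm_zeta_term_le2:
  assumes "0 < n" "Re s > 0"
  shows "norm (zeta_term n s) \<le> norm (s - 1) * (2 * real n powr (- Re s))"
proof (rule norm_zeta_term_aux[OF assms(1)])
  fix x assume x: "real n \<le> x" "x \<le> real n + 1"
  have "norm (of_nat n powr (-s) - of_real x powr (-s)) \<le> real n powr (- Re s) + x powr (- Re s)"
    using norm_triangle_ineq4[of "of_nat n powr (-s)" "of_real x powr (-s) :: complex"] x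
    by (simp add: norm_of_nat_powr norm_powr_real_powr)
  also have "x powr (- Re s) \<le> real n powr (- Re s)" using x assms by (intro powr_mono2') auto
  finally show "norm (of_nat n powr (-s) - of_real x powr (-s)) \<le> 2 * real n powr (- Re s)" by simp
qed

text \<open>
  Interpolating between the two bounds gives growth \<open>O(\<bar>t\<bar> powr \<theta>)\<close> of zeta slightly to the left of the line
  \<open>Re s = 1\<close>, without splitting the series at \<open>\<bar>t\<bar>\<close>.
\<close>

lemma norm_zeta_term_le:
  assumes "0 < n" "Re s > 0" "0 \<le> \<theta>" "\<theta> \<le> 1"
  shows "norm (zeta_term n s) \<le> norm (s - 1) * (2 * norm s powr \<theta> * real n powr (- Re s - \<theta>))"
proof -
  define x where "x = norm s / real n"
  have "norm s > 0" using assms by auto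
  then have x: "x > 0" using assms by (auto simp: x_def)
  have eq: "norm s powr \<theta> * real n powr (- Re s - \<theta>) = x powr \<theta> * real n powr (- Re s)"
    using assms by (simp add: x_def powr_divide powr_diff powr_minus field_simps)
  show ?thesis
  proof (cases "x \<ge> 1")
    case True
    then have "1 \<le> x powr \<theta>" using assms ge_one_powr_ge_zero by blast
    then have "2 * real n powr (- Re s) \<le> 2 * (x powr \<theta> * real n powr (- Re s))"
      using mult_right_mono[of 1 "x powr \<theta>" "real n powr (- Re s)"] by simp
    then have "norm (s - 1) * (2 * real n powr (- Re s)) \<le> norm (s - 1) * (2 * (x powr \<theta> * real n powr (- Re s)))"
      by (rule mult_left_mono) simp
    with norm_zeta_term_le2[OF assms(1,2)] show ?thesis
      unfolding eq[symmetric] mult.assoc by (rule order.trans)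
  next
    case False
    then have "x \<le> x powr \<theta>" using x assms powr_mono'[of \<theta> 1 x] by simp
    then have "norm s * real n powr (- Re s - 1) \<le> x powr \<theta> * real n powr (- Re s)"
      using assms by (simp add: x_def powr_diff field_simps mult_right_mono)
    also have "\<dots> \<le> 2 * (x powr \<theta> * real n powr (- Re s))" by simp
    finally have "norm (s - 1) * (norm s * real n powr (- Re s - 1)) \<le> norm (s - 1) * (2 * (x powr \<theta> * real n powr (- Re s)))"
      by (rule mult_left_mono) simp
    with norm_zeta_term_le1[OF assms(1,2)] show ?thesis
      unfolding eq[symmetric] mult.assoc by (rule order.trans)
  qed
qed

lemma zeta_term_summable:
  assumes "Re s > 0"
  shows "summable (\<lambda>n. norm (zeta_term (Suc n) s))"
proof (rule summable_comparison_test)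
  show "summable (\<lambda>n. norm (s - 1) * (norm s * real (Suc n) powr (- Re s - 1)))"
    using assms by (intro summable_mult, subst summable_Suc_iff) (simp add: summable_real_powr_iff)
  show "\<exists>N. \<forall>n\<ge>N. norm (norm (zeta_term (Suc n) s)) \<le> norm (s - 1) * (norm s * real (Suc n) powr (- Re s - 1))"
    using norm_zeta_term_le1[OF _ assms] unfolding real_norm_def abs_norm_cancel by blast
qed

lemma zeta_reg_holomorphic: "zeta_reg holomorphic_on {s. Re s > 0}"
proof -
  have "\<exists>d. (zeta_reg has_field_derivative d) (at s)" if s: "Re s > 0" for s
  proof -
    define c where "c = Re s / 2"
    define S where "S = {z. Re z > c} \<inter> ball 0 (norm s + 1)"
    have S: "open S" unfolding S_def by (rule open_Int[OF open_halfspace_Re_gt open_ball])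
    have S': "s \<in> S" using s by (simp add: S_def c_def)
    define R where "R = norm s + 1"
    have h: "summable (\<lambda>n. (R + 1) * (R * real (Suc n) powr (- (Re s / 2) - 1)))"
      using s by (intro summable_mult, subst summable_Suc_iff) (simp add: summable_real_powr_iff)
    have der: "((\<lambda>s. zeta_term (Suc n) s) has_field_derivative deriv (zeta_term (Suc n)) z) (at z)" for n z
    proof -
      have "zeta_term (Suc n) holomorphic_on UNIV"
        unfolding zeta_term_def by (intro holomorphic_intros)
      from holomorphic_derivI[OF this] show ?thesis by simp
    qed
    have le: "norm (zeta_term (Suc n) z) \<le> (R + 1) * (R * real (Suc n) powr (- (Re s / 2) - 1))" if "z \<in> S" for n z
    proof -
      have z: "Re z > Re s / 2" "norm z \<le> R" using that by (auto simp: S_def R_def c_def)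
      have "norm (z - 1) \<le> R + 1" using z norm_triangle_ineq4[of z 1] by simp
      then have "norm (z - 1) * (norm z * real (Suc n) powr (- Re z - 1)) \<le> (R + 1) * (R * real (Suc n) powr (- (Re s / 2) - 1))"
        using z s by (intro mult_mono powr_mono) (auto simp: R_def)
      with norm_zeta_term_le1[of "Suc n" z] z s show ?thesis by simp
    qed
    obtain g g' where g: "\<And>x. x \<in> S \<Longrightarrow> (\<lambda>n. zeta_term (Suc n) x) sums g x \<and> (g has_field_derivative g' x) (at x)"
      by (rule series_and_derivative_comparison[OF S h der, where n2 = "\<lambda>n. n"]) (use le in auto)
    have "zeta_reg x = 1 + g x" if "x \<in> S" for x using g[OF that] by (simp add: zeta_reg_def sums_iff)
    moreover have "((\<lambda>x. 1 + g x) has_field_derivative g' s) (at s)"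
      using g[OF S'] by (auto intro!: derivative_eq_intros)
    ultimately have "(zeta_reg has_field_derivative g' s) (at s)" using S S'
      by (metis has_field_derivative_transform_within_open)
    then show ?thesis by blast
  qed
  then show ?thesis by (auto simp: holomorphic_on_open open_halfspace_Re_gt)
qed

lemma zeta_reg_1: "zeta_reg 1 = 1"
proof -
  have "zeta_term (Suc n) 1 = 0" for n
    unfolding zeta_term_def by (simp del: of_nat_Suc)
  then show ?thesis by (simp add: zeta_reg_def)
qed

text \<open>The telescoping part sums to -1, which cancels the leading 1 in \<open>zeta_reg\<close>.
  Its boundary term tends to 0 because Re s > 1.\<close>

lemma zeta_reg_eq:
  assumes "Re s > 1"
  shows "zeta_reg s = (s - 1) * dser (\<lambda>n. 1) s"
proof -
  have "(\<lambda>n. (s - 1) * of_nat (Suc n) powr (-s)) sums ((s - 1) * dser (\<lambda>n. 1) s)"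
    using dser_sums[OF abs_conv_one assms] by (intro sums_mult, subst sums_Suc_iff) simp
  moreover have "(\<lambda>n. of_nat (Suc (Suc n)) powr (1 - s) - of_nat (Suc n) powr (1 - s)) sums (0 - of_nat (Suc 0) powr (1 - s))"
  proof (rule telescope_sums)
    have "(\<lambda>n. norm (of_nat (Suc n) powr (1 - s) :: complex)) \<longlonglongrightarrow> 0"
      unfolding norm_of_nat_powr using assms
      by (intro tendsto_neg_powr filterlim_compose[OF filterlim_real_sequentially filterlim_Suc]) auto
    then show "(\<lambda>n. of_nat (Suc n) powr (1 - s) :: complex) \<longlonglongrightarrow> 0" by (rule tendsto_norm_zero_cancel)
  qed
  ultimately have "(\<lambda>n. (s - 1) * of_nat (Suc n) powr (-s) + (of_nat (Suc (Suc n)) powr (1 - s) - of_nat (Suc n) powr (1 - s)))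
      sums ((s - 1) * dser (\<lambda>n. 1) s + (0 - of_nat (Suc 0) powr (1 - s)))"
    by (rule sums_add)
  also have "(\<lambda>n. (s - 1) * of_nat (Suc n) powr (-s) + (of_nat (Suc (Suc n)) powr (1 - s) - of_nat (Suc n) powr (1 - s)))
      = (\<lambda>n. zeta_term (Suc n) s)"
    unfolding zeta_term_def by (rule ext) (simp add: algebra_simps del: of_nat_Suc)
  finally have "(\<lambda>n. zeta_term (Suc n) s) sums ((s - 1) * dser (\<lambda>n. 1) s + (0 - of_nat (Suc 0) powr (1 - s)))" .
  then show ?thesis by (simp add: zeta_reg_def sums_iff)
qed

lemma zeta_eq: "Re s > 1 \<Longrightarrow> zeta s = dser (\<lambda>n. 1) s"
  by (auto simp: zeta_def zeta_reg_eq)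

lemma zeta_holomorphic: "zeta holomorphic_on {s. Re s > 0} - {1}"
  unfolding zeta_def using zeta_reg_holomorphic
  by (intro holomorphic_intros) (auto intro: holomorphic_on_subset)

text \<open>With exponent 1/30 in \<open>norm_zeta_term_le\<close> the powers of n are at most
  n^(-61/60), since 59/60 + 1/30 = 61/60, and the series converges. The value 1/30 is chosen so that
  its fifteenfold, reached in \<open>dser_second_deriv_large\<close>, is 1/2.\<close>

lemma zeta_growth:
  obtains K :: real where "K \<ge> 1"
    "\<And>s. Re s \<ge> 59/60 \<Longrightarrow> s \<noteq> 1 \<Longrightarrow> norm (zeta s) \<le> 1 / norm (s - 1) + K * norm s powr (1/30)"
proof -
  define K where "K = 1 + 2 * (\<Sum>n. real (Suc n) powr (-61/60))"
  have sm: "summable (\<lambda>n. real (Suc n) powr (-61/60))"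
    by (subst summable_Suc_iff) (simp add: summable_real_powr_iff)
  then have K: "K \<ge> 1" by (auto simp: K_def intro!: suminf_nonneg)
  show ?thesis
  proof (rule that[OF K])
    fix s :: complex assume s: "Re s \<ge> 59/60" "s \<noteq> 1"
    have s0: "Re s > 0" using s by simp
    have le: "norm (zeta_term (Suc n) s) \<le> norm (s - 1) * (2 * norm s powr (1/30)) * real (Suc n) powr (-61/60)" for n
    proof -
      have "norm (zeta_term (Suc n) s) \<le> norm (s - 1) * (2 * norm s powr (1/30) * real (Suc n) powr (- Re s - 1/30))"
        using norm_zeta_term_le[of "Suc n" s "1/30"] s0 by simp
      also have "\<dots> \<le> norm (s - 1) * (2 * norm s powr (1/30) * real (Suc n) powr (-61/60))"
        using s by (intro mult_left_mono powr_mono) auto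
      finally show ?thesis by (simp add: mult_ac)
    qed
    have "norm (\<Sum>n. zeta_term (Suc n) s) \<le> (\<Sum>n. norm (zeta_term (Suc n) s))"
      by (rule summable_norm[OF zeta_term_summable[OF s0]])
    also have "\<dots> \<le> (\<Sum>n. norm (s - 1) * (2 * norm s powr (1/30)) * real (Suc n) powr (-61/60))"
      by (intro suminf_le le zeta_term_summable s0 summable_mult sm)
    also have "\<dots> = norm (s - 1) * norm s powr (1/30) * (K - 1)"
      using suminf_mult[OF sm] by (simp add: K_def)
    also have "\<dots> \<le> norm (s - 1) * norm s powr (1/30) * K" by (intro mult_left_mono) auto
    finally have "norm (zeta_reg s) \<le> 1 + norm (s - 1) * norm s powr (1/30) * K"
      unfolding zeta_reg_def using norm_triangle_ineq[of 1 "\<Sum>n. zeta_term (Suc n) s"] by simp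
    then have "norm (zeta s) \<le> (1 + norm (s - 1) * norm s powr (1/30) * K) / norm (s - 1)"
      unfolding zeta_def norm_divide by (intro divide_right_mono) auto
    also have "\<dots> = 1 / norm (s - 1) + K * norm s powr (1/30)" using s by (simp add: field_simps)
    finally show "norm (zeta s) \<le> 1 / norm (s - 1) + K * norm s powr (1/30)" .
  qed
qed

section \<open>Lower bounds near the line Re s = 1\<close>


lemma zeta_field_derivative:
  assumes "Re s > 1"
  shows "(zeta has_field_derivative - (dser mangoldt s * zeta s)) (at s)"
proof (rule has_field_derivative_transform_within_open)
  show "(dser (\<lambda>n. 1) has_field_derivative - (dser mangoldt s * zeta s)) (at s)"
    using deriv_dser_one[OF assms] zeta_eq[OF assms] by simp
  show "open {s. Re s > 1}" by (rule open_halfspace_Re_gt)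
qed (use assms zeta_eq in auto)

lemma Re_of_nat_powr: "Re (of_nat n powr - Complex \<sigma> t) = real n powr (-\<sigma>) * cos (t * ln (real n))"
  by (cases "n = 0") (auto simp: powr_def Re_exp mult_ac simp del: exp_minus)

lemma mangoldt_341:
  assumes "\<sigma> > 1"
  shows "3 * Re (dser mangoldt (Complex \<sigma> 0)) + 4 * Re (dser mangoldt (Complex \<sigma> t))
       + Re (dser mangoldt (Complex \<sigma> (2 * t))) \<ge> 0"
proof -
  have S: "(\<lambda>n. mangoldt n * (real n powr (-\<sigma>) * cos (u * ln (real n)))) sums Re (dser mangoldt (Complex \<sigma> u))" for u
    using sums_Re[OF dser_sums[OF abs_conv_mangoldt, of "Complex \<sigma> u"]] assms by (simp add: Re_of_nat_powr)
  have "(\<lambda>n. 3 * (mangoldt n * (real n powr (-\<sigma>) * cos (0 * ln (real n)))) + 4 * (mangoldt n * (real n powr (-\<sigma>) * cos (t * ln (real n))))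
       + mangoldt n * (real n powr (-\<sigma>) * cos (2 * t * ln (real n))))
       sums (3 * Re (dser mangoldt (Complex \<sigma> 0)) + 4 * Re (dser mangoldt (Complex \<sigma> t)) + Re (dser mangoldt (Complex \<sigma> (2 * t))))"
    by (intro sums_add sums_mult S)
  note sum = this
  show ?thesis
  proof (rule sums_le[OF _ sums_zero sum])
    fix n
    have alg: "3 * (m * (r * 1)) + 4 * (m * (r * c)) + m * (r * (2 * c\<^sup>2 - 1)) = m * r * (2 * (1 + c)\<^sup>2)" for m r c :: real
      by (simp add: power2_eq_square algebra_simps)
    have "cos (2 * t * ln (real n)) = 2 * (cos (t * ln (real n)))\<^sup>2 - 1"
      using cos_double_cos[of "t * ln (real n)"] by (simp add: mult_ac)
    then have "3 * (mangoldt n * (real n powr (-\<sigma>) * cos (0 * ln (real n)))) + 4 * (mangoldt n * (real n powr (-\<sigma>) * cos (t * ln (real n))))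
       + mangoldt n * (real n powr (-\<sigma>) * cos (2 * t * ln (real n)))
       = mangoldt n * real n powr (-\<sigma>) * (2 * (1 + cos (t * ln (real n)))\<^sup>2)"
      using alg[of "mangoldt n" "real n powr (-\<sigma>)" "cos (t * ln (real n))"] by (simp only: mult_zero_left cos_zero)
    then show "0 \<le> 3 * (mangoldt n * (real n powr (-\<sigma>) * cos (0 * ln (real n)))) + 4 * (mangoldt n * (real n powr (-\<sigma>) * cos (t * ln (real n))))
       + mangoldt n * (real n powr (-\<sigma>) * cos (2 * t * ln (real n)))"
      by (simp add: mangoldt_nonneg)
  qed
qed

text \<open>The logarithmic derivative of |zeta|^2 along a horizontal line, written without a
  logarithm and hence without a choice of branch. Squaring makes the norm differentiable
  everywhere.\<close>

lemma norm_zeta_sq_derivative: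
  assumes "\<sigma> > 1"
  shows "((\<lambda>\<sigma>. (norm (zeta (Complex \<sigma> t)))\<^sup>2) has_real_derivative
          - 2 * Re (dser mangoldt (Complex \<sigma> t)) * (norm (zeta (Complex \<sigma> t)))\<^sup>2) (at \<sigma>)"
proof -
  define L Z where "L = dser mangoldt (Complex \<sigma> t)" and "Z = zeta (Complex \<sigma> t)"
  have "((\<lambda>\<sigma>. of_real \<sigma> + \<i> * of_real t) has_vector_derivative 1) (at \<sigma>)"
    by (auto intro!: derivative_eq_intros)
  then have "((\<lambda>\<sigma>. Complex \<sigma> t) has_vector_derivative 1) (at \<sigma>)"
    by (simp add: Complex_eq)
  from field_vector_diff_chain_at[OF this zeta_field_derivative] assms
  have z: "((\<lambda>\<sigma>. zeta (Complex \<sigma> t)) has_vector_derivative - (L * Z)) (at \<sigma>)"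
    by (simp add: o_def L_def Z_def)
  have re: "((\<lambda>\<sigma>. Re (zeta (Complex \<sigma> t))) has_real_derivative Re (- (L * Z))) (at \<sigma>)"
    unfolding has_real_derivative_iff_has_vector_derivative
    by (rule bounded_linear.has_vector_derivative[OF bounded_linear_Re z])
  have im: "((\<lambda>\<sigma>. Im (zeta (Complex \<sigma> t))) has_real_derivative Im (- (L * Z))) (at \<sigma>)"
    unfolding has_real_derivative_iff_has_vector_derivative
    by (rule bounded_linear.has_vector_derivative[OF bounded_linear_Im z])
  have "((\<lambda>\<sigma>. (Re (zeta (Complex \<sigma> t)))\<^sup>2 + (Im (zeta (Complex \<sigma> t)))\<^sup>2) has_real_derivative
     2 * Re (- (L * Z)) * Re Z + 2 * Im (- (L * Z)) * Im Z) (at \<sigma>)"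
    unfolding Z_def[symmetric]
    by (rule DERIV_cong[OF DERIV_add[OF DERIV_power[OF re] DERIV_power[OF im]]]) (simp add: Z_def algebra_simps)
  then show ?thesis unfolding cmod_power2 L_def[symmetric] Z_def[symmetric]
    by (rule DERIV_cong) (simp add: power2_eq_square algebra_simps Z_def)
qed

text \<open>The anchor of the monotonicity argument in \<open>zeta_341\<close>. The sum of n^-3 over
  n >= 2 is at most half the sum of n^-2, that is (pi^2/6 - 1)/2, and pi < 4 bounds this by
  5/6.\<close>

lemma norm_zeta_3: "norm (zeta (Complex 3 t)) \<ge> 1/6"
proof -
  let ?s = "Complex 3 t"
  have "(\<lambda>n. of_nat n powr (-?s)) sums zeta ?s"
    using dser_sums[OF abs_conv_one, of ?s] zeta_eq[of ?s] by simp
  then have "(\<lambda>n. of_nat (Suc n) powr (-?s)) sums zeta ?s" by (subst sums_Suc_iff) simp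
  then have s1: "(\<lambda>n. of_nat (Suc (Suc n)) powr (-?s)) sums (zeta ?s - 1)"
    using sums_Suc_iff[of "\<lambda>n. of_nat (Suc n) powr (-?s) :: complex" "zeta ?s - 1"] by simp
  have s2: "(\<lambda>n. 1 / 2 * (1 / (real (Suc n + 1))\<^sup>2)) sums (1 / 2 * (pi\<^sup>2 / 6 - 1))"
    using sums_Suc_iff[of "\<lambda>n. 1 / (real n + 1)\<^sup>2" "pi\<^sup>2 / 6 - 1"] inverse_squares_sums
    by (intro sums_mult) (simp add: add_ac)
  have "norm (zeta ?s - 1) \<le> 1 / 2 * (pi\<^sup>2 / 6 - 1)"
    unfolding sums_unique[OF s1] sums_unique[OF s2]
  proof (rule norm_suminf_le)
    fix n
    have "norm (of_nat (Suc (Suc n)) powr (-?s) :: complex) = 1 / real (Suc (Suc n)) ^ 3"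
      unfolding norm_of_nat_powr by (simp add: powr_minus powr_numeral divide_inverse del: of_nat_Suc)
    also have "\<dots> \<le> 1 / (2 * (real (Suc (Suc n)))\<^sup>2)"
    proof (rule divide_left_mono)
      show "2 * (real (Suc (Suc n)))\<^sup>2 \<le> real (Suc (Suc n)) ^ 3"
        unfolding power3_eq_cube power2_eq_square mult.assoc by (intro mult_right_mono) auto
    qed (auto simp del: of_nat_Suc)
    finally show "norm (of_nat (Suc (Suc n)) powr (-?s) :: complex) \<le> 1 / 2 * (1 / (real (Suc n + 1))\<^sup>2)"
      by simp
  qed (use s2 in \<open>simp add: sums_iff\<close>)
  moreover have "pi\<^sup>2 \<le> 4\<^sup>2" using pi_less_4 by (intro power_mono) auto
  ultimately have "norm (zeta ?s - 1) \<le> 5/6" by simp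
  then show ?thesis using norm_triangle_ineq2[of 1 "1 - zeta ?s"] by (simp add: norm_minus_commute)
qed

text \<open>The square \<open>P\<close> of the product has logarithmic derivative -2 times the sum
  in \<open>mangoldt_341\<close>, so it decreases in \<open>\<sigma>\<close> and can be compared
  with its value at 3. There each of the 3 + 4 + 1 = 8 factors is at least 1/6.\<close>

lemma zeta_341:
  assumes "1 < \<sigma>" "\<sigma> \<le> 3"
  shows "norm (zeta (Complex \<sigma> 0)) ^ 3 * norm (zeta (Complex \<sigma> t)) ^ 4 * norm (zeta (Complex \<sigma> (2 * t))) \<ge> (1/6) ^ 8"
proof -
  define N where "N = (\<lambda>t \<sigma>. (norm (zeta (Complex \<sigma> t)))\<^sup>2)"
  define L where "L = (\<lambda>t \<sigma>. Re (dser mangoldt (Complex \<sigma> t)))"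
  define P where "P = (\<lambda>\<sigma>. N 0 \<sigma> ^ 3 * N t \<sigma> ^ 4 * N (2 * t) \<sigma>)"
  have N: "(N t has_real_derivative - 2 * L t \<sigma> * N t \<sigma>) (at \<sigma>)" if "\<sigma> > 1" for t \<sigma>
    using norm_zeta_sq_derivative[OF that] by (simp add: N_def L_def)
  have "P 3 \<le> P \<sigma>"
  proof (rule DERIV_nonpos_imp_nonincreasing[OF assms(2)])
    fix x assume x: "\<sigma> \<le> x" "x \<le> 3"
    then have x1: "x > 1" using assms by simp
    have "(P has_real_derivative - 2 * (3 * L 0 x + 4 * L t x + L (2 * t) x) * P x) (at x)"
      unfolding P_def by (rule DERIV_cong[OF DERIV_mult[OF DERIV_mult[OF DERIV_power[OF N[OF x1]] DERIV_power[OF N[OF x1]]] N[OF x1]]])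
         (simp add: algebra_simps eval_nat_numeral)
    moreover have "- 2 * (3 * L 0 x + 4 * L t x + L (2 * t) x) * P x \<le> 0"
      using mangoldt_341[OF x1, of t] by (auto simp: L_def P_def N_def intro!: mult_nonpos_nonneg)
    ultimately show "\<exists>y. (P has_real_derivative y) (at x) \<and> y \<le> 0" by blast
  qed
  moreover have N3: "N t 3 \<ge> (1/6)\<^sup>2" for t
    unfolding N_def using norm_zeta_3 by (intro power_mono) auto
  have "((1/6)\<^sup>2) ^ 3 * ((1/6)\<^sup>2) ^ 4 * ((1/6)\<^sup>2) \<le> P 3"
    unfolding P_def by (intro mult_mono power_mono N3) (auto simp: N_def)
  moreover have "P \<sigma> = (norm (zeta (Complex \<sigma> 0)) ^ 3 * norm (zeta (Complex \<sigma> t)) ^ 4 * norm (zeta (Complex \<sigma> (2 * t))))\<^sup>2"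
    by (simp add: P_def N_def power_mult_distrib flip: power_mult)
  ultimately have "((1/6) ^ 8)\<^sup>2 \<le> (norm (zeta (Complex \<sigma> 0)) ^ 3 * norm (zeta (Complex \<sigma> t)) ^ 4 * norm (zeta (Complex \<sigma> (2 * t))))\<^sup>2"
    by (simp flip: power_mult power_add)
  then show ?thesis by (rule power2_le_imp_le) auto
qed

lemma zeta_real_le:
  obtains C :: real where "C \<ge> 1" "\<And>\<sigma>. 1 < \<sigma> \<Longrightarrow> \<sigma> \<le> 2 \<Longrightarrow> norm (zeta (Complex \<sigma> 0)) \<le> C / (\<sigma> - 1)"
proof -
  obtain K where K: "K \<ge> 1" "\<And>s. Re s \<ge> 59/60 \<Longrightarrow> s \<noteq> 1 \<Longrightarrow> norm (zeta s) \<le> 1 / norm (s - 1) + K * norm s powr (1/30)"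
    using zeta_growth by blast
  show ?thesis
  proof (rule that[of "1 + 2 * K"])
    fix \<sigma> :: real assume s: "1 < \<sigma>" "\<sigma> \<le> 2"
    have eq: "Complex \<sigma> 0 = of_real \<sigma>" by (simp add: complex_eq_iff)
    have "norm (zeta (Complex \<sigma> 0)) \<le> 1 / norm (Complex \<sigma> 0 - 1) + K * norm (Complex \<sigma> 0) powr (1/30)"
      using s by (intro K) (auto simp: complex_eq_iff)
    also have "norm (Complex \<sigma> 0 - 1) = \<sigma> - 1"
      unfolding eq using s by (metis abs_of_pos diff_gt_0_iff_gt norm_of_real of_real_1 of_real_diff)
    also have "norm (Complex \<sigma> 0) powr (1/30) \<le> 2"
    proof -
      have "norm (Complex \<sigma> 0) powr (1/30) \<le> 2 powr 1"
        unfolding eq norm_of_real using s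
        by (intro order.trans[OF powr_mono[of "1/30" 1] powr_mono2]) auto
      then show ?thesis by simp
    qed
    also have "1 / (\<sigma> - 1) + K * 2 \<le> 1 / (\<sigma> - 1) + 2 * K / (\<sigma> - 1)"
    proof -
      have "K * 2 * (\<sigma> - 1) \<le> 2 * K" using s K mult_left_le[of "\<sigma> - 1" "2 * K"] by (simp add: mult_ac)
      then show ?thesis using s by (simp add: pos_le_divide_eq)
    qed
    finally show "norm (zeta (Complex \<sigma> 0)) \<le> (1 + 2 * K) / (\<sigma> - 1)"
      using K by (simp add: add_divide_distrib)
  qed (use K in auto)
qed

lemma zeta_deriv_holomorphic: "deriv zeta holomorphic_on {s. Re s > 0} - {1}"
  by (intro holomorphic_deriv zeta_holomorphic open_Diff open_halfspace_Re_gt) auto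

lemma zeta_diff_le:
  assumes "convex S" "S \<subseteq> {s. Re s > 0} - {1}" "\<And>s. s \<in> S \<Longrightarrow> norm (deriv zeta s) \<le> M" "x \<in> S" "y \<in> S"
  shows "norm (zeta x - zeta y) \<le> M * norm (x - y)"
proof (rule field_differentiable_bound[OF assms(1) _ assms(3-5)])
  fix s assume "s \<in> S"
  moreover have "open ({s. Re s > 0} - {1::complex})" by (intro open_Diff open_halfspace_Re_gt) auto
  ultimately show "(zeta has_field_derivative deriv zeta s) (at s within S)"
    using holomorphic_derivI[OF zeta_holomorphic] assms(2) has_field_derivative_at_within by blast
qed

text \<open>For \<open>\<sigma> \<ge> 1 + \<eta>\<close> the inequality \<open>zeta_341\<close>
  applies, with the pole bounding its first factor; for smaller \<open>\<sigma>\<close> the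
  derivative bound carries the estimate over from \<open>1 + \<eta>\<close>. The bound
  \<open>M\<close> is left abstract because it is used twice: as a small power of t for large t, and
  as a compactness constant for a fixed t.\<close>

lemma zeta_lower:
  obtains c :: real where "c > 0"
    "\<And>t M \<sigma>. t \<noteq> 0 \<Longrightarrow> M \<ge> 1 \<Longrightarrow> (\<And>\<sigma>. 1 < \<sigma> \<Longrightarrow> \<sigma> \<le> 2 \<Longrightarrow> norm (zeta (Complex \<sigma> (2 * t))) \<le> M) \<Longrightarrow>
       (\<And>\<sigma>. 1 \<le> \<sigma> \<Longrightarrow> \<sigma> \<le> 2 \<Longrightarrow> norm (deriv zeta (Complex \<sigma> t)) \<le> M) \<Longrightarrow>
       1 \<le> \<sigma> \<Longrightarrow> \<sigma> \<le> 2 \<Longrightarrow> norm (zeta (Complex \<sigma> t)) \<ge> c / M ^ 4"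
proof -
  obtain C where C: "C \<ge> 1" "\<And>\<sigma>. 1 < \<sigma> \<Longrightarrow> \<sigma> \<le> 2 \<Longrightarrow> norm (zeta (Complex \<sigma> 0)) \<le> C / (\<sigma> - 1)"
    using zeta_real_le by blast
  define b where "b = (1/6) ^ 8 / C ^ 3"
  \<comment> \<open>With this choice the loss \<open>M * \<eta>\<close> is half of the lower bound
    \<open>b * \<kappa> ^ 3 / M ^ 4\<close> available at \<open>1 + \<eta>\<close>.\<close>
  define \<kappa> where "\<kappa> = b / 2"
  have b: "0 < b" "b \<le> 1"
  proof -
    have "1 \<le> C ^ 3" using C by simp
    then have "1 \<le> 1679616 * C ^ 3" by linarith
    then show "0 < b" "b \<le> 1" using C by (auto simp: b_def divide_simps power_one_over)
  qed
  show ?thesis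
  proof (rule that[of "b ^ 4 / 16"])
    fix t M \<sigma> :: real
    assume t: "t \<noteq> 0" and M: "M \<ge> 1" and z2: "\<And>\<sigma>. 1 < \<sigma> \<Longrightarrow> \<sigma> \<le> 2 \<Longrightarrow> norm (zeta (Complex \<sigma> (2 * t))) \<le> M"
      and z': "\<And>\<sigma>. 1 \<le> \<sigma> \<Longrightarrow> \<sigma> \<le> 2 \<Longrightarrow> norm (deriv zeta (Complex \<sigma> t)) \<le> M" and s: "1 \<le> \<sigma>" "\<sigma> \<le> 2"
    \<comment> \<open>Balances the two ranges: \<open>zeta_341\<close> gives |zeta|^4 >= b eta^3 /
      M, of order M^-16, so |zeta| is at least of order M^-4, and moving by eta changes zeta by at
      most M eta, also of order M^-4.\<close>
    define \<eta> where "\<eta> = \<kappa> ^ 4 / M ^ 5"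
    have \<kappa>: "0 < \<kappa>" "\<kappa> \<le> 1" using b by (auto simp: \<kappa>_def)
    have "\<kappa> ^ 4 \<le> 1" "1 \<le> M ^ 5" using \<kappa> M by (auto simp: power_le_one)
    then have "\<kappa> ^ 4 \<le> M ^ 5" by linarith
    then have \<eta>: "0 < \<eta>" "\<eta> \<le> 1" using \<kappa> M by (auto simp: \<eta>_def divide_simps)
    have big: "norm (zeta (Complex \<sigma>1 t)) \<ge> b * \<kappa> ^ 3 / M ^ 4" if s1: "1 + \<eta> \<le> \<sigma>1" "\<sigma>1 \<le> 2" for \<sigma>1
    proof -
      have s1': "\<sigma>1 > 1" using s1 \<eta> by simp
      have "(1/6) ^ 8 \<le> norm (zeta (Complex \<sigma>1 0)) ^ 3 * norm (zeta (Complex \<sigma>1 t)) ^ 4 * norm (zeta (Complex \<sigma>1 (2 * t)))"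
        using zeta_341[OF s1'] s1 by simp
      also have "\<dots> \<le> (C / \<eta>) ^ 3 * norm (zeta (Complex \<sigma>1 t)) ^ 4 * M"
      proof (intro mult_mono power_mono z2 s1' s1)
        have "C / (\<sigma>1 - 1) \<le> C / \<eta>" using s1 \<eta> C by (intro divide_left_mono) auto
        then show "norm (zeta (Complex \<sigma>1 0)) \<le> C / \<eta>" using C(2)[OF s1' s1(2)] by linarith
      qed (use C \<eta> M in auto)
      finally have "b * \<eta> ^ 3 / M \<le> norm (zeta (Complex \<sigma>1 t)) ^ 4"
        using C \<eta> M by (simp add: b_def field_simps)
      moreover have "(b * \<kappa> ^ 3 / M ^ 4) ^ 4 \<le> b * \<eta> ^ 3 / M"
      proof -
        have "(b * \<kappa> ^ 3 / M ^ 4) ^ 4 = b ^ 4 * (\<eta> ^ 3 / M)"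
          using M by (simp add: \<eta>_def power_mult_distrib power_divide field_simps flip: power_mult power_Suc power_add)
        also have "\<dots> \<le> b * (\<eta> ^ 3 / M)"
          using b \<eta> M power_decreasing[of 1 4 b] by (intro mult_right_mono) auto
        finally show ?thesis by simp
      qed
      ultimately show ?thesis using power_le_imp_le_base[of "b * \<kappa> ^ 3 / M ^ 4" 3 "norm (zeta (Complex \<sigma>1 t))"] by simp
    qed
    have M4: "b ^ 4 / 16 / M ^ 4 = b * \<kappa> ^ 3 / M ^ 4 - M * \<eta>"
      using M by (simp add: \<eta>_def \<kappa>_def field_simps eval_nat_numeral)
    show "norm (zeta (Complex \<sigma> t)) \<ge> b ^ 4 / 16 / M ^ 4"
    proof (cases "1 + \<eta> \<le> \<sigma>")
      case True
      have "0 \<le> M * \<eta>" using M \<eta> by simp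
      then show ?thesis using big[OF True s(2)] M4 by linarith
    next
      case False
      let ?S = "closed_segment (Complex \<sigma> t) (Complex (1 + \<eta>) t)"
      have S: "?S = {w. Re w \<in> closed_segment \<sigma> (1 + \<eta>) \<and> Im w = t}"
        using closed_segment_same_Im[of "Complex \<sigma> t" "Complex (1 + \<eta>) t"] by auto
      have "norm (zeta (Complex (1 + \<eta>) t) - zeta (Complex \<sigma> t)) \<le> M * norm (Complex (1 + \<eta>) t - Complex \<sigma> t)"
      proof (rule zeta_diff_le[of ?S])
        fix w assume "w \<in> ?S"
        then have w: "w = Complex (Re w) t" "\<sigma> \<le> Re w" "Re w \<le> 1 + \<eta>"
          using False unfolding S by (auto simp: closed_segment_eq_real_ivl complex_eq_iff)
        then show "norm (deriv zeta w) \<le> M" using z'[of "Re w"] s \<eta> by simp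
      next
        show "convex ?S" by (rule convex_closed_segment)
      qed (use s t \<eta> in \<open>auto simp: S closed_segment_eq_real_ivl\<close>)
      also have "norm (Complex (1 + \<eta>) t - Complex \<sigma> t) \<le> \<eta>"
        using False s by (simp add: complex_diff complex_norm)
      finally have "norm (zeta (Complex (1 + \<eta>) t) - zeta (Complex \<sigma> t)) \<le> M * \<eta>" using M by simp
      moreover have "norm (zeta (Complex (1 + \<eta>) t)) \<ge> b * \<kappa> ^ 3 / M ^ 4" using big[of "1 + \<eta>"] \<eta> by simp
      ultimately show ?thesis using M4 norm_triangle_ineq2[of "zeta (Complex (1 + \<eta>) t)" "zeta (Complex \<sigma> t)"] by linarith
    qed
  qed (use b in auto)
qed


section \<open>Polynomial bounds for zeta, its derivative and its reciprocal at large
  ordinates\<close>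

lemma powr_double_le:
  fixes x y :: real
  assumes "0 \<le> x" "x \<le> 2 * y" "0 \<le> a" "a \<le> 1"
  shows "x powr a \<le> 2 * y powr a"
proof -
  have "x powr a \<le> (2 * y) powr a" using assms by (intro powr_mono2) auto
  also have "\<dots> = 2 powr a * y powr a" using assms by (simp add: powr_mult)
  also have "\<dots> \<le> 2 powr 1 * y powr a" using assms by (intro mult_right_mono powr_mono) auto
  finally show ?thesis by simp
qed

lemma zeta_bound:
  obtains K :: real where "K \<ge> 1"
    "\<And>s. 59/60 \<le> Re s \<Longrightarrow> Re s \<le> 4 \<Longrightarrow> \<bar>Im s\<bar> \<ge> 1/2 \<Longrightarrow> norm (zeta s) \<le> K * (1 + \<bar>Im s\<bar>) powr (1/30)"
proof -
  obtain K where K: "K \<ge> 1" "\<And>s. Re s \<ge> 59/60 \<Longrightarrow> s \<noteq> 1 \<Longrightarrow> norm (zeta s) \<le> 1 / norm (s - 1) + K * norm s powr (1/30)"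
    using zeta_growth by blast
  show ?thesis
  proof (rule that[of "6 * K"])
    fix s assume s: "59/60 \<le> Re s" "Re s \<le> 4" "\<bar>Im s\<bar> \<ge> 1/2"
    define x where "x = (1 + \<bar>Im s\<bar>) powr (1/30)"
    have x: "x \<ge> 1" unfolding x_def by (intro ge_one_powr_ge_zero) auto
    have "\<bar>Im (s - 1)\<bar> \<le> norm (s - 1)" by (rule abs_Im_le_cmod)
    then have "1 / norm (s - 1) \<le> 1 / (1/2)" using s by (intro divide_left_mono) auto
    then have "1 / norm (s - 1) \<le> 2" by simp
    \<comment> \<open>Two doublings: |s| <= 4 + |Im s| is at most four times 1 + |Im s|. Together
      with the pole term, at most 2, this gives the constant 6.\<close>
    moreover have "norm s powr (1/30) \<le> 2 * (2 * (1 + \<bar>Im s\<bar>)) powr (1/30)"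
      using cmod_le[of s] s by (intro powr_double_le) auto
    moreover have "(2 * (1 + \<bar>Im s\<bar>)) powr (1/30) \<le> 2 * x"
      unfolding x_def by (intro powr_double_le) auto
    moreover have "norm (zeta s) \<le> 1 / norm (s - 1) + K * norm s powr (1/30)"
      using s by (intro K) auto
    moreover have "K * norm s powr (1/30) \<le> K * (4 * x)"
      using K calculation by (intro mult_left_mono) auto
    moreover have "2 \<le> 2 * K * x" using mult_mono[OF K(1) x] K x by simp
    ultimately show "norm (zeta s) \<le> 6 * K * (1 + \<bar>Im s\<bar>) powr (1/30)" unfolding x_def[symmetric] by linarith
  qed (use K in auto)
qed

text \<open>Cauchy's inequality on discs of radius 1/120, which reach from Re s >= 119/120 to Re s
  >= 59/60. The constant is 120 times the factor 2 lost by the change of |Im s| inside the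
  disc.\<close>

lemma zeta_deriv_bound:
  obtains K :: real where "K \<ge> 1"
    "\<And>s. 119/120 \<le> Re s \<Longrightarrow> Re s \<le> 3 \<Longrightarrow> \<bar>Im s\<bar> \<ge> 1 \<Longrightarrow> norm (deriv zeta s) \<le> K * (1 + \<bar>Im s\<bar>) powr (1/30)"
proof -
  obtain K where K: "K \<ge> 1"
    "\<And>s. 59/60 \<le> Re s \<Longrightarrow> Re s \<le> 4 \<Longrightarrow> \<bar>Im s\<bar> \<ge> 1/2 \<Longrightarrow> norm (zeta s) \<le> K * (1 + \<bar>Im s\<bar>) powr (1/30)"
    using zeta_bound by blast
  show ?thesis
  proof (rule that[of "240 * K"])
    fix s assume s: "119/120 \<le> Re s" "Re s \<le> 3" "\<bar>Im s\<bar> \<ge> 1"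
    have near: "Re s - 1/120 \<le> Re w \<and> Re w \<le> Re s + 1/120 \<and> \<bar>Im w\<bar> \<le> \<bar>Im s\<bar> + 1/120 \<and> \<bar>Im s\<bar> \<le> \<bar>Im w\<bar> + 1/120" if "norm (s - w) \<le> 1/120" for w
      using that abs_Re_le_cmod[of "s - w"] abs_Im_le_cmod[of "s - w"]
      unfolding minus_complex.simps by (intro conjI; linarith)
    have sub: "cball s (1/120) \<subseteq> {s. Re s > 0} - {1}"
    proof
      fix w assume "w \<in> cball s (1/120)"
      then have "norm (s - w) \<le> 1/120" by (simp add: dist_norm)
      from near[OF this] s show "w \<in> {s. Re s > 0} - {1}" by auto
    qed
    have hol: "zeta holomorphic_on cball s (1/120)" using zeta_holomorphic sub by (rule holomorphic_on_subset)
    have "norm ((deriv ^^ 1) zeta s) \<le> fact 1 * (K * (2 * (1 + \<bar>Im s\<bar>) powr (1/30))) / (1/120) ^ 1"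
    proof (rule Cauchy_inequality)
      show "zeta holomorphic_on ball s (1/120)" using hol by (rule holomorphic_on_subset) auto
      show "continuous_on (cball s (1/120)) zeta" using hol by (rule holomorphic_on_imp_continuous_on)
      fix w assume "norm (s - w) = 1/120"
      then have w: "Re s - 1/120 \<le> Re w \<and> Re w \<le> Re s + 1/120 \<and> \<bar>Im w\<bar> \<le> \<bar>Im s\<bar> + 1/120 \<and> \<bar>Im s\<bar> \<le> \<bar>Im w\<bar> + 1/120" using near[of w] by auto
      have "norm (zeta w) \<le> K * (1 + \<bar>Im w\<bar>) powr (1/30)" using w s by (intro K) auto
      also have "(1 + \<bar>Im w\<bar>) powr (1/30) \<le> 2 * (1 + \<bar>Im s\<bar>) powr (1/30)"
        using w s by (intro powr_double_le) auto
      finally show "norm (zeta w) \<le> K * (2 * (1 + \<bar>Im s\<bar>) powr (1/30))" using K by simp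
    qed auto
    then show "norm (deriv zeta s) \<le> 240 * K * (1 + \<bar>Im s\<bar>) powr (1/30)" by simp
  qed (use K in auto)
qed

text \<open>This is \<open>zeta_lower\<close> with M = B (1 + |t|)^(1/30), whose fourth power gives
  the exponent 4/30. In \<open>B\<close> the summand \<open>2 * K\<close> covers zeta at height 2t
  and \<open>K'\<close> covers the derivative.\<close>

lemma zeta_lower_bound:
  obtains c :: real where "c > 0"
    "\<And>s. 1 \<le> Re s \<Longrightarrow> Re s \<le> 2 \<Longrightarrow> \<bar>Im s\<bar> \<ge> 1 \<Longrightarrow> norm (zeta s) \<ge> c * (1 + \<bar>Im s\<bar>) powr (-4/30)"
proof -
  obtain K where K: "K \<ge> 1"
    "\<And>s. 59/60 \<le> Re s \<Longrightarrow> Re s \<le> 4 \<Longrightarrow> \<bar>Im s\<bar> \<ge> 1/2 \<Longrightarrow> norm (zeta s) \<le> K * (1 + \<bar>Im s\<bar>) powr (1/30)"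
    using zeta_bound by blast
  obtain K' where K': "K' \<ge> 1"
    "\<And>s. 119/120 \<le> Re s \<Longrightarrow> Re s \<le> 3 \<Longrightarrow> \<bar>Im s\<bar> \<ge> 1 \<Longrightarrow> norm (deriv zeta s) \<le> K' * (1 + \<bar>Im s\<bar>) powr (1/30)"
    using zeta_deriv_bound by blast
  obtain c where c: "c > 0" "\<And>t M \<sigma>. t \<noteq> 0 \<Longrightarrow> M \<ge> 1 \<Longrightarrow> (\<And>\<sigma>. 1 < \<sigma> \<Longrightarrow> \<sigma> \<le> 2 \<Longrightarrow> norm (zeta (Complex \<sigma> (2 * t))) \<le> M) \<Longrightarrow>
       (\<And>\<sigma>. 1 \<le> \<sigma> \<Longrightarrow> \<sigma> \<le> 2 \<Longrightarrow> norm (deriv zeta (Complex \<sigma> t)) \<le> M) \<Longrightarrow>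
       1 \<le> \<sigma> \<Longrightarrow> \<sigma> \<le> 2 \<Longrightarrow> norm (zeta (Complex \<sigma> t)) \<ge> c / M ^ 4"
    using zeta_lower by blast
  define B where "B = 2 * K + K'"
  show ?thesis
  proof (rule that[of "c / B ^ 4"])
    fix s assume s: "1 \<le> Re s" "Re s \<le> 2" "\<bar>Im s\<bar> \<ge> 1"
    define t where "t = Im s"
    define x where "x = (1 + \<bar>t\<bar>) powr (1/30)"
    have x: "x \<ge> 1" unfolding x_def by (intro ge_one_powr_ge_zero) auto
    have B: "B \<ge> 1" using K K' by (simp add: B_def)
    have "norm (zeta (Complex (Re s) t)) \<ge> c / (B * x) ^ 4"
    proof (rule c(2))
      show "B * x \<ge> 1" using mult_mono[OF B x] B by simp
      fix \<sigma> :: real assume \<sigma>: "1 < \<sigma>" "\<sigma> \<le> 2"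
      have "norm (zeta (Complex \<sigma> (2 * t))) \<le> K * (1 + \<bar>2 * t\<bar>) powr (1/30)"
        using K(2)[of "Complex \<sigma> (2 * t)"] \<sigma> s by (simp add: t_def)
      also have "(1 + \<bar>2 * t\<bar>) powr (1/30) \<le> 2 * x" unfolding x_def by (intro powr_double_le) auto
      also have "K * (2 * x) \<le> B * x" using K K' x by (simp add: B_def algebra_simps)
      finally show "norm (zeta (Complex \<sigma> (2 * t))) \<le> B * x" using K by simp
    next
      fix \<sigma> :: real assume \<sigma>: "1 \<le> \<sigma>" "\<sigma> \<le> 2"
      have "norm (deriv zeta (Complex \<sigma> t)) \<le> K' * x"
        using K'(2)[of "Complex \<sigma> t"] \<sigma> s by (simp add: t_def x_def)
      also have "\<dots> \<le> B * x" using K K' x by (simp add: B_def algebra_simps)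
      finally show "norm (deriv zeta (Complex \<sigma> t)) \<le> B * x" .
    qed (use s in \<open>auto simp: t_def\<close>)
    also have "(B * x) ^ 4 = B ^ 4 * (1 + \<bar>t\<bar>) powr (4/30)"
      by (simp add: x_def power_mult_distrib powr_power)
    also have "c / (B ^ 4 * (1 + \<bar>t\<bar>) powr (4/30)) = c / B ^ 4 * (1 + \<bar>t\<bar>) powr (-4/30)"
      using powr_minus_divide[of "1 + \<bar>t\<bar>" "4/30"] by simp
    finally show "norm (zeta s) \<ge> c / B ^ 4 * (1 + \<bar>Im s\<bar>) powr (-4/30)"
      by (simp add: t_def)
  qed (use K K' c in \<open>auto simp: B_def\<close>)
qed

section \<open>The second derivative of - zeta'/zeta - zeta\<close>

lemma higher_deriv_dser:
  assumes "abs_conv a" "Re s > 1"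
  shows "(deriv ^^ 2) (dser a) s = dser (\<lambda>n. a n * (ln (real n))\<^sup>2) s"
proof -
  have eq: "eventually (\<lambda>z. deriv (dser a) z = - dser (\<lambda>n. a n * ln (real n)) z) (nhds s)"
    using eventually_nhds_in_open[OF open_halfspace_Re_gt[of 1], of s] assms
    by (auto elim!: eventually_mono intro!: DERIV_imp_deriv dser_has_field_derivative)
  have "(deriv ^^ 2) (dser a) s = deriv (deriv (dser a)) s" by (simp add: numeral_2_eq_2)
  also have "\<dots> = deriv (\<lambda>z. - dser (\<lambda>n. a n * ln (real n)) z) s" by (rule deriv_cong_ev[OF eq refl])
  also have "\<dots> = dser (\<lambda>n. a n * ln (real n) * ln (real n)) s"
    using DERIV_minus[OF dser_has_field_derivative[OF abs_conv_ln[OF assms(1)] assms(2)]] by (intro DERIV_imp_deriv) simp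
  finally show ?thesis by (simp add: power2_eq_square mult.assoc)
qed

definition weighted_mangoldt :: "nat \<Rightarrow> real" where
  "weighted_mangoldt n = (mangoldt n - 1) * (ln (real n))\<^sup>2"

lemma second_deriv_dser_mangoldt:
  "Re s > 1 \<Longrightarrow> (deriv ^^ 2) (dser (\<lambda>n. mangoldt n - 1)) s = dser weighted_mangoldt s"
  unfolding weighted_mangoldt_def[abs_def]
  by (intro higher_deriv_dser abs_conv_diff abs_conv_mangoldt abs_conv_one)

lemma dser_mangoldt_eq:
  assumes "Re s > 1" "zeta s \<noteq> 0"
  shows "dser (\<lambda>n. mangoldt n - 1) s = - deriv zeta s / zeta s - zeta s"
proof -
  have "deriv zeta s = - (dser mangoldt s * zeta s)" by (rule DERIV_imp_deriv[OF zeta_field_derivative[OF assms(1)]])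
  then have "dser mangoldt s = - deriv zeta s / zeta s" using assms by (simp add: field_simps)
  then show ?thesis
    using dser_diff[OF abs_conv_mangoldt abs_conv_one assms(1)] zeta_eq[OF assms(1)] by simp
qed

lemma zeta_nonzero: "1 < Re s \<Longrightarrow> Re s \<le> 3 \<Longrightarrow> zeta s \<noteq> 0"
  using zeta_341[of "Re s" "Im s"] by auto

text \<open>Write x for (1 + |t|)^(1/30). On the closed disc of radius r = rho / x^5 around s, which
  may cross the line Re s = 1, zeta stays of size at least x^-4, so \<open>W\<close> is O(x * x^4) =
  O(x^5). Cauchy's inequality for the second derivative gives O(x^5 / r^2) = O(x^15).\<close>

lemma dser_second_deriv_large:
  obtains C :: real where "\<And>s. 1 < Re s \<Longrightarrow> Re s \<le> 2 \<Longrightarrow> \<bar>Im s\<bar> \<ge> 2 \<Longrightarrow>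
     norm (dser weighted_mangoldt s) \<le> C * (1 + \<bar>Im s\<bar>) powr (1/2)"
proof -
  obtain K where K: "K \<ge> 1"
    "\<And>s. 59/60 \<le> Re s \<Longrightarrow> Re s \<le> 4 \<Longrightarrow> \<bar>Im s\<bar> \<ge> 1/2 \<Longrightarrow> norm (zeta s) \<le> K * (1 + \<bar>Im s\<bar>) powr (1/30)"
    using zeta_bound by blast
  obtain K' where K': "K' \<ge> 1"
    "\<And>s. 119/120 \<le> Re s \<Longrightarrow> Re s \<le> 3 \<Longrightarrow> \<bar>Im s\<bar> \<ge> 1 \<Longrightarrow> norm (deriv zeta s) \<le> K' * (1 + \<bar>Im s\<bar>) powr (1/30)"
    using zeta_deriv_bound by blast
  obtain c where c: "c > 0"
    "\<And>s. 1 \<le> Re s \<Longrightarrow> Re s \<le> 2 \<Longrightarrow> \<bar>Im s\<bar> \<ge> 1 \<Longrightarrow> norm (zeta s) \<ge> c * (1 + \<bar>Im s\<bar>) powr (-4/30)"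
    using zeta_lower_bound by blast
  \<comment> \<open>The bound 1/120 keeps the disc inside the range of
    \<open>zeta_deriv_bound\<close>; the other one makes the variation of zeta over the disc at most
    half of its lower bound at the centre.\<close>
  define \<rho> where "\<rho> = min (1/120) (c / (4 * K'))"
  have \<rho>: "0 < \<rho>" "\<rho> \<le> 1/120" "K' * \<rho> \<le> c / 4" using c K'
  proof -
    have "K' * \<rho> \<le> K' * (c / (4 * K'))" using K' by (intro mult_left_mono) (auto simp: \<rho>_def)
    then show "K' * \<rho> \<le> c / 4" using K' by simp
  qed (use c K' in \<open>auto simp: \<rho>_def\<close>)
  define B where "B = 4 * K' / c + 2 * K"
  show ?thesis
  proof (rule that[of "2 * B / \<rho>\<^sup>2"])
    fix s assume s: "1 < Re s" "Re s \<le> 2" "\<bar>Im s\<bar> \<ge> 2"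
    define \<tau> where "\<tau> = 1 + \<bar>Im s\<bar>"
    define x where "x = \<tau> powr (1/30)"
    have \<tau>: "\<tau> \<ge> 1" by (simp add: \<tau>_def)
    have x: "x \<ge> 1" unfolding x_def using \<tau> by (intro ge_one_powr_ge_zero) auto
    have x4: "\<tau> powr (-4/30) = 1 / x ^ 4" using powr_minus_divide[of \<tau> "4/30"] \<tau> by (simp add: x_def powr_power)
    \<comment> \<open>Since zeta' is O(x) and |zeta(s)| is at least of order x^-4, the radius must
      be of order x^-5 to keep zeta away from 0.\<close>
    define r where "r = \<rho> / x ^ 5"
    have r: "0 < r" "r \<le> 1/120"
      using \<rho> x order.trans[OF divide_left_mono[of 1 "x ^ 5" \<rho>], of "1/120"] by (auto simp: r_def)
    have near: "Re s - 1/120 \<le> Re w \<and> Re w \<le> Re s + 1/120 \<and> \<bar>Im w\<bar> \<le> \<bar>Im s\<bar> + 1/120 \<and> \<bar>Im s\<bar> \<le> \<bar>Im w\<bar> + 1/120" if "w \<in> cball s r" for w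
      using that r abs_Re_le_cmod[of "s - w"] abs_Im_le_cmod[of "s - w"]
      unfolding minus_complex.simps mem_cball dist_norm by (intro conjI; linarith)
    have \<tau>w: "(1 + \<bar>Im w\<bar>) powr (1/30) \<le> 2 * x" if "w \<in> cball s r" for w
      unfolding x_def \<tau>_def using near[OF that] by (intro powr_double_le) auto
    have z': "norm (deriv zeta w) \<le> 2 * K' * x" if "w \<in> cball s r" for w
    proof -
      have "norm (deriv zeta w) \<le> K' * (1 + \<bar>Im w\<bar>) powr (1/30)"
        using near[OF that] s by (intro K') auto
      also have "\<dots> \<le> K' * (2 * x)" using \<tau>w[OF that] K' by (intro mult_left_mono) auto
      finally show ?thesis by simp
    qed
    have z: "norm (zeta w) \<le> 2 * K * x" if "w \<in> cball s r" for w
    proof -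
      have "norm (zeta w) \<le> K * (1 + \<bar>Im w\<bar>) powr (1/30)"
        using near[OF that] s by (intro K) auto
      also have "\<dots> \<le> K * (2 * x)" using \<tau>w[OF that] K by (intro mult_left_mono) auto
      finally show ?thesis by simp
    qed
    have sub: "cball s r \<subseteq> {s. Re s > 0} - {1}"
      using near s by fastforce
    have low: "norm (zeta w) \<ge> c / 2 / x ^ 4" if w: "w \<in> cball s r" for w
    proof -
      have "norm (zeta s - zeta w) \<le> 2 * K' * x * norm (s - w)"
        by (rule zeta_diff_le[OF convex_cball sub z']) (use w r in auto)
      also have "\<dots> \<le> 2 * K' * x * r" using w x K' by (intro mult_left_mono) (auto simp: dist_norm)
      also have "\<dots> = 2 * (K' * \<rho>) / x ^ 4" using x by (simp add: r_def field_simps eval_nat_numeral)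
      also have "\<dots> \<le> 2 * (c / 4) / x ^ 4" using \<rho> x by (intro divide_right_mono mult_left_mono) auto
      finally have "norm (zeta s - zeta w) \<le> c / 2 / x ^ 4" by simp
      moreover have "norm (zeta s) \<ge> c / x ^ 4" using c(2)[of s] s x4 by (simp add: \<tau>_def)
      moreover have "c / x ^ 4 = c / 2 / x ^ 4 + c / 2 / x ^ 4" by (simp flip: add_divide_distrib)
      moreover have "norm (zeta s) - norm (zeta s - zeta w) \<le> norm (zeta w)"
        using norm_triangle_ineq2[of "zeta s" "zeta s - zeta w"] by simp
      ultimately show ?thesis by linarith
    qed
    have nz: "zeta w \<noteq> 0" if "w \<in> cball s r" for w
    proof -
      have "0 < c / 2 / x ^ 4" using c x by simp
      with low[OF that] show ?thesis by auto
    qed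
    define W where "W = (\<lambda>w. - deriv zeta w / zeta w - zeta w)"
    have hol: "W holomorphic_on cball s r"
      unfolding W_def using nz holomorphic_on_subset[OF zeta_holomorphic sub] holomorphic_on_subset[OF zeta_deriv_holomorphic sub]
      by (intro holomorphic_on_diff holomorphic_on_divide holomorphic_on_minus) auto
    have "norm ((deriv ^^ 2) W s) \<le> fact 2 * (B * x ^ 5) / r ^ 2"
    proof (rule Cauchy_inequality)
      show "W holomorphic_on ball s r" using hol by (rule holomorphic_on_subset) auto
      show "continuous_on (cball s r) W" using hol by (rule holomorphic_on_imp_continuous_on)
      fix w assume "norm (s - w) = r"
      then have w: "w \<in> cball s r" by (simp add: dist_norm)
      have "norm (W w) \<le> norm (deriv zeta w) / norm (zeta w) + norm (zeta w)"
        unfolding W_def using norm_triangle_ineq4[of "- deriv zeta w / zeta w" "zeta w"] by (simp add: norm_divide)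
      also have "norm (deriv zeta w) / norm (zeta w) \<le> (2 * K' * x) / (c / 2 / x ^ 4)"
        using z'[OF w] low[OF w] c x K' by (intro frac_le) auto
      also have "\<dots> = 4 * K' / c * x ^ 5" using c x by (simp add: field_simps eval_nat_numeral)
      also have "norm (zeta w) \<le> 2 * K * x ^ 5"
      proof -
        have "x \<le> x ^ 5" using power_increasing[of 1 5 x] x by simp
        then have "2 * K * x \<le> 2 * K * x ^ 5" using K(1) by (intro mult_left_mono) auto
        with z[OF w] show ?thesis by linarith
      qed
      finally show "norm (W w) \<le> B * x ^ 5" by (simp add: B_def algebra_simps)
    qed (use r in auto)
    also have "fact 2 * (B * x ^ 5) / r ^ 2 = 2 * B / \<rho>\<^sup>2 * x ^ 15"
      using x \<rho> by (simp add: r_def field_simps flip: power_mult power_add)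
    also have "x ^ 15 = \<tau> powr (1/2)" using \<tau> by (simp add: x_def powr_power)
    also have "(deriv ^^ 2) W s = (deriv ^^ 2) (dser (\<lambda>n. mangoldt n - 1)) s"
    proof (rule higher_deriv_cong_ev[OF _ refl])
      have "eventually (\<lambda>w. w \<in> {w. Re w > 1} \<inter> {w. Re w < 3}) (nhds s)"
        using s by (intro eventually_nhds_in_open open_Int open_halfspace_Re_gt open_halfspace_Re_lt) auto
      then show "eventually (\<lambda>w. W w = dser (\<lambda>n. mangoldt n - 1) w) (nhds s)"
        by (rule eventually_mono) (use zeta_nonzero in \<open>auto simp: W_def dser_mangoldt_eq\<close>)
    qed
    also have "\<dots> = dser weighted_mangoldt s"
      using s by (intro second_deriv_dser_mangoldt)
    finally show "norm (dser weighted_mangoldt s) \<le> 2 * B / \<rho>\<^sup>2 * (1 + \<bar>Im s\<bar>) powr (1/2)"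
      by (simp add: \<tau>_def)
  qed
qed


section \<open>Non-vanishing on the line Re s = 1 and the bound at small ordinates\<close>

lemma zeta_reg_nonzero:
  assumes "1 \<le> Re s" "Re s \<le> 2"
  shows "zeta_reg s \<noteq> 0"
proof -
  consider "s = 1" | "Im s = 0" "Re s > 1" | "Im s \<noteq> 0"
    using assms by (cases "Im s = 0"; cases "Re s = 1") (auto simp: complex_eq_iff)
  then show ?thesis
  proof cases
    case 1
    then show ?thesis by (simp add: zeta_reg_1)
  next
    case 2
    then show ?thesis using zeta_nonzero[of s] assms by (auto simp: zeta_def)
  next
    case 3
    obtain c where c: "c > 0" "\<And>t M \<sigma>. t \<noteq> 0 \<Longrightarrow> M \<ge> 1 \<Longrightarrow> (\<And>\<sigma>. 1 < \<sigma> \<Longrightarrow> \<sigma> \<le> 2 \<Longrightarrow> norm (zeta (Complex \<sigma> (2 * t))) \<le> M) \<Longrightarrow>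
       (\<And>\<sigma>. 1 \<le> \<sigma> \<Longrightarrow> \<sigma> \<le> 2 \<Longrightarrow> norm (deriv zeta (Complex \<sigma> t)) \<le> M) \<Longrightarrow>
       1 \<le> \<sigma> \<Longrightarrow> \<sigma> \<le> 2 \<Longrightarrow> norm (zeta (Complex \<sigma> t)) \<ge> c / M ^ 4"
      using zeta_lower by blast
    \<comment> \<open>At a fixed height other than 0 the part 1 <= Re s <= 2 is a compact segment
      that avoids the pole. This supplies the constant \<open>M\<close> that
      \<open>zeta_lower\<close> asks for.\<close>
    have bdd: "\<exists>M. \<forall>\<sigma>. 1 \<le> \<sigma> \<and> \<sigma> \<le> 2 \<longrightarrow> norm (f (Complex \<sigma> u)) \<le> M"
      if "f holomorphic_on {s. Re s > 0} - {1}" "u \<noteq> 0" for f u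
    proof -
      have S: "closed_segment (Complex 1 u) (Complex 2 u) = {w. Re w \<in> {1..2} \<and> Im w = u}"
        using closed_segment_same_Im[of "Complex 1 u" "Complex 2 u"] by (auto simp: closed_segment_eq_real_ivl)
      have "continuous_on (closed_segment (Complex 1 u) (Complex 2 u)) f"
        using that by (intro holomorphic_on_imp_continuous_on holomorphic_on_subset[OF that(1)]) (auto simp: S)
      then have "bounded (f ` closed_segment (Complex 1 u) (Complex 2 u))"
        by (intro compact_imp_bounded compact_continuous_image compact_segment)
      then obtain M where "\<forall>w \<in> closed_segment (Complex 1 u) (Complex 2 u). norm (f w) \<le> M"
        by (auto simp: bounded_iff)
      then show ?thesis by (intro exI[of _ M]) (auto simp: S)
    qed
    obtain M1 where M1: "\<And>\<sigma>. 1 \<le> \<sigma> \<Longrightarrow> \<sigma> \<le> 2 \<Longrightarrow> norm (zeta (Complex \<sigma> (2 * Im s))) \<le> M1"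
      using bdd[OF zeta_holomorphic, of "2 * Im s"] 3 by auto
    obtain M2 where M2: "\<And>\<sigma>. 1 \<le> \<sigma> \<Longrightarrow> \<sigma> \<le> 2 \<Longrightarrow> norm (deriv zeta (Complex \<sigma> (Im s))) \<le> M2"
      using bdd[OF zeta_deriv_holomorphic, of "Im s"] 3 by auto
    define M where "M = max 1 (max M1 M2)"
    have "norm (zeta (Complex (Re s) (Im s))) \<ge> c / M ^ 4"
      using M1 M2 3 assms by (intro c(2)) (force simp: M_def le_max_iff_disj)+
    moreover have "c / M ^ 4 > 0" using c by (simp add: M_def)
    ultimately have "zeta s \<noteq> 0" by auto
    then show ?thesis by (auto simp: zeta_def)
  qed
qed

text \<open>With g = \<open>zeta_reg\<close>, the function - zeta'/zeta - zeta equals - g'/g - (g -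
  1)/(z - 1): the pole 1/(z - 1) of the first term is absorbed. As g(1) = 1 and g has no zero for 1
  <= Re s <= 2, this is holomorphic near the compact rectangle \<open>R\<close>, including its left
  side.\<close>

lemma dser_second_deriv_small:
  obtains C :: real where "\<And>s. 1 < Re s \<Longrightarrow> Re s \<le> 2 \<Longrightarrow> \<bar>Im s\<bar> \<le> 2 \<Longrightarrow>
     norm (dser weighted_mangoldt s) \<le> C"
proof -
  define S where "S = {s. Re s > 0}"
  have S: "open S" by (simp add: S_def open_halfspace_Re_gt)
  define U where "U = S \<inter> zeta_reg -` (- {0})"
  have U: "open U" unfolding U_def
    using zeta_reg_holomorphic S by (intro continuous_open_preimage holomorphic_on_imp_continuous_on) (auto simp: S_def)
  \<comment> \<open>The difference quotient of \<open>zeta_reg\<close> at 1, with its removable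
    singularity filled in by the derivative.\<close>
  define q where "q = (\<lambda>z. if z = 1 then deriv zeta_reg 1 else (zeta_reg z - zeta_reg 1) / (z - 1))"
  define W where "W = (\<lambda>z. - deriv zeta_reg z / zeta_reg z - q z)"
  have hol: "zeta_reg holomorphic_on S" using zeta_reg_holomorphic by (simp add: S_def)
  have "q holomorphic_on S"
    unfolding q_def using S by (intro pole_lemma hol) (auto simp: interior_open S_def)
  moreover have "deriv zeta_reg holomorphic_on S" by (rule holomorphic_deriv[OF hol S])
  moreover have "U \<subseteq> S" by (auto simp: U_def)
  ultimately have "W holomorphic_on U"
    unfolding W_def using holomorphic_on_subset hol
    by (intro holomorphic_on_diff holomorphic_on_divide holomorphic_on_minus) (auto simp: U_def intro: holomorphic_on_subset)
  then have hW: "(deriv ^^ 2) W holomorphic_on U" by (intro holomorphic_higher_deriv U)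
  define R where "R = cbox (Complex 1 (-2)) (Complex 2 2)"
  have R: "R = {s. 1 \<le> Re s \<and> Re s \<le> 2 \<and> -2 \<le> Im s \<and> Im s \<le> 2}"
    by (auto simp: R_def in_cbox_complex_iff)
  have "R \<subseteq> U" unfolding U_def S_def R using zeta_reg_nonzero by auto
  then have "continuous_on R ((deriv ^^ 2) W)"
    by (intro holomorphic_on_imp_continuous_on holomorphic_on_subset[OF hW])
  then have "bounded ((deriv ^^ 2) W ` R)"
    unfolding R_def by (intro compact_imp_bounded compact_continuous_image compact_cbox)
  then obtain C where C: "\<And>s. s \<in> R \<Longrightarrow> norm ((deriv ^^ 2) W s) \<le> C" by (auto simp: bounded_iff)
  show ?thesis
  proof (rule that)
    fix s assume s: "1 < Re s" "Re s \<le> 2" "\<bar>Im s\<bar> \<le> 2"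
    have "(deriv ^^ 2) W s = (deriv ^^ 2) (dser (\<lambda>n. mangoldt n - 1)) s"
    proof (rule higher_deriv_cong_ev[OF _ refl])
      have "eventually (\<lambda>w. w \<in> {w. Re w > 1} \<inter> {w. Re w < 3}) (nhds s)"
        using s by (intro eventually_nhds_in_open open_Int open_halfspace_Re_gt open_halfspace_Re_lt) auto
      then show "eventually (\<lambda>w. W w = dser (\<lambda>n. mangoldt n - 1) w) (nhds s)"
      proof (rule eventually_mono)
        fix w :: complex assume "w \<in> {w. Re w > 1} \<inter> {w. Re w < 3}"
        then have w: "Re w > 1" "Re w \<le> 3" by auto
        then have w1: "w \<noteq> 1" "w - 1 \<noteq> 0" by auto
        have z: "zeta w \<noteq> 0" using zeta_nonzero w by auto
        then have g: "zeta_reg w \<noteq> 0" by (auto simp: zeta_def)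
        have "(zeta_reg has_field_derivative deriv zeta_reg w) (at w)"
          using holomorphic_derivI[OF hol S] w by (auto simp: S_def)
        then have "((\<lambda>z. zeta_reg z / (z - 1)) has_field_derivative
           (deriv zeta_reg w * (w - 1) - zeta_reg w * 1) / ((w - 1) * (w - 1))) (at w)"
          using w1 by (auto intro!: derivative_eq_intros)
        then have d: "deriv zeta w = (deriv zeta_reg w * (w - 1) - zeta_reg w) / ((w - 1) * (w - 1))"
          by (intro DERIV_imp_deriv) (simp add: zeta_def[abs_def])
        show "W w = dser (\<lambda>n. mangoldt n - 1) w"
          unfolding dser_mangoldt_eq[OF w(1) z] d W_def q_def
          using w1 g by (simp add: zeta_def zeta_reg_1 divide_simps) (simp add: algebra_simps)
      qed
    qed
    also have "\<dots> = dser weighted_mangoldt s"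
      using s by (intro second_deriv_dser_mangoldt)
    finally show "norm (dser weighted_mangoldt s) \<le> C"
      using C[of s] s by (auto simp: R abs_le_iff)
  qed
qed

lemma dser_second_deriv_bound:
  obtains C :: real where "C > 0" "\<And>s. 1 < Re s \<Longrightarrow> Re s \<le> 2 \<Longrightarrow>
     norm (dser weighted_mangoldt s) \<le> C * (1 + \<bar>Im s\<bar>) powr (1/2)"
proof -
  obtain C1 where C1: "\<And>s. 1 < Re s \<Longrightarrow> Re s \<le> 2 \<Longrightarrow> \<bar>Im s\<bar> \<le> 2 \<Longrightarrow> norm (dser weighted_mangoldt s) \<le> C1"
    using dser_second_deriv_small by blast
  obtain C2 where C2: "\<And>s. 1 < Re s \<Longrightarrow> Re s \<le> 2 \<Longrightarrow> \<bar>Im s\<bar> \<ge> 2 \<Longrightarrow> norm (dser weighted_mangoldt s) \<le> C2 * (1 + \<bar>Im s\<bar>) powr (1/2)"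
    using dser_second_deriv_large by blast
  show ?thesis
  proof (rule that[of "max 1 (max C1 C2)"])
    fix s assume s: "1 < Re s" "Re s \<le> 2"
    have x: "(1 + \<bar>Im s\<bar>) powr (1/2) \<ge> 1" by (intro ge_one_powr_ge_zero) auto
    have m: "max 1 (max C1 C2) \<le> max 1 (max C1 C2) * (1 + \<bar>Im s\<bar>) powr (1/2)"
      using mult_left_mono[OF x, of "max 1 (max C1 C2)"] by simp
    show "norm (dser weighted_mangoldt s) \<le> max 1 (max C1 C2) * (1 + \<bar>Im s\<bar>) powr (1/2)"
    proof (cases "\<bar>Im s\<bar> \<le> 2")
      case True
      with C1[OF s True] m show ?thesis by linarith
    next
      case False
      then have "norm (dser weighted_mangoldt s) \<le> C2 * (1 + \<bar>Im s\<bar>) powr (1/2)" using C2[OF s] by simp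
      also have "\<dots> \<le> max 1 (max C1 C2) * (1 + \<bar>Im s\<bar>) powr (1/2)" by (intro mult_right_mono) auto
      finally show ?thesis .
    qed
  qed auto
qed

section \<open>Perron's formula\<close>


lemma contour_integral_rectpath:
  assumes "continuous_on (path_image (rectpath a b)) f"
  shows "contour_integral (rectpath a b) f =
      contour_integral (linepath a (Complex (Re b) (Im a))) f + contour_integral (linepath (Complex (Re b) (Im a)) b) f
    + contour_integral (linepath b (Complex (Re a) (Im b))) f + contour_integral (linepath (Complex (Re a) (Im b)) a) f"
proof -
  define c d where "c = Complex (Re b) (Im a)" and "d = Complex (Re a) (Im b)"
  have r: "rectpath a b = linepath a c +++ linepath c b +++ linepath b d +++ linepath d a"
    by (simp add: rectpath_def Let_def c_def d_def)
  have "path_image (rectpath a b) = closed_segment a c \<union> closed_segment c b \<union> closed_segment b d \<union> closed_segment d a"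
    unfolding r by (auto simp: path_image_join)
  with assms have "f contour_integrable_on linepath a c" "f contour_integrable_on linepath c b"
      "f contour_integrable_on linepath b d" "f contour_integrable_on linepath d a"
    by (auto intro!: contour_integrable_continuous_linepath elim: continuous_on_subset)
  then show ?thesis unfolding r c_def[symmetric] d_def[symmetric] by (simp add: add.assoc)
qed

text \<open>The integral along a vertical line to the right of 0 is 2 pi i times max(0, 1 - 1/y).
  The weight is continuous at y = 1, and in return the kernel decays like t^-2 and is absolutely
  integrable.\<close>

definition perron_kernel :: "real \<Rightarrow> complex \<Rightarrow> complex" where
  "perron_kernel y s = of_real y powr s / (s * (s + 1))"

lemma norm_perron_kernel: "y \<ge> 0 \<Longrightarrow> norm (perron_kernel y s) = y powr Re s / (norm s * norm (s + 1))"
  using norm_powr_real_powr[of "of_real y" s] by (simp add: perron_kernel_def norm_divide norm_mult)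

text \<open>On the side Re s = -T the point s + 1 may be only T - 1 away from 0, whence the weaker
  hypothesis on it; T >= 2 turns T - 1 into T/2, the source of the factor 2.\<close>

lemma perron_kernel_le:
  assumes "y \<ge> 0" "y powr Re s \<le> A" "norm s \<ge> T" "norm (s + 1) \<ge> T - 1" "T \<ge> 2"
  shows "norm (perron_kernel y s) \<le> 2 * A / T\<^sup>2"
proof -
  have A: "0 \<le> A" using assms(2) powr_ge_zero order.trans by blast
  have "T / 2 \<le> norm (s + 1)" using assms by linarith
  then have "T * (T / 2) \<le> norm s * norm (s + 1)"
    using assms by (intro mult_mono) auto
  then have "norm (perron_kernel y s) \<le> A / (T * (T / 2))"
    unfolding norm_perron_kernel[OF assms(1)] using assms A by (intro frac_le) auto
  then show ?thesis by (simp add: power2_eq_square mult.commute)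
qed

lemma perron_kernel_holomorphic: "y > 0 \<Longrightarrow> perron_kernel y holomorphic_on - {0, -1}"
  unfolding perron_kernel_def by (intro holomorphic_intros) (auto simp: add_eq_0_iff2)

text \<open>For y >= 1 the contour is closed to the left, where y^(Re s) is largest at the abscissa
  \<open>\<sigma>\<close>. The partial fractions 1/s - 1/(s + 1) reduce the rectangle to two
  applications of Cauchy's formula, with values 1 at 0 and 1/y at -1. The other three sides have
  total length at most 6T.\<close>

lemma perron_large:
  assumes y: "y \<ge> 1" and s: "1 < \<sigma>" "\<sigma> \<le> 2" and T: "T \<ge> 2"
  shows "norm (contour_integral (linepath (Complex \<sigma> (-T)) (Complex \<sigma> T)) (perron_kernel y) - 2 * of_real pi * \<i> * of_real (1 - 1 / y))
     \<le> 12 * y powr \<sigma> / T"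
proof -
  define a b where "a = Complex (-T) (-T)" and "b = Complex \<sigma> T"
  define f where "f = perron_kernel y"
  have img: "path_image (rectpath a b) = {z. Re z \<in> {-T, \<sigma>} \<and> Im z \<in> {-T..T}} \<union> {z. Im z \<in> {-T, T} \<and> Re z \<in> {-T..\<sigma>}}"
    unfolding a_def b_def using s T by (subst path_image_rectpath) auto
  have cont: "continuous_on (path_image (rectpath a b)) f"
    unfolding f_def using y s T
    by (intro holomorphic_on_imp_continuous_on holomorphic_on_subset[OF perron_kernel_holomorphic]) (auto simp: img)
  define g where "g = (\<lambda>s. of_real y powr s :: complex)"
  have g: "g holomorphic_on UNIV" unfolding g_def by (intro holomorphic_intros)
  have "((\<lambda>w. g w / (w - 0)) has_contour_integral (2 * pi * \<i> * winding_number (rectpath a b) 0 * g 0)) (rectpath a b)"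
    using s T by (intro Cauchy_integral_formula_convex_simple[OF convex_UNIV g]) (auto simp: img)
  moreover have "winding_number (rectpath a b) 0 = 1"
    using s T by (intro winding_number_rectpath) (auto simp: a_def b_def in_box_complex_iff)
  ultimately have i0: "((\<lambda>w. g w / w) has_contour_integral (2 * pi * \<i>)) (rectpath a b)"
    using y by (simp add: g_def)
  have "((\<lambda>w. g w / (w - (-1))) has_contour_integral (2 * pi * \<i> * winding_number (rectpath a b) (-1) * g (-1))) (rectpath a b)"
    using s T by (intro Cauchy_integral_formula_convex_simple[OF convex_UNIV g]) (auto simp: img)
  moreover have "winding_number (rectpath a b) (-1) = 1"
    using s T by (intro winding_number_rectpath) (auto simp: a_def b_def in_box_complex_iff)
  moreover have "g (-1) = of_real (1 / y)" unfolding g_def using y by (simp add: powr_minus divide_inverse)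
  ultimately have i1: "((\<lambda>w. g w / (w + 1)) has_contour_integral (2 * pi * \<i> * of_real (1 / y))) (rectpath a b)"
    by simp
  have "((\<lambda>w. g w / w - g w / (w + 1)) has_contour_integral (2 * pi * \<i> - 2 * pi * \<i> * of_real (1 / y))) (rectpath a b)"
    by (rule has_contour_integral_diff[OF i0 i1])
  then have "(f has_contour_integral (2 * pi * \<i> - 2 * pi * \<i> * of_real (1 / y))) (rectpath a b)"
  proof (rule has_contour_integral_eq)
    fix w assume "w \<in> path_image (rectpath a b)"
    then have "w \<noteq> 0" "w + 1 \<noteq> 0" using s T by (auto simp: img complex_eq_iff)
    then show "g w / w - g w / (w + 1) = f w"
      by (simp add: f_def perron_kernel_def g_def divide_simps) (simp add: algebra_simps)
  qed
  then have tot: "contour_integral (rectpath a b) f = 2 * pi * \<i> * of_real (1 - 1 / y)"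
    by (intro contour_integral_unique) (simp add: algebra_simps)
  define B where "B = 2 * y powr \<sigma> / T\<^sup>2"
  have B: "B \<ge> 0" by (simp add: B_def)
  have le: "norm (f w) \<le> B" if "w \<in> path_image (rectpath a b)" "\<bar>Im w\<bar> = T \<or> Re w = -T" for w
    unfolding f_def B_def
  proof (rule perron_kernel_le)
    show "y powr Re w \<le> y powr \<sigma>" using that y s T by (intro powr_mono) (auto simp: img)
    show "T \<le> norm w" using that(2) T abs_Re_le_cmod[of w] abs_Im_le_cmod[of w] by auto
    show "T - 1 \<le> norm (w + 1)" using that(2) T abs_Re_le_cmod[of "w + 1"] abs_Im_le_cmod[of "w + 1"] by auto
  qed (use y T in auto)
  have seg: "norm (contour_integral (linepath u v) f) \<le> B * norm (v - u)"
    if "closed_segment u v \<subseteq> path_image (rectpath a b)" "\<And>w. w \<in> closed_segment u v \<Longrightarrow> \<bar>Im w\<bar> = T \<or> Re w = -T" for u v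
    by (rule contour_integral_bound_linepath[OF contour_integrable_continuous_linepath B])
       (use that le cont in \<open>auto elim: continuous_on_subset\<close>)
  have s1: "norm (contour_integral (linepath a (Complex \<sigma> (-T))) f) \<le> B * (\<sigma> + T)"
    using seg[of a "Complex \<sigma> (-T)"] s T
    by (auto simp: a_def b_def img[unfolded a_def b_def] closed_segment_same_Im closed_segment_eq_real_ivl complex_norm complex_diff)
  have s2: "norm (contour_integral (linepath b (Complex (-T) T)) f) \<le> B * (\<sigma> + T)"
    using seg[of b "Complex (-T) T"] s T
    by (auto simp: a_def b_def img[unfolded a_def b_def] closed_segment_same_Im closed_segment_eq_real_ivl complex_norm complex_diff abs_if)
  have s3: "norm (contour_integral (linepath (Complex (-T) T) a) f) \<le> B * (2 * T)"
    using seg[of "Complex (-T) T" a] s T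
    by (auto simp: a_def b_def img[unfolded a_def b_def] closed_segment_same_Re closed_segment_eq_real_ivl complex_norm complex_diff real_sqrt_mult)
  have eq: "contour_integral (linepath (Complex \<sigma> (-T)) (Complex \<sigma> T)) f - 2 * of_real pi * \<i> * of_real (1 - 1 / y) =
      - (contour_integral (linepath a (Complex \<sigma> (-T))) f + contour_integral (linepath b (Complex (-T) T)) f
         + contour_integral (linepath (Complex (-T) T) a) f)"
    using contour_integral_rectpath[OF cont] tot by (simp add: a_def b_def algebra_simps)
  have "norm (contour_integral (linepath (Complex \<sigma> (-T)) (Complex \<sigma> T)) f - 2 * of_real pi * \<i> * of_real (1 - 1 / y))
      \<le> B * (\<sigma> + T) + B * (\<sigma> + T) + B * (2 * T)"
    unfolding eq norm_minus_cancel
    by (intro order.trans[OF norm_triangle_ineq] add_mono s1 s2 s3)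
  also have "\<dots> = B * (2 * \<sigma> + 4 * T)" by (simp add: algebra_simps)
  also have "\<dots> \<le> B * (6 * T)" using s T B by (intro mult_left_mono) auto
  also have "\<dots> = 12 * y powr \<sigma> / T" using T by (simp add: B_def power2_eq_square)
  finally show ?thesis by (simp add: f_def)
qed

text \<open>For y <= 1 the contour is closed to the right, where there are no poles and y^(Re s)
  does not increase. Because T > 2 the far side lies strictly to the right of
  \<open>\<sigma>\<close>.\<close>

lemma perron_small:
  assumes y: "0 < y" "y \<le> 1" and s: "1 < \<sigma>" "\<sigma> \<le> 2" and T: "T > 2"
  shows "norm (contour_integral (linepath (Complex \<sigma> (-T)) (Complex \<sigma> T)) (perron_kernel y)) \<le> 12 * y powr \<sigma> / T"
proof -
  define a b where "a = Complex \<sigma> (-T)" and "b = Complex T T"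
  define f where "f = perron_kernel y"
  have img: "path_image (rectpath a b) = {z. Re z \<in> {\<sigma>, T} \<and> Im z \<in> {-T..T}} \<union> {z. Im z \<in> {-T, T} \<and> Re z \<in> {\<sigma>..T}}"
    unfolding a_def b_def using s T by (subst path_image_rectpath) auto
  have hol: "f holomorphic_on {z. Re z > 0}"
    unfolding f_def using y by (intro holomorphic_on_subset[OF perron_kernel_holomorphic]) auto
  have sub: "path_image (rectpath a b) \<subseteq> {z. Re z > 0}" using s T by (auto simp: img)
  have cont: "continuous_on (path_image (rectpath a b)) f"
    by (intro holomorphic_on_imp_continuous_on holomorphic_on_subset[OF hol sub])
  have tot: "contour_integral (rectpath a b) f = 0"
    by (intro contour_integral_unique Cauchy_theorem_convex_simple[OF hol convex_halfspace_Re_gt] sub) auto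
  define B where "B = 2 * y powr \<sigma> / T\<^sup>2"
  have B: "B \<ge> 0" by (simp add: B_def)
  have le: "norm (f w) \<le> B" if "w \<in> path_image (rectpath a b)" "\<bar>Im w\<bar> = T \<or> Re w = T" for w
    unfolding f_def B_def
  proof (rule perron_kernel_le)
    show "y powr Re w \<le> y powr \<sigma>" using that y s T by (intro powr_mono') (auto simp: img)
    show "T \<le> norm w" using that(2) T abs_Re_le_cmod[of w] abs_Im_le_cmod[of w] by auto
    show "T - 1 \<le> norm (w + 1)" using that(2) T abs_Re_le_cmod[of "w + 1"] abs_Im_le_cmod[of "w + 1"] by auto
  qed (use y T in auto)
  have seg: "norm (contour_integral (linepath u v) f) \<le> B * norm (v - u)"
    if "closed_segment u v \<subseteq> path_image (rectpath a b)" "\<And>w. w \<in> closed_segment u v \<Longrightarrow> \<bar>Im w\<bar> = T \<or> Re w = T" for u v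
    by (rule contour_integral_bound_linepath[OF contour_integrable_continuous_linepath B])
       (use that le cont in \<open>auto elim: continuous_on_subset\<close>)
  have s1: "norm (contour_integral (linepath a (Complex T (-T))) f) \<le> B * (T - \<sigma>)"
    using seg[of a "Complex T (-T)"] s T
    by (auto simp: a_def b_def img[unfolded a_def b_def] closed_segment_same_Im closed_segment_eq_real_ivl complex_norm complex_diff)
  have s2: "norm (contour_integral (linepath b (Complex \<sigma> T)) f) \<le> B * (T - \<sigma>)"
    using seg[of b "Complex \<sigma> T"] s T
    by (auto simp: a_def b_def img[unfolded a_def b_def] closed_segment_same_Im closed_segment_eq_real_ivl complex_norm complex_diff abs_if)
  have s3: "norm (contour_integral (linepath (Complex T (-T)) b) f) \<le> B * (2 * T)"
    using seg[of "Complex T (-T)" b] s T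
    by (auto simp: a_def b_def img[unfolded a_def b_def] closed_segment_same_Re closed_segment_eq_real_ivl complex_norm complex_diff real_sqrt_mult)
  have "contour_integral (linepath (Complex \<sigma> (-T)) (Complex \<sigma> T)) f = - contour_integral (linepath (Complex \<sigma> T) a) f"
    unfolding a_def by (rule contour_integral_reverse_linepath) (use cont s T in \<open>auto elim!: continuous_on_subset simp: img closed_segment_same_Re closed_segment_eq_real_ivl\<close>)
  also have "\<dots> = contour_integral (linepath a (Complex T (-T))) f + contour_integral (linepath b (Complex \<sigma> T)) f
         + contour_integral (linepath (Complex T (-T)) b) f"
    using contour_integral_rectpath[OF cont] tot by (simp add: a_def b_def algebra_simps add_eq_0_iff2)
  finally have eq: "contour_integral (linepath (Complex \<sigma> (-T)) (Complex \<sigma> T)) f = \<dots>" .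
  have "norm (contour_integral (linepath (Complex \<sigma> (-T)) (Complex \<sigma> T)) f) \<le> B * (T - \<sigma>) + B * (T - \<sigma>) + B * (2 * T)"
    unfolding eq by (intro order.trans[OF norm_triangle_ineq] add_mono s1 s2 s3)
  also have "\<dots> = B * (4 * T - 2 * \<sigma>)" by (simp add: algebra_simps)
  also have "\<dots> \<le> B * (6 * T)" using s T B by (intro mult_left_mono) auto
  also have "\<dots> = 12 * y powr \<sigma> / T" using T by (simp add: B_def power2_eq_square)
  finally show ?thesis by (simp add: f_def)
qed


section \<open>Summation by Perron's formula\<close>

lemma integral_weight:
  assumes "T > 0"
  shows "((\<lambda>t::real. (1 + \<bar>t\<bar>) powr (-3/2)) has_integral (4 - 4 * (1 + T) powr (-1/2))) {-T..T}"
proof -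
  have pos: "((\<lambda>t::real. (1 + t) powr (-3/2)) has_integral
      (-2 * (1 + T) powr (-1/2) - (-2 * (1 + 0) powr (-1/2)))) {0..T}"
    using assms by (intro fundamental_theorem_of_calculus)
      (auto intro!: derivative_eq_intros simp flip: has_real_derivative_iff_has_vector_derivative)
  have neg: "((\<lambda>t::real. (1 - t) powr (-3/2)) has_integral
      (2 * (1 - 0) powr (-1/2) - 2 * (1 - (-T)) powr (-1/2))) {-T..0}"
    using assms by (intro fundamental_theorem_of_calculus)
      (auto intro!: derivative_eq_intros simp flip: has_real_derivative_iff_has_vector_derivative)
  have "((\<lambda>t::real. (1 + \<bar>t\<bar>) powr (-3/2)) has_integral
      (2 * (1 - 0) powr (-1/2) - 2 * (1 - (-T)) powr (-1/2)) + (-2 * (1 + T) powr (-1/2) - (-2 * (1 + 0) powr (-1/2)))) {-T..T}"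
  proof (rule has_integral_combine)
    show "((\<lambda>t::real. (1 + \<bar>t\<bar>) powr (-3/2)) has_integral (2 * (1 - 0) powr (-1/2) - 2 * (1 - (-T)) powr (-1/2))) {-T..0}"
      by (rule has_integral_eq[OF _ neg]) auto
    show "((\<lambda>t::real. (1 + \<bar>t\<bar>) powr (-3/2)) has_integral (-2 * (1 + T) powr (-1/2) - (-2 * (1 + 0) powr (-1/2)))) {0..T}"
      by (rule has_integral_eq[OF _ pos]) auto
  qed (use assms in auto)
  then show ?thesis by simp
qed

lemma perron_kernel_line_le:
  assumes "x > 0" "\<sigma> > 1"
  shows "norm (perron_kernel x (Complex \<sigma> t)) \<le> 4 * x powr \<sigma> / (1 + \<bar>t\<bar>)\<^sup>2"
proof -
  let ?s = "Complex \<sigma> t"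
  \<comment> \<open>Both real parts exceed 1, so both norms are at least max(1, |t|), which is at
    least the mean of 1 and |t|.\<close>
  have "(1 + \<bar>t\<bar>) / 2 \<le> norm ?s" "(1 + \<bar>t\<bar>) / 2 \<le> norm (?s + 1)"
    using abs_Re_le_cmod[of ?s] abs_Im_le_cmod[of ?s] abs_Re_le_cmod[of "?s + 1"] abs_Im_le_cmod[of "?s + 1"] assms by auto
  then have "((1 + \<bar>t\<bar>) / 2) * ((1 + \<bar>t\<bar>) / 2) \<le> norm ?s * norm (?s + 1)" by (intro mult_mono) auto
  then have "x powr \<sigma> / (norm ?s * norm (?s + 1)) \<le> x powr \<sigma> / (((1 + \<bar>t\<bar>) / 2) * ((1 + \<bar>t\<bar>) / 2))"
    using assms by (intro divide_left_mono mult_pos_pos) (auto intro!: zero_less_norm_iff[THEN iffD2] simp: complex_eq_iff)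
  then show ?thesis using assms norm_perron_kernel[of x ?s] by (simp add: power2_eq_square mult_ac)
qed

text \<open>Integrating over a segment of height T produces a truncation error proportional to
  \<open>D / T\<close>. With \<open>\<sigma>\<close> fixed, \<open>D\<close> is a finite number that
  may be large, and letting T grow removes it from the result. The constant 16 is the 4 of
  \<open>perron_kernel_line_le\<close> times the bound 4 for the mass in
  \<open>integral_weight\<close>.\<close>

theorem perron_sum_bound:
  assumes b: "abs_conv b" and x: "x > 0" and s: "1 < \<sigma>" "\<sigma> \<le> 2" and C: "C \<ge> 0"
    and bound: "\<And>t. norm (dser b (Complex \<sigma> t)) \<le> C * (1 + \<bar>t\<bar>) powr (1/2)"
  shows "\<bar>\<Sum>n | 0 < n \<and> real n \<le> x. b n * (1 - real n / x)\<bar> \<le> 16 * C * x powr \<sigma>"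
proof -
  define S where "S = (\<Sum>n | 0 < n \<and> real n \<le> x. b n * (1 - real n / x))"
  define N where "N = {n. 0 < n \<and> real n \<le> x}"
  have N: "finite N" by (rule finite_subset[of _ "{..nat \<lfloor>x\<rfloor>}"]) (auto simp: N_def le_nat_floor)
  define D where "D = (\<Sum>n. \<bar>b n\<bar> * real n powr (-\<sigma>))"
  have sm: "summable (\<lambda>n. \<bar>b n\<bar> * real n powr (-\<sigma>))" using b s by (auto simp: abs_conv_def)
  have D: "D \<ge> 0" unfolding D_def by (intro suminf_nonneg sm) auto
  have key: "norm S \<le> 16 * C * x powr \<sigma> + 12 * x powr \<sigma> * D / T" if T: "T > 2" for T
  proof -
    let ?u = "Complex \<sigma> (-T)" and ?v = "Complex \<sigma> T"
    have seg: "closed_segment ?u ?v = {w. Re w = \<sigma> \<and> Im w \<in> {-T..T}}"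
      using T by (auto simp: closed_segment_same_Re closed_segment_eq_real_ivl)
    define f where "f = (\<lambda>n w. of_real (b n) * perron_kernel (x / real n) w)"
    have f: "f n w = (of_real (b n) * of_nat n powr (-w)) * perron_kernel x w" for n w
    proof (cases "n = 0")
      case False
      have "complex_of_real (x / real n) powr w = of_real x powr w * of_nat n powr (-w)"
      proof -
        have L1: "Ln (of_real (x / real n)) = of_real (ln x) - of_real (ln (real n))"
          using False x by (subst Ln_of_real) (auto simp: ln_div)
        have L2: "Ln (of_real x) = of_real (ln x)" using x by (simp add: Ln_of_real)
        have L3: "Ln (of_nat n) = of_real (ln (real n))" using False by (simp add: Ln_of_nat)
        have "of_real (x / real n) powr w = exp (w * (of_real (ln x) - of_real (ln (real n))))"
          unfolding powr_def L1 using False x by simp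
        also have "w * (of_real (ln x) - of_real (ln (real n))) = w * of_real (ln x) + (-w) * of_real (ln (real n))"
          by (simp add: algebra_simps)
        also have "exp \<dots> = of_real x powr w * of_nat n powr (-w)"
          unfolding powr_def L2 L3 exp_add using False x by simp
        finally show ?thesis .
      qed
      then show ?thesis by (simp add: f_def perron_kernel_def)
    qed (simp add: f_def perron_kernel_def)
    have cont: "continuous_on (closed_segment ?u ?v) (f n)" for n
    proof -
      define h where "h = (\<lambda>w. (of_real (b n) * of_nat n powr (-w)) * perron_kernel x w)"
      have "h holomorphic_on - {0, -1}"
        unfolding h_def by (intro holomorphic_on_mult perron_kernel_holomorphic x) (intro holomorphic_intros)+
      moreover have "f n = h" by (simp add: fun_eq_iff f h_def)
      moreover have "closed_segment ?u ?v \<subseteq> - {0, -1}" using s by (auto simp: seg)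
      ultimately show ?thesis by (metis holomorphic_on_imp_continuous_on holomorphic_on_subset)
    qed
    \<comment> \<open>Uniform convergence on the segment lets the series be integrated term by term,
      so that each n can be treated by \<open>perron_large\<close> or
      \<open>perron_small\<close>.\<close>
    have "uniform_limit (closed_segment ?u ?v) (\<lambda>n w. \<Sum>i<n. f i w) (\<lambda>w. \<Sum>i. f i w) sequentially"
    proof (rule Weierstrass_m_test)
      fix n w assume w: "w \<in> closed_segment ?u ?v"
      then have w': "w = Complex \<sigma> (Im w)" by (auto simp: seg complex_eq_iff)
      have "norm (perron_kernel x w) \<le> 4 * x powr \<sigma> / (1 + \<bar>Im w\<bar>)\<^sup>2"
        using perron_kernel_line_le[OF x s(1), of "Im w"] w' by simp
      also have "\<dots> \<le> 4 * x powr \<sigma> / 1" using one_le_power[of "1 + \<bar>Im w\<bar>" 2] by (intro divide_left_mono) (simp_all, linarith?)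
      finally have "norm (perron_kernel x w) \<le> 4 * x powr \<sigma>" by simp
      moreover have "norm (f n w) = \<bar>b n\<bar> * real n powr (-\<sigma>) * norm (perron_kernel x w)"
        unfolding f using w by (simp add: norm_mult norm_of_nat_powr seg)
      ultimately show "norm (f n w) \<le> \<bar>b n\<bar> * real n powr (-\<sigma>) * (4 * x powr \<sigma>)"
        by (auto intro!: mult_left_mono)
    qed (intro summable_mult2 sm)
    then obtain J where J: "((\<lambda>w. \<Sum>i. f i w) has_contour_integral J) (linepath ?u ?v)"
      "(\<lambda>n. contour_integral (linepath ?u ?v) (f n)) sums J"
      by (rule contour_integral_sums_linepath[OF _ cont])
    define g where "g = (\<lambda>t. dser b (Complex \<sigma> t) * perron_kernel x (Complex \<sigma> t))"
    have g: "(\<Sum>i. f i (Complex \<sigma> t)) = g t" for t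
      using sums_mult2[OF dser_sums[OF b], of "Complex \<sigma> t" "perron_kernel x (Complex \<sigma> t)"] s
      by (simp add: f g_def sums_iff)
    from J(1) have gJ: "(g has_integral (- \<i> * J)) {-T..T}"
      using T by (subst (asm) has_contour_integral_linepath_same_Re_iff[of _ \<sigma> _ "-T" T]) (auto simp: g)
    have "norm J \<le> 4 * C * x powr \<sigma> * (4 - 4 * (1 + T) powr (-1/2))"
    proof -
      \<comment> \<open>The integrand is of order (1 + |t|)^(1/2) from the series times (1 + |t|)^-2
        from the kernel.\<close>
      have W: "((\<lambda>t. 4 * C * x powr \<sigma> * (1 + \<bar>t\<bar>) powr (-3/2)) has_integral
          (4 * C * x powr \<sigma> * (4 - 4 * (1 + T) powr (-1/2)))) {-T..T}"
        using T by (intro has_integral_mult_right integral_weight) auto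
      have "norm (- \<i> * J) \<le> 4 * C * x powr \<sigma> * (4 - 4 * (1 + T) powr (-1/2))"
        unfolding integral_unique[OF gJ, symmetric] integral_unique[OF W, symmetric]
      proof (rule integral_norm_bound_integral)
        show "g integrable_on {-T..T}" using gJ by blast
        show "(\<lambda>t. 4 * C * x powr \<sigma> * (1 + \<bar>t\<bar>) powr (-3/2)) integrable_on {-T..T}"
          using W by blast
        fix t
        have "norm (g t) \<le> C * (1 + \<bar>t\<bar>) powr (1/2) * (4 * x powr \<sigma> / (1 + \<bar>t\<bar>)\<^sup>2)"
          unfolding g_def norm_mult by (intro mult_mono bound perron_kernel_line_le x s) (use C in auto)
        also have "(1 + \<bar>t\<bar>)\<^sup>2 = (1 + \<bar>t\<bar>) powr 2" by (simp add: powr_numeral)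
        also have "C * (1 + \<bar>t\<bar>) powr (1/2) * (4 * x powr \<sigma> / (1 + \<bar>t\<bar>) powr 2) =
            4 * C * x powr \<sigma> * ((1 + \<bar>t\<bar>) powr (1/2) / (1 + \<bar>t\<bar>) powr 2)" by simp
        also have "(1 + \<bar>t\<bar>) powr (1/2) / (1 + \<bar>t\<bar>) powr 2 = (1 + \<bar>t\<bar>) powr (-3/2)"
          unfolding powr_diff[symmetric] by simp
        finally show "norm (g t) \<le> 4 * C * x powr \<sigma> * (1 + \<bar>t\<bar>) powr (-3/2)" .
      qed
      then show ?thesis by (simp add: norm_mult)
    qed
    also have "\<dots> \<le> 4 * C * x powr \<sigma> * 4" using C by (intro mult_left_mono) auto
    finally have nJ: "norm J \<le> 16 * C * x powr \<sigma>" by simp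
    define m where "m = (\<lambda>n. if n \<in> N then 2 * of_real pi * \<i> * of_real (b n * (1 - real n / x)) else 0)"
    have "m sums (\<Sum>n\<in>N. 2 * of_real pi * \<i> * of_real (b n * (1 - real n / x)))"
      unfolding m_def using N by (rule sums_If_finite_set)
    then have m: "m sums (2 * of_real pi * \<i> * of_real S)"
      by (simp add: S_def N_def sum_distrib_left)
    have "norm (J - 2 * of_real pi * \<i> * of_real S) \<le> 12 * x powr \<sigma> / T * D"
      unfolding D_def sums_unique[OF sums_diff[OF J(2) m]] suminf_mult[OF sm, symmetric]
    proof (rule norm_suminf_le)
      fix n
      have ci: "contour_integral (linepath ?u ?v) (f n) = of_real (b n) * contour_integral (linepath ?u ?v) (perron_kernel (x / real n))"
        if "n > 0"
      proof -
        have "perron_kernel (x / real n) holomorphic_on - {0, -1}"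
          using x that by (intro perron_kernel_holomorphic) auto
        moreover have "closed_segment ?u ?v \<subseteq> - {0, -1}" using s by (auto simp: seg)
        ultimately have "perron_kernel (x / real n) contour_integrable_on (linepath ?u ?v)"
          by (metis contour_integrable_continuous_linepath holomorphic_on_imp_continuous_on holomorphic_on_subset)
        then show ?thesis unfolding f_def by (rule contour_integral_lmul)
      qed
      have eq: "\<bar>b n\<bar> * (12 * (x / real n) powr \<sigma> / T) = 12 * x powr \<sigma> / T * (\<bar>b n\<bar> * real n powr (-\<sigma>))"
        if "n > 0" using that x by (simp add: powr_divide powr_minus_divide mult_ac)
      consider "n = 0" | "n > 0" "real n \<le> x" | "n > 0" "real n > x" by force
      then show "norm (contour_integral (linepath ?u ?v) (f n) - m n) \<le> 12 * x powr \<sigma> / T * (\<bar>b n\<bar> * real n powr (-\<sigma>))"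
      proof cases
        case 1
        then have "f n = (\<lambda>w. 0)" by (simp add: f_def perron_kernel_def)
        then show ?thesis using 1 by (simp add: m_def N_def)
      next
        case 2
        have "norm (contour_integral (linepath ?u ?v) (perron_kernel (x / real n)) - 2 * of_real pi * \<i> * of_real (1 - 1 / (x / real n)))
            \<le> 12 * (x / real n) powr \<sigma> / T"
          using 2 s T x by (intro perron_large) (auto simp: field_simps)
        then have "\<bar>b n\<bar> * norm (contour_integral (linepath ?u ?v) (perron_kernel (x / real n)) - 2 * of_real pi * \<i> * of_real (1 - 1 / (x / real n)))
            \<le> \<bar>b n\<bar> * (12 * (x / real n) powr \<sigma> / T)" by (intro mult_left_mono) auto
        moreover have "contour_integral (linepath ?u ?v) (f n) - m n = of_real (b n) *
           (contour_integral (linepath ?u ?v) (perron_kernel (x / real n)) - 2 * of_real pi * \<i> * of_real (1 - 1 / (x / real n)))"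
          using 2 ci by (simp add: m_def N_def algebra_simps)
        ultimately show ?thesis using eq 2 by (simp only: norm_mult norm_of_real)
      next
        case 3
        have "norm (contour_integral (linepath ?u ?v) (perron_kernel (x / real n))) \<le> 12 * (x / real n) powr \<sigma> / T"
          using 3 s T x by (intro perron_small) (auto simp: field_simps)
        then have "\<bar>b n\<bar> * norm (contour_integral (linepath ?u ?v) (perron_kernel (x / real n)))
            \<le> \<bar>b n\<bar> * (12 * (x / real n) powr \<sigma> / T)" by (intro mult_left_mono) auto
        moreover have "contour_integral (linepath ?u ?v) (f n) - m n = of_real (b n) *
           contour_integral (linepath ?u ?v) (perron_kernel (x / real n))"
          using 3 ci by (simp add: m_def N_def)
        ultimately show ?thesis using eq 3 by (simp only: norm_mult norm_of_real)
      qed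
    qed (intro summable_mult sm)
    then have "norm (2 * of_real pi * \<i> * of_real S) \<le> 16 * C * x powr \<sigma> + 12 * x powr \<sigma> / T * D"
      using nJ norm_triangle_ineq2[of "2 * of_real pi * \<i> * of_real S" J] by (simp add: norm_minus_commute)
    moreover have "norm (2 * of_real pi * \<i> * of_real S :: complex) = 2 * pi * \<bar>S\<bar>" by (simp add: norm_mult)
    \<comment> \<open>The factor 1 / (2 pi) of Perron's formula is given away.\<close>
    moreover have "\<bar>S\<bar> \<le> 2 * pi * \<bar>S\<bar>" using pi_ge_two mult_right_mono[of 1 "2 * pi" "\<bar>S\<bar>"] by simp
    ultimately show ?thesis by simp
  qed
  have "\<bar>S\<bar> \<le> 16 * C * x powr \<sigma>"
  proof (rule field_le_epsilon)
    fix e :: real assume e: "e > 0"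
    define K where "K = 12 * x powr \<sigma> * D"
    have K: "K \<ge> 0" using D by (simp add: K_def)
    \<comment> \<open>The choice T = 3 + K / e satisfies T > 2 and makes the truncation error at
      most e.\<close>
    have "K / (3 + K / e) \<le> e" using K e by (simp add: field_simps)
    moreover have "norm S \<le> 16 * C * x powr \<sigma> + K / (3 + K / e)"
      using key[of "3 + K / e"] K e unfolding K_def[symmetric] by (simp add: add_pos_nonneg add_strict_increasing)
    ultimately show "\<bar>S\<bar> \<le> 16 * C * x powr \<sigma> + e" by simp
  qed
  then show ?thesis by (simp add: S_def)
qed

section \<open>The prime number theorem with remainder\<close>


definition wsum :: "nat \<Rightarrow> real" where
  "wsum N = (\<Sum>n=1..N. weighted_mangoldt n)"

lemma wsum_Suc: "wsum (Suc N) = wsum N + weighted_mangoldt (Suc N)"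
  by (simp add: wsum_def)

text \<open>Summation by parts: the sum with weights N - n, to which Perron's formula applies, is an
  average of the partial sums that have to be bounded.\<close>

lemma sum_wsum: "(\<Sum>m<N. wsum m) = (\<Sum>n=1..N. weighted_mangoldt n * (real N - real n))"
proof (induction N)
  case (Suc N)
  have "(\<Sum>n=1..Suc N. weighted_mangoldt n * (real (Suc N) - real n)) =
      (\<Sum>n=1..N. weighted_mangoldt n * (real N - real n) + weighted_mangoldt n)"
    by (simp add: algebra_simps)
  then show ?case using Suc by (simp add: sum.distrib wsum_def)
qed auto

lemma ln_ge_1: "N \<ge> 3 \<Longrightarrow> ln (real N) \<ge> 1"
  using ln_ge_iff[of "real N" 1] exp_le by (simp add: order.trans)

lemma sum_wsum_bound:
  obtains C :: real where "C > 0" "\<And>N. \<bar>\<Sum>m<N. wsum m\<bar> \<le> C * (real N)\<^sup>2"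
proof -
  obtain C where C: "C > 0" "\<And>s. 1 < Re s \<Longrightarrow> Re s \<le> 2 \<Longrightarrow>
     norm (dser weighted_mangoldt s) \<le> C * (1 + \<bar>Im s\<bar>) powr (1/2)"
    using dser_second_deriv_bound by blast
  have conv: "abs_conv weighted_mangoldt"
  proof -
    have "abs_conv (\<lambda>n. (mangoldt n - 1) * ln (real n) * ln (real n))"
      by (intro abs_conv_ln abs_conv_diff abs_conv_mangoldt abs_conv_one)
    then show ?thesis unfolding weighted_mangoldt_def[abs_def] by (simp add: power2_eq_square mult.assoc)
  qed
  show ?thesis
  proof (rule that[of "16 * C * exp 1"])
    fix N :: nat
    \<comment> \<open>For N <= 2 only m <= 1 occurs, and these partial sums vanish because ln 1 = 0.
      From 3 on, ln N >= 1 and hence \<open>\<sigma> \<le> 2\<close>.\<close>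
    consider "N = 0" | "N = 1" | "N = 2" | "N \<ge> 3" by linarith
    then show "\<bar>\<Sum>m<N. wsum m\<bar> \<le> 16 * C * exp 1 * (real N)\<^sup>2"
    proof cases
      case 4
      \<comment> \<open>So close to 1 that N^sigma = e N, while the bound for the series on this
        line does not depend on its distance from 1.\<close>
      define \<sigma> where "\<sigma> = 1 + 1 / ln (real N)"
      have l: "ln (real N) \<ge> 1" using 4 by (rule ln_ge_1)
      have s: "1 < \<sigma>" "\<sigma> \<le> 2" using l by (auto simp: \<sigma>_def)
      have "real N powr \<sigma> = exp (ln (real N) + 1)"
        using 4 l by (simp add: powr_def \<sigma>_def algebra_simps)
      also have "\<dots> = exp 1 * real N" using 4 by (simp add: exp_add)
      finally have p: "real N powr \<sigma> = exp 1 * real N" .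
      have "\<bar>\<Sum>n | 0 < n \<and> real n \<le> real N. weighted_mangoldt n * (1 - real n / real N)\<bar> \<le> 16 * C * real N powr \<sigma>"
        using C(2)[of "Complex \<sigma> t" for t] C(1) s 4
        by (intro perron_sum_bound conv) auto
      also have "{n. 0 < n \<and> real n \<le> real N} = {1..N}" by auto
      finally have "real N * \<bar>\<Sum>n=1..N. weighted_mangoldt n * (1 - real n / real N)\<bar> \<le> real N * (16 * C * (exp 1 * real N))"
        unfolding p by (intro mult_left_mono) auto
      also have "real N * \<bar>\<Sum>n=1..N. weighted_mangoldt n * (1 - real n / real N)\<bar>
          = \<bar>\<Sum>n=1..N. weighted_mangoldt n * (real N - real n)\<bar>"
      proof -
        have "real N * \<bar>\<Sum>n=1..N. weighted_mangoldt n * (1 - real n / real N)\<bar> =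
            \<bar>\<Sum>n=1..N. real N * (weighted_mangoldt n * (1 - real n / real N))\<bar>"
          by (simp add: abs_mult flip: sum_distrib_left)
        also have "(\<Sum>n=1..N. real N * (weighted_mangoldt n * (1 - real n / real N))) = (\<Sum>n=1..N. weighted_mangoldt n * (real N - real n))"
          using 4 by (intro sum.cong) (auto simp: divide_simps)
        finally show ?thesis .
      qed
      finally show ?thesis unfolding sum_wsum by (simp add: power2_eq_square mult_ac)
    qed (use C in \<open>auto simp: wsum_def weighted_mangoldt_def numeral_2_eq_2\<close>)
  qed (use C in auto)
qed

text \<open>The one-sided condition of the Tauberian argument: Lambda is nonnegative, so each step
  lowers \<open>wsum\<close> by at most (ln K)^2.\<close>

lemma wsum_diff_ge:
  assumes "N \<le> m" "m \<le> K" "N \<ge> 1"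
  shows "wsum m - wsum N \<ge> - (real (m - N) * (ln (real K))\<^sup>2)"
  using assms(1,2)
proof (induction m rule: dec_induct)
  case (step m)
  have "- (ln (real K))\<^sup>2 \<le> - 1 * (ln (real (Suc m)))\<^sup>2"
    using step assms by (auto intro!: power_mono)
  also have "\<dots> \<le> weighted_mangoldt (Suc m)"
    unfolding weighted_mangoldt_def by (intro mult_right_mono) (auto simp: mangoldt_nonneg)
  finally show ?case using step by (simp add: wsum_Suc Suc_diff_le algebra_simps)
qed auto

lemma sum_lessThan_diff: "(a::nat) \<le> b \<Longrightarrow> (\<Sum>m<b. f m) - (\<Sum>m<a. f m) = (\<Sum>m=a..<b. f m :: real)"
  by (metis lessThan_atLeast0 sum_diff_nat_ivl zero_le)

text \<open>If \<open>wsum N\<close> is large and positive, it stays large on a window to the right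
  of N; if it is large and negative, it was so on a window to the left. Either contradicts
  \<open>sum_wsum_bound\<close>. A window of length h costs h l^2 from the drift and N^2 / h from
  the average; both are of order N l for h = N / l.\<close>

lemma wsum_bound:
  obtains C :: real where "C > 0" "\<And>N. N \<ge> 2 \<Longrightarrow> \<bar>wsum N\<bar> \<le> C * (real N * ln (real N))"
proof -
  obtain C where C: "C > 0" "\<And>N. \<bar>\<Sum>m<N. wsum m\<bar> \<le> C * (real N)\<^sup>2"
    using sum_wsum_bound by blast
  show ?thesis
  proof (rule that[of "2 * (5 * C + 3)"])
    fix N :: nat assume N: "N \<ge> 2"
    \<comment> \<open>As h <= N, both windows lie below 2N, so one logarithm bounds all
      increments.\<close>
    define l where "l = ln (real (2 * N))"
    have l: "l \<ge> 1" unfolding l_def using N by (intro ln_ge_1) auto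
    have l2: "l \<le> 2 * ln (real N)" using N ln_le_cancel_iff[of 2 "real N"] by (simp add: l_def ln_mult)
    have lN: "l \<le> 2 * real N" using ln_bound[of "2 * real N"] N by (simp add: l_def)
    define h where "h = nat \<lceil>real N / l\<rceil>"
    have h0: "real N / l \<le> real h" "real h \<le> real N / l + 1"
      unfolding h_def using l N by (auto intro: of_nat_ceiling)
    have hpos: "h \<ge> 1" using h0(1) N l by (cases "h = 0") (auto simp: field_simps)
    have hN: "h \<le> N"
    proof -
      have "real N / l \<le> real N" using l N by (simp add: field_simps mult_right_le_one_le)
      then show ?thesis unfolding h_def by (simp add: ceiling_le_iff nat_le_iff)
    qed
    have up: "real h * (wsum N - real h * l\<^sup>2) \<le> 5 * C * (real N)\<^sup>2"
    proof -
      have "real h * (wsum N - real h * l\<^sup>2) = (\<Sum>m=N..<N+h. wsum N - real h * l\<^sup>2)" by simp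
      also have "\<dots> \<le> (\<Sum>m=N..<N+h. wsum m)"
      proof (rule sum_mono)
        fix m assume m: "m \<in> {N..<N+h}"
        have "- (real (m - N) * l\<^sup>2) \<le> wsum m - wsum N"
          unfolding l_def using m hN N by (intro wsum_diff_ge) auto
        moreover have "real (m - N) * l\<^sup>2 \<le> real h * l\<^sup>2" using m by (intro mult_right_mono) auto
        ultimately show "wsum N - real h * l\<^sup>2 \<le> wsum m" by linarith
      qed
      also have "\<dots> = (\<Sum>m<N+h. wsum m) - (\<Sum>m<N. wsum m)" by (rule sum_lessThan_diff[symmetric]) simp
      also have "\<dots> \<le> C * (real (N + h))\<^sup>2 + C * (real N)\<^sup>2" using C(2)[of "N + h"] C(2)[of N] by linarith
      also have "\<dots> \<le> C * (real (2 * N))\<^sup>2 + C * (real N)\<^sup>2"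
        using hN C by (intro add_mono mult_left_mono power_mono) auto
      finally show ?thesis by (simp add: power2_eq_square)
    qed
    have low: "real h * (- wsum N - real h * l\<^sup>2) \<le> 5 * C * (real N)\<^sup>2"
    proof -
      have "real h * (- wsum N - real h * l\<^sup>2) = (\<Sum>m=N-h..<N. - wsum N - real h * l\<^sup>2)" using hN by simp
      also have "\<dots> \<le> (\<Sum>m=N-h..<N. - wsum m)"
      proof (rule sum_mono)
        fix m assume m: "m \<in> {N-h..<N}"
        have "- (real (N - m) * l\<^sup>2) \<le> wsum N - wsum m"
        proof (cases "m = 0")
          \<comment> \<open>When h = N the left window starts at 0, outside the range of
            \<open>wsum_diff_ge\<close>; the coefficient at 1 is 0, so the value at 1 can be used
            instead.\<close>
          case True
          have "weighted_mangoldt (Suc 0) = 0" by (simp add: weighted_mangoldt_def)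
          then have "wsum 0 = wsum 1" by (simp add: wsum_def)
          moreover have "- (real (N - 1) * l\<^sup>2) \<le> wsum N - wsum 1"
            unfolding l_def using N by (intro wsum_diff_ge) auto
          moreover have "real (N - 1) * l\<^sup>2 \<le> real (N - m) * l\<^sup>2" using True by (intro mult_right_mono) auto
          ultimately show ?thesis using True by simp
        next
          case False
          then show ?thesis unfolding l_def using m N by (intro wsum_diff_ge) auto
        qed
        moreover have "real (N - m) * l\<^sup>2 \<le> real h * l\<^sup>2" using m hN by (intro mult_right_mono) auto
        ultimately show "- wsum N - real h * l\<^sup>2 \<le> - wsum m" by linarith
      qed
      also have "\<dots> = (\<Sum>m<N-h. wsum m) - (\<Sum>m<N. wsum m)"
        using sum_lessThan_diff[of "N - h" N wsum] by (simp add: sum_negf)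
      also have "\<dots> \<le> C * (real (N - h))\<^sup>2 + C * (real N)\<^sup>2" using C(2)[of "N - h"] C(2)[of N] by linarith
      also have "\<dots> \<le> C * (real (2 * N))\<^sup>2 + C * (real N)\<^sup>2"
        using hN C by (intro add_mono mult_left_mono power_mono) auto
      finally show ?thesis by (simp add: power2_eq_square)
    qed
    have "real h * (\<bar>wsum N\<bar> - real h * l\<^sup>2) \<le> 5 * C * (real N)\<^sup>2" using up low by (simp add: abs_if)
    then have "\<bar>wsum N\<bar> - real h * l\<^sup>2 \<le> 5 * C * (real N)\<^sup>2 / real h" using hpos by (simp add: field_simps)
    also have "\<dots> \<le> 5 * C * (real N)\<^sup>2 / (real N / l)"
      using h0 hpos N l C by (intro divide_left_mono mult_pos_pos) auto
    also have "\<dots> = 5 * C * (real N * l)" using N l by (simp add: power2_eq_square)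
    finally have "\<bar>wsum N\<bar> \<le> 5 * C * (real N * l) + real h * l\<^sup>2" by simp
    also have "real h * l\<^sup>2 \<le> (real N / l + 1) * l\<^sup>2" using h0 by (intro mult_right_mono) auto
    also have "\<dots> = real N * l + l * l" using l by (simp add: power2_eq_square field_simps)
    also have "l * l \<le> 2 * real N * l" using lN l by (intro mult_right_mono) auto
    finally have "\<bar>wsum N\<bar> \<le> (5 * C + 3) * (real N * l)" by (simp add: algebra_simps)
    also have "\<dots> \<le> (5 * C + 3) * (real N * (2 * ln (real N)))" using C l2 by (intro mult_left_mono) auto
    finally show "\<bar>wsum N\<bar> \<le> 2 * (5 * C + 3) * (real N * ln (real N))" by (simp only: mult_ac)
  qed (use C in auto)
qed

lemma ln_Suc_diff_le: "n \<ge> 1 \<Longrightarrow> ln (real (Suc n)) - ln (real n) \<le> 1 / real n"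
proof -
  assume n: "n \<ge> 1"
  have "ln (real (Suc n)) - ln (real n) = ln (real (Suc n) / real n)" using n by (simp add: ln_div)
  also have "real (Suc n) / real n = 1 + 1 / real n" using n by (simp add: field_simps)
  also have "ln (1 + 1 / real n) \<le> 1 / real n" using n by (intro ln_add_one_self_le_self) auto
  finally show ?thesis .
qed

lemma sum_ln_ge: "(\<Sum>n=1..N. ln (real n)) \<ge> real N * ln (real N) - real N"
proof (induction N)
  case (Suc N)
  show ?case
  proof (cases "N = 0")
    case False
    then have "real N * (ln (real (Suc N)) - ln (real N)) \<le> real N * (1 / real N)"
      by (intro mult_left_mono ln_Suc_diff_le) auto
    then show ?thesis using Suc False by (simp add: algebra_simps)
  qed auto
qed auto

definition vsum :: "nat \<Rightarrow> real" where
  "vsum N = (\<Sum>n=1..N. mangoldt n * (ln (real n))\<^sup>2)"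

text \<open>Adding back the sum of (ln n)^2 to \<open>wsum\<close>; that sum is N (ln N)^2 up to O(N
  ln N).\<close>

lemma vsum_asymp:
  obtains C :: real where "C > 0" "\<And>N. N \<ge> 1 \<Longrightarrow> \<bar>vsum N - real N * (ln (real N))\<^sup>2\<bar> \<le> C * (real N * ln (real N))"
proof -
  obtain C where C: "C > 0" "\<And>N. N \<ge> 2 \<Longrightarrow> \<bar>wsum N\<bar> \<le> C * (real N * ln (real N))"
    using wsum_bound by blast
  show ?thesis
  proof (rule that[of "C + 2"])
    fix N :: nat assume "N \<ge> 1"
    then consider "N = 1" | "N \<ge> 2" by linarith
    then show "\<bar>vsum N - real N * (ln (real N))\<^sup>2\<bar> \<le> (C + 2) * (real N * ln (real N))"
    proof cases
      case 2
      define L where "L = ln (real N)"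
      have L: "L \<ge> 0" using 2 by (simp add: L_def)
      have "vsum N = wsum N + (\<Sum>n=1..N. (ln (real n))\<^sup>2)"
        by (simp add: vsum_def wsum_def weighted_mangoldt_def algebra_simps flip: sum.distrib)
      moreover have "(\<Sum>n=1..N. (ln (real n))\<^sup>2) \<le> real N * L\<^sup>2"
      proof -
        have "(\<Sum>n=1..N. (ln (real n))\<^sup>2) \<le> (\<Sum>n=1..N. L\<^sup>2)"
          by (intro sum_mono power_mono) (auto simp: L_def)
        then show ?thesis by simp
      qed
      moreover have "(\<Sum>n=1..N. (ln (real n))\<^sup>2) \<ge> real N * L\<^sup>2 - 2 * (real N * L)"
      proof -
        \<comment> \<open>The square lies above its tangent at \<open>L\<close>. This makes the sum
          linear in ln n, so that the Stirling-type bound \<open>sum_ln_ge\<close> applies.\<close>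
        have "(\<Sum>n=1..N. L\<^sup>2 - 2 * L * (L - ln (real n))) \<le> (\<Sum>n=1..N. (ln (real n))\<^sup>2)"
        proof (rule sum_mono)
          fix n
          have "0 \<le> (L - ln (real n))\<^sup>2" by simp
          then show "L\<^sup>2 - 2 * L * (L - ln (real n)) \<le> (ln (real n))\<^sup>2" by (simp add: power2_eq_square algebra_simps)
        qed
        also have "(\<Sum>n=1..N. L\<^sup>2 - 2 * L * (L - ln (real n))) = real N * L\<^sup>2 - 2 * L * (real N * L - (\<Sum>n=1..N. ln (real n)))"
          by (simp add: sum_subtractf flip: sum_distrib_left)
        finally show ?thesis
          using mult_left_mono[of "real N * L - (\<Sum>n=1..N. ln (real n))" "real N" "2 * L"] sum_ln_ge[of N] L
          by (simp add: L_def[symmetric] algebra_simps)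
      qed
      moreover have "\<bar>wsum N\<bar> \<le> C * (real N * L)" using C(2)[OF 2] by (simp add: L_def)
      ultimately show ?thesis unfolding L_def[symmetric] using L by (simp add: algebra_simps abs_le_iff)
    qed (auto simp: vsum_def)
  qed (use C in auto)
qed


section \<open>From the weighted sum over prime powers to the prime-counting function\<close>

lemma ln_2_ge_half: "ln (2::real) \<ge> 1/2"
  using ln2_ge_two_thirds by linarith

lemma finite_squares_le: "finite {p::nat. 1 \<le> p \<and> p\<^sup>2 \<le> N}"
proof (rule finite_subset)
  show "{p::nat. 1 \<le> p \<and> p\<^sup>2 \<le> N} \<subseteq> {..N}"
    using power2_nat_le_imp_le by blast
qed auto

lemma card_sqrt_le: "real (card {p::nat. 1 \<le> p \<and> p\<^sup>2 \<le> N}) \<le> sqrt (real N)"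
proof -
  have "{p::nat. 1 \<le> p \<and> p\<^sup>2 \<le> N} \<subseteq> {1..nat \<lfloor>sqrt (real N)\<rfloor>}"
  proof
    fix p assume "p \<in> {p::nat. 1 \<le> p \<and> p\<^sup>2 \<le> N}"
    then have "1 \<le> p" "real p ^ 2 \<le> real N" by (auto simp flip: of_nat_power)
    then show "p \<in> {1..nat \<lfloor>sqrt (real N)\<rfloor>}" by (auto simp: le_nat_floor real_le_rsqrt)
  qed
  then have "card {p::nat. 1 \<le> p \<and> p\<^sup>2 \<le> N} \<le> card {1..nat \<lfloor>sqrt (real N)\<rfloor>}" by (intro card_mono) auto
  then have "real (card {p::nat. 1 \<le> p \<and> p\<^sup>2 \<le> N}) \<le> real (nat \<lfloor>sqrt (real N)\<rfloor>)"
    unfolding of_nat_le_iff by simp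
  also have "\<dots> \<le> sqrt (real N)" by (rule of_nat_floor) simp
  finally show ?thesis .
qed

text \<open>A proper prime power p^k up to N has p <= sqrt N and k <= L / ln 2 <= 2 L, so there are
  at most 2 sqrt N L of them, each contributing at most L^3. The bound L <= 6 N^(1/6) gives L^3 <=
  216 sqrt N, and 432 = 2 * 216.\<close>

lemma sum_mangoldt_nonprime:
  assumes "N \<ge> 1"
  shows "(\<Sum>n | n \<in> {1..N} \<and> \<not> prime n. mangoldt n * (ln (real n))\<^sup>2) \<le> 432 * (real N * ln (real N))"
proof -
  define L where "L = ln (real N)"
  have L: "L \<ge> 0" using assms by (simp add: L_def)
  define k0 where "k0 = nat \<lfloor>L / ln 2\<rfloor>"
  define P where "P = {p::nat. 1 \<le> p \<and> p\<^sup>2 \<le> N}"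
  have finP: "finite P" unfolding P_def by (rule finite_squares_le)
  define Q where "Q = {n \<in> {1..N}. primepow n \<and> \<not> prime n}"
  have sub: "Q \<subseteq> (\<lambda>(p, k). p ^ k) ` (P \<times> {1..k0})"
  proof
    fix n assume n: "n \<in> Q"
    then obtain p k where pk: "prime p" "k > 0" "n = p ^ k" by (auto simp: Q_def primepow_def)
    have "k \<noteq> 1" using n pk by (auto simp: Q_def)
    then have k: "k \<ge> 2" using pk by simp
    have p: "p \<ge> 2" using pk by (simp add: prime_ge_2_nat)
    have "p ^ 2 \<le> p ^ k" using k p by (intro power_increasing) auto
    also have pkN: "p ^ k \<le> N" using n pk by (auto simp: Q_def)
    finally have "p \<in> P" using p by (simp add: P_def)
    moreover have "real k * ln 2 \<le> L"
    proof -
      have "2 ^ k \<le> p ^ k" using p by (intro power_mono) auto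
      also note pkN
      finally have "real (2 ^ k) \<le> real N" unfolding of_nat_le_iff .
      then have "(2::real) ^ k \<le> real N" by simp
      then have "ln ((2::real) ^ k) \<le> ln (real N)" using assms by (subst ln_le_cancel_iff) auto
      then show ?thesis by (simp add: ln_realpow L_def)
    qed
    then have "k \<le> k0" unfolding k0_def by (intro le_nat_floor) (simp add: field_simps)
    ultimately show "n \<in> (\<lambda>(p, k). p ^ k) ` (P \<times> {1..k0})" using pk k by force
  qed
  have "card Q \<le> card ((\<lambda>(p, k). p ^ k) ` (P \<times> {1..k0}))" using sub finP by (intro card_mono) auto
  also have "\<dots> \<le> card (P \<times> {1..k0})" using finP by (intro card_image_le) auto
  finally have "real (card Q) \<le> real (card P) * real k0" by (simp only: of_nat_le_iff card_cartesian_product card_atLeastAtMost flip: of_nat_mult) simp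
  also have "\<dots> \<le> sqrt (real N) * (2 * L)"
  proof (intro mult_mono)
    show "real (card P) \<le> sqrt (real N)" unfolding P_def by (rule card_sqrt_le)
    have "real k0 \<le> L / ln 2" unfolding k0_def using L by simp
    also have "\<dots> \<le> L / (1/2)" using L ln_2_ge_half by (intro divide_left_mono) auto
    finally show "real k0 \<le> 2 * L" by simp
  qed auto
  finally have cQ: "real (card Q) \<le> 2 * sqrt (real N) * L" by simp
  have "(\<Sum>n | n \<in> {1..N} \<and> \<not> prime n. mangoldt n * (ln (real n))\<^sup>2) = (\<Sum>n\<in>Q. mangoldt n * (ln (real n))\<^sup>2)"
    by (intro sum.mono_neutral_right) (auto simp: Q_def mangoldt_def)
  also have "\<dots> \<le> (\<Sum>n\<in>Q. L * L\<^sup>2)"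
  proof (intro sum_mono mult_mono power_mono)
    fix n assume n: "n \<in> Q"
    then have "ln (real n) \<le> L" by (auto simp: Q_def L_def)
    then show "mangoldt n \<le> L" using mangoldt_le[of n] n by (auto simp: Q_def intro: order.trans)
    show "ln (real n) \<le> L" by fact
  qed (use L in \<open>auto simp: Q_def\<close>)
  also have "\<dots> = real (card Q) * L ^ 3" by (simp add: power2_eq_square power3_eq_cube)
  also have "\<dots> \<le> (2 * sqrt (real N) * L) * L ^ 3" using cQ L by (intro mult_right_mono) auto
  also have "L ^ 3 \<le> 216 * sqrt (real N)"
  proof -
    have "L \<le> real N powr (1/6) / (1/6)" unfolding L_def using assms by (intro ln_powr_bound) auto
    then have "L ^ 3 \<le> (6 * real N powr (1/6)) ^ 3" using L by (intro power_mono) auto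
    also have "\<dots> = 216 * sqrt (real N)" using assms by (simp add: power_mult_distrib powr_power powr_half_sqrt)
    finally show ?thesis .
  qed
  also have "2 * sqrt (real N) * L * (216 * sqrt (real N)) = 432 * (real N * L)" by simp
  finally show ?thesis using L by (simp add: L_def mult_left_mono)
qed

definition prime_count :: "nat \<Rightarrow> real" where
  "prime_count N = real (card {p. prime p \<and> p \<le> N})"

text \<open>The easy direction: each prime up to N contributes at most (ln N)^3 to
  \<open>vsum\<close>, and the other prime powers are negligible.\<close>

lemma prime_count_lower:
  obtains C :: real where "C > 0" "\<And>N. N \<ge> 2 \<Longrightarrow> prime_count N \<ge> real N / ln (real N) - C * (real N / (ln (real N))\<^sup>2)"
proof -
  obtain C where C: "C > 0" "\<And>N. N \<ge> 1 \<Longrightarrow> \<bar>vsum N - real N * (ln (real N))\<^sup>2\<bar> \<le> C * (real N * ln (real N))"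
    using vsum_asymp by blast
  show ?thesis
  proof (rule that[of "C + 432"])
    fix N :: nat assume N: "N \<ge> 2"
    define L where "L = ln (real N)"
    have L: "L > 0" using N by (simp add: L_def)
    have "vsum N = (\<Sum>n | n \<in> {1..N} \<and> prime n. mangoldt n * (ln (real n))\<^sup>2)
        + (\<Sum>n | n \<in> {1..N} \<and> \<not> prime n. mangoldt n * (ln (real n))\<^sup>2)"
      unfolding vsum_def by (subst sum.union_disjoint[symmetric]) (auto intro!: sum.cong)
    also have "(\<Sum>n | n \<in> {1..N} \<and> prime n. mangoldt n * (ln (real n))\<^sup>2) \<le> (\<Sum>n | n \<in> {1..N} \<and> prime n. L ^ 3)"
    proof (rule sum_mono)
      fix p assume p: "p \<in> {n. n \<in> {1..N} \<and> prime n}"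
      then have "mangoldt p * (ln (real p))\<^sup>2 = ln (real p) ^ 3" by (simp add: power2_eq_square power3_eq_cube)
      also have "\<dots> \<le> L ^ 3" using p by (intro power_mono) (auto simp: L_def)
      finally show "mangoldt p * (ln (real p))\<^sup>2 \<le> L ^ 3" .
    qed
    also have "(\<Sum>n | n \<in> {1..N} \<and> prime n. L ^ 3) = prime_count N * L ^ 3"
    proof -
      have "{n. n \<in> {1..N} \<and> prime n} = {p. prime p \<and> p \<le> N}" by (auto intro: Suc_leI prime_gt_0_nat)
      then show ?thesis by (simp add: prime_count_def)
    qed
    also have "(\<Sum>n | n \<in> {1..N} \<and> \<not> prime n. mangoldt n * (ln (real n))\<^sup>2) \<le> 432 * (real N * L)"
      unfolding L_def using N by (intro sum_mangoldt_nonprime) auto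
    finally have "prime_count N * L ^ 3 \<ge> real N * L\<^sup>2 - (C + 432) * (real N * L)"
      using C(2)[of N] N unfolding L_def[symmetric] by (simp add: algebra_simps abs_le_iff)
    then have "prime_count N \<ge> (real N * L\<^sup>2 - (C + 432) * (real N * L)) / L ^ 3"
      using L by (simp add: pos_divide_le_eq)
    also have "(real N * L\<^sup>2 - (C + 432) * (real N * L)) / L ^ 3 = real N / L - (C + 432) * (real N / L\<^sup>2)"
      using L by (simp add: diff_divide_distrib power2_eq_square power3_eq_cube)
    finally show "prime_count N \<ge> real N / ln (real N) - (C + 432) * (real N / (ln (real N))\<^sup>2)" by (simp add: L_def)
  qed (use C in auto)
qed

text \<open>Partial summation as an inequality: the weight ln N - ln n accumulates the steps ln (m +
  1) - ln m <= 1/m for n <= m < N.\<close>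

lemma sum_log_weight_le:
  assumes "\<And>n. a n \<ge> (0::real)"
  shows "(\<Sum>n=1..N. a n * (ln (real N) - ln (real n))) \<le> (\<Sum>m=1..<N. (\<Sum>n=1..m. a n) / real m)"
proof (induction N)
  case (Suc N)
  show ?case
  proof (cases "N = 0")
    case False
    have "(\<Sum>n=1..Suc N. a n * (ln (real (Suc N)) - ln (real n)))
        = (\<Sum>n=1..N. a n * (ln (real N) - ln (real n)) + a n * (ln (real (Suc N)) - ln (real N)))"
      by (simp add: algebra_simps)
    also have "\<dots> = (\<Sum>n=1..N. a n * (ln (real N) - ln (real n))) + (\<Sum>n=1..N. a n) * (ln (real (Suc N)) - ln (real N))"
      by (simp add: sum.distrib sum_distrib_right)
    also have "\<dots> \<le> (\<Sum>m=1..<N. (\<Sum>n=1..m. a n) / real m) + (\<Sum>n=1..N. a n) * (1 / real N)"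
      using False by (intro add_mono Suc.IH mult_left_mono ln_Suc_diff_le sum_nonneg assms) auto
    also have "\<dots> = (\<Sum>m=1..<Suc N. (\<Sum>n=1..m. a n) / real m)" using False by simp
    finally show ?thesis .
  qed auto
qed auto

lemma ln_sq_le_sqrt:
  fixes x :: real
  assumes x: "x \<ge> 1"
  shows "(ln x)\<^sup>2 \<le> 16 * sqrt x"
proof -
  have "ln x \<le> x powr (1/4) / (1/4)" using x by (intro ln_powr_bound) auto
  then have "(ln x)\<^sup>2 \<le> (4 * x powr (1/4))\<^sup>2" using x by (intro power_mono) auto
  also have "\<dots> = 16 * sqrt x" using x by (simp add: power_mult_distrib powr_power powr_half_sqrt)
  finally show ?thesis .
qed

text \<open>Here the weights (ln p)^3 fall short of L^3, and the shortfall must be shown to be small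
  on average. It is bounded linearly by the deficit L - ln p, whose sum over the primes is
  controlled by \<open>vsum\<close> itself through partial summation.\<close>

lemma prime_count_upper:
  obtains C :: real where "C > 0" "\<And>N. N \<ge> 2 \<Longrightarrow> prime_count N \<le> real N / ln (real N) + C * (real N / (ln (real N))\<^sup>2)"
proof -
  obtain C where C: "C > 0" "\<And>N. N \<ge> 1 \<Longrightarrow> \<bar>vsum N - real N * (ln (real N))\<^sup>2\<bar> \<le> C * (real N * ln (real N))"
    using vsum_asymp by blast
  show ?thesis
  proof (rule that[of "C + 48 + 24 * (1 + 2 * C)"])
    fix N :: nat assume N: "N \<ge> 2"
    define L where "L = ln (real N)"
    have "ln (2::real) \<le> L" using N by (simp add: L_def)
    then have L: "L \<ge> 1/2" "L > 0" using ln_2_ge_half by auto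
    define P where "P = {p. prime p \<and> p \<le> N}"
    have finP: "finite P" by (rule finite_subset[of _ "{..N}"]) (auto simp: P_def)
    have Psub: "P \<subseteq> {1..N}" by (auto simp: P_def Suc_le_eq prime_gt_0_nat)
    define v where "v = (\<lambda>n. mangoldt n * (ln (real n))\<^sup>2 :: real)"
    have v: "v n \<ge> 0" for n by (simp add: v_def mangoldt_nonneg)
    have vp: "v p = ln (real p) ^ 3" if "p \<in> P" for p
      using that by (simp add: v_def P_def power2_eq_square power3_eq_cube)
    \<comment> \<open>The deficit averages to O(1): the bound is smaller by one logarithm than the
      trivial N L^3.\<close>
    have bv: "(\<Sum>n=1..N. v n * (L - ln (real n))) \<le> (1 + 2 * C) * real N * L\<^sup>2"
    proof -
      have "(\<Sum>n=1..N. v n * (L - ln (real n))) \<le> (\<Sum>m=1..<N. vsum m / real m)"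
        using sum_log_weight_le[where a = v and N = N, OF v] by (simp add: L_def vsum_def v_def)
      also have "\<dots> \<le> (\<Sum>m=1..<N. (1 + 2 * C) * L\<^sup>2)"
      proof (rule sum_mono)
        fix m assume m: "m \<in> {1..<N}"
        have lm: "0 \<le> ln (real m)" "ln (real m) \<le> L" using m by (auto simp: L_def)
        have "vsum m \<le> real m * (ln (real m))\<^sup>2 + C * (real m * ln (real m))" using C(2)[of m] m by (simp add: abs_le_iff)
        also have "\<dots> \<le> real m * L\<^sup>2 + C * (real m * (2 * L\<^sup>2))"
        proof (intro add_mono mult_left_mono power_mono lm)
          have "L * 1 \<le> L * (2 * L)" using L by (intro mult_left_mono) auto
          then show "ln (real m) \<le> 2 * L\<^sup>2" using lm by (simp add: power2_eq_square)
        qed (use C in auto)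
        also have "\<dots> = real m * ((1 + 2 * C) * L\<^sup>2)" by (simp add: algebra_simps)
        finally show "vsum m / real m \<le> (1 + 2 * C) * L\<^sup>2" using m by (simp add: field_simps)
      qed
      also have "\<dots> \<le> (1 + 2 * C) * real N * L\<^sup>2" using C by (simp add: mult_right_mono)
      finally show ?thesis .
    qed
    have S1: "(\<Sum>p\<in>P. v p) \<le> vsum N"
      unfolding vsum_def v_def[symmetric] using Psub v by (intro sum_mono2) (auto simp: v_def)
    have S2: "(\<Sum>p\<in>P. v p * (L - ln (real p))) \<le> (\<Sum>n=1..N. v n * (L - ln (real n)))"
      using Psub v by (intro sum_mono2) (auto simp: L_def)
    \<comment> \<open>At most sqrt N primes satisfy p^2 <= N, each with deficit at most L. For the
      others ln p >= L/2, so v p >= L^3 / 8 and the weight 8 v p / L^3 is at least 1.\<close>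
    have S3: "(\<Sum>p\<in>P. L - ln (real p)) \<le> sqrt (real N) * L + 8 / L ^ 3 * (\<Sum>p\<in>P. v p * (L - ln (real p)))"
    proof -
      have "(\<Sum>p\<in>P. L - ln (real p)) \<le> (\<Sum>p\<in>P. (if p\<^sup>2 \<le> N then L else 0) + 8 / L ^ 3 * (v p * (L - ln (real p))))"
      proof (rule sum_mono)
        fix p assume p: "p \<in> P"
        then have lp: "0 \<le> ln (real p)" "ln (real p) \<le> L" using Psub by (auto simp: L_def)
        have p0: "real p > 0" using p Psub by auto
        have nn: "0 \<le> 8 / L ^ 3 * (v p * (L - ln (real p)))" using L lp v by simp
        show "L - ln (real p) \<le> (if p\<^sup>2 \<le> N then L else 0) + 8 / L ^ 3 * (v p * (L - ln (real p)))"
        proof (cases "p\<^sup>2 \<le> N")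
          case True
          then show ?thesis using nn lp by auto
        next
          case False
          then have "real N \<le> real p ^ 2" by (simp flip: of_nat_power)
          then have "L \<le> ln (real p ^ 2)" unfolding L_def using N p0 by (subst ln_le_cancel_iff) auto
          then have "L / 2 \<le> ln (real p)" using p0 by (simp add: ln_realpow)
          then have "(L / 2) ^ 3 \<le> v p" unfolding vp[OF p] using L by (intro power_mono) auto
          then have "1 \<le> 8 / L ^ 3 * v p" using L by (simp add: power_divide field_simps)
          then have "1 * (L - ln (real p)) \<le> (8 / L ^ 3 * v p) * (L - ln (real p))" using lp by (intro mult_right_mono) auto
          then show ?thesis using False by simp
        qed
      qed
      also have "\<dots> = (\<Sum>p\<in>P. (if p\<^sup>2 \<le> N then L else 0)) + 8 / L ^ 3 * (\<Sum>p\<in>P. v p * (L - ln (real p)))"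
        by (simp add: sum.distrib sum_distrib_left)
      also have "(\<Sum>p\<in>P. (if p\<^sup>2 \<le> N then L else 0)) \<le> sqrt (real N) * L"
      proof -
        have "card (P \<inter> {p. p\<^sup>2 \<le> N}) \<le> card {p::nat. 1 \<le> p \<and> p\<^sup>2 \<le> N}"
          using Psub by (intro card_mono finite_squares_le) auto
        then have "real (card (P \<inter> {p. p\<^sup>2 \<le> N})) \<le> sqrt (real N)" using card_sqrt_le[of N] by linarith
        then have "real (card (P \<inter> {p. p\<^sup>2 \<le> N})) * L \<le> sqrt (real N) * L" using L by (intro mult_right_mono) auto
        then show ?thesis using finP by (simp add: sum.If_cases)
      qed
      finally show ?thesis by simp
    qed
    have "prime_count N = (\<Sum>p\<in>P. 1)" by (simp add: prime_count_def P_def)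
    also have "\<dots> \<le> (\<Sum>p\<in>P. v p / L ^ 3 + 3 / L * (L - ln (real p)))"
    proof (rule sum_mono)
      fix p assume p: "p \<in> P"
      define u where "u = ln (real p) / L"
      have u: "0 \<le> u" "u \<le> 1" using p Psub L by (auto simp: u_def L_def field_simps)
      \<comment> \<open>Expanded, this is u^3 - 3u + 2 >= 0, the tangent inequality for the cube at
        u = 1.\<close>
      have "(1 - u)\<^sup>2 * (2 + u) \<ge> 0" using u by simp
      then have "1 \<le> u ^ 3 + 3 * (1 - u)" by (simp add: power2_eq_square power3_eq_cube algebra_simps)
      also have "u ^ 3 + 3 * (1 - u) = v p / L ^ 3 + 3 / L * (L - ln (real p))"
        unfolding vp[OF p] u_def using L by (simp add: power_divide field_simps)
      finally show "1 \<le> v p / L ^ 3 + 3 / L * (L - ln (real p))" .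
    qed
    also have "\<dots> = (\<Sum>p\<in>P. v p) / L ^ 3 + 3 / L * (\<Sum>p\<in>P. L - ln (real p))"
      by (simp add: sum.distrib sum_divide_distrib sum_distrib_left)
    also have "\<dots> \<le> (real N * L\<^sup>2 + C * (real N * L)) / L ^ 3 + 3 / L * (sqrt (real N) * L + 8 / L ^ 3 * ((1 + 2 * C) * real N * L\<^sup>2))"
    proof (intro add_mono divide_right_mono mult_left_mono)
      show "(\<Sum>p\<in>P. v p) \<le> real N * L\<^sup>2 + C * (real N * L)"
        using S1 C(2)[of N] N unfolding L_def[symmetric] by (simp add: abs_le_iff)
      have "8 / L ^ 3 * (\<Sum>p\<in>P. v p * (L - ln (real p))) \<le> 8 / L ^ 3 * ((1 + 2 * C) * real N * L\<^sup>2)"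
        using S2 bv L by (intro mult_left_mono) auto
      then show "(\<Sum>p\<in>P. L - ln (real p)) \<le> sqrt (real N) * L + 8 / L ^ 3 * ((1 + 2 * C) * real N * L\<^sup>2)"
        using S3 by linarith
    qed (use L in auto)
    also have "\<dots> = real N / L + C * (real N / L\<^sup>2) + 3 * sqrt (real N) + 24 * (1 + 2 * C) * (real N / L\<^sup>2)"
      using L by (simp add: power2_eq_square power3_eq_cube field_simps)
    also have "3 * sqrt (real N) \<le> 48 * (real N / L\<^sup>2)"
    proof -
      have "sqrt (real N) * L\<^sup>2 \<le> sqrt (real N) * (16 * sqrt (real N))"
        unfolding L_def using N by (intro mult_left_mono ln_sq_le_sqrt) auto
      also have "\<dots> = 16 * real N" by simp
      finally have "sqrt (real N) * L\<^sup>2 \<le> 16 * real N" .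
      then show ?thesis using L by (simp add: field_simps)
    qed
    finally show "prime_count N \<le> real N / ln (real N) + (C + 48 + 24 * (1 + 2 * C)) * (real N / (ln (real N))\<^sup>2)"
      unfolding L_def[symmetric] by (simp add: algebra_simps)
  qed (use C in auto)
qed

section \<open>The Selberg sieve\<close>


text \<open>
  Squarefree divisors are represented by the set of their prime factors, and \<open>DD\<close> by the sets of those
  below the level of the sieve; only that \<open>DD\<close> is closed under subsets matters.
\<close>

locale selberg_sieve =
  fixes T :: "'a set" and g :: "'a \<Rightarrow> real" and DD :: "'a set set"
  assumes fin: "finite T" and g_pos: "\<And>p. p \<in> T \<Longrightarrow> 0 < g p" and g_lt1: "\<And>p. p \<in> T \<Longrightarrow> g p < 1"
    and DD_sub: "\<And>S. S \<in> DD \<Longrightarrow> S \<subseteq> T" and DD_empty: "{} \<in> DD"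
    and DD_down: "\<And>S R. S \<in> DD \<Longrightarrow> R \<subseteq> S \<Longrightarrow> R \<in> DD"
begin

definition h :: "'a \<Rightarrow> real" where "h p = g p / (1 - g p)"

definition G :: real where "G = (\<Sum>S\<in>DD. prod h S)"

text \<open>The Selberg weights, with (-1)^(card S) in the role of the Moebius function: they make
  the quadratic form in \<open>quadratic_form\<close> equal to 1 / G under the constraint
  \<open>lam {} = 1\<close>.\<close>

definition lam :: "'a set \<Rightarrow> real" where
  "lam S = (-1) ^ card S / (prod g S * G) * (\<Sum>L | L \<in> DD \<and> S \<subseteq> L. prod h L)"

lemma finDD: "finite DD"
  by (rule finite_subset[of _ "Pow T"]) (use fin DD_sub in auto)

lemma h_pos: "p \<in> T \<Longrightarrow> 0 < h p"
  using g_pos g_lt1 by (simp add: h_def)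

lemma prod_h_pos: "S \<in> DD \<Longrightarrow> 0 < prod h S"
  using DD_sub h_pos by (intro prod_pos) blast

lemma prod_g_pos: "S \<subseteq> T \<Longrightarrow> 0 < prod g S"
  using g_pos by (intro prod_pos) blast

lemma G_ge_1: "1 \<le> G"
proof -
  have "(\<Sum>S\<in>{{}}. prod h S) \<le> G"
    unfolding G_def using finDD DD_empty prod_h_pos less_imp_le by (intro sum_mono2) blast+
  then show ?thesis by simp
qed

lemma lam_empty: "lam {} = 1"
  using G_ge_1 by (simp add: lam_def G_def[symmetric])

text \<open>Removing \<open>S\<close> maps the sets L of \<open>DD\<close> containing S injectively
  into \<open>DD\<close>, so their sum is at most prod h S times G, and h p / g p = 1 / (1 - g p).
  This coarse bound is later multiplied out to the level of the sieve.\<close>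

lemma abs_lam_le:
  assumes S: "S \<in> DD"
  shows "\<bar>lam S\<bar> \<le> (\<Prod>p\<in>S. 1 / (1 - g p))"
proof -
  have ST: "S \<subseteq> T" using DD_sub S by blast
  have finS: "finite S" using ST fin by (rule finite_subset)
  have "(\<Sum>L | L \<in> DD \<and> S \<subseteq> L. prod h L) = (\<Sum>L | L \<in> DD \<and> S \<subseteq> L. prod h S * prod h (L - S))"
  proof (rule sum.cong)
    fix L assume "L \<in> {L. L \<in> DD \<and> S \<subseteq> L}"
    then have "finite L" "S \<subseteq> L" using DD_sub fin finite_subset by blast+
    then show "prod h L = prod h S * prod h (L - S)" by (metis mult.commute prod.subset_diff)
  qed auto
  also have "\<dots> = prod h S * (\<Sum>L | L \<in> DD \<and> S \<subseteq> L. prod h (L - S))" by (simp add: sum_distrib_left)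
  also have "(\<Sum>L | L \<in> DD \<and> S \<subseteq> L. prod h (L - S)) = (\<Sum>R\<in>(\<lambda>L. L - S) ` {L. L \<in> DD \<and> S \<subseteq> L}. prod h R)"
    by (subst sum.reindex) (auto simp: inj_on_def)
  also have "\<dots> \<le> G"
    unfolding G_def using finDD prod_h_pos DD_down by (intro sum_mono2) (auto intro: less_imp_le)
  finally have le: "(\<Sum>L | L \<in> DD \<and> S \<subseteq> L. prod h L) \<le> prod h S * G"
    using prod_h_pos[OF S] by (simp add: mult_left_mono)
  have nn: "0 \<le> (\<Sum>L | L \<in> DD \<and> S \<subseteq> L. prod h L)"
    using prod_h_pos by (intro sum_nonneg) (auto intro: less_imp_le)
  have pg: "prod g S * G > 0" using prod_g_pos[OF ST] G_ge_1 by simp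
  have "\<bar>lam S\<bar> = (\<Sum>L | L \<in> DD \<and> S \<subseteq> L. prod h L) / (prod g S * G)"
    using nn prod_g_pos[OF ST] G_ge_1 by (simp add: lam_def abs_mult power_abs)
  also have "\<dots> \<le> prod h S * G / (prod g S * G)" using le pg by (intro divide_right_mono) auto
  also have "\<dots> = prod h S / prod g S" using G_ge_1 by simp
  also have "\<dots> = (\<Prod>p\<in>S. h p / g p)" by (simp add: prod_dividef)
  also have "\<dots> = (\<Prod>p\<in>S. 1 / (1 - g p))"
    using ST g_pos by (intro prod.cong refl) (force simp: h_def)
  finally show ?thesis .
qed

text \<open>Moebius inversion on the lattice of subsets: the sum over the part of S outside L is the
  expanded product of factors -1 + 1.\<close>

lemma sum_alternating:
  assumes "finite M" "L \<subseteq> M"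
  shows "(\<Sum>S | L \<subseteq> S \<and> S \<subseteq> M. (-1) ^ card S :: real) = (if L = M then (-1) ^ card M else 0)"
proof -
  have finL: "finite L" using assms finite_subset by blast
  have "(\<Sum>S | L \<subseteq> S \<and> S \<subseteq> M. (-1) ^ card S :: real) = (\<Sum>R\<in>Pow (M - L). (-1) ^ card (L \<union> R))"
    by (rule sum.reindex_bij_witness[where i = "\<lambda>R. L \<union> R" and j = "\<lambda>S. S - L"]) (use assms in \<open>auto simp: Un_absorb1\<close>)
  also have "\<dots> = (\<Sum>R\<in>Pow (M - L). (-1) ^ card L * (-1) ^ card R)"
  proof (rule sum.cong)
    fix R assume "R \<in> Pow (M - L)"
    then have "card (L \<union> R) = card L + card R"
      using assms finL finite_subset by (intro card_Un_disjoint) blast+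
    then show "(-1::real) ^ card (L \<union> R) = (-1) ^ card L * (-1) ^ card R" by (simp add: power_add)
  qed auto
  also have "\<dots> = (-1) ^ card L * (\<Sum>R\<in>Pow (M - L). (\<Prod>x\<in>R. -1) * (\<Prod>x\<in>(M - L) - R. 1))"
    by (simp add: sum_distrib_left)
  also have "(\<Sum>R\<in>Pow (M - L). (\<Prod>x\<in>R. -1) * (\<Prod>x\<in>(M - L) - R. 1)) = (\<Prod>x\<in>M - L. -1 + (1::real))"
    using assms by (subst prod_add) auto
  also have "\<dots> = (if L = M then 1 else 0)"
    using assms by (auto simp: prod_constant card_gt_0_iff power_0_left)
  finally show ?thesis by simp
qed

text \<open>Diagonalisation. From 1 / g = 1 + 1 / h one gets g(S Un R) = g(S) g(R) times the sum of
  1 / h(L) over L contained in both, so the form is the sum of (u L)^2 / h(L). Moebius inversion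
  gives u L = (-1)^(card L) h(L) / G, and the sum of h(L) / G^2 is 1 / G.\<close>

lemma quadratic_form:
  "(\<Sum>S\<in>DD. \<Sum>R\<in>DD. lam S * lam R * prod g (S \<union> R)) = 1 / G"
proof -
  define u where "u = (\<lambda>L. \<Sum>S | S \<in> DD \<and> L \<subseteq> S. prod g S * lam S)"
  have finS: "finite S" if "S \<in> DD" for S using DD_sub[OF that] fin finite_subset by blast
  have u: "u L = (-1) ^ card L * prod h L / G" if L: "L \<in> DD" for L
  proof -
    have "u L = (\<Sum>S | S \<in> DD \<and> L \<subseteq> S. \<Sum>M | M \<in> DD \<and> S \<subseteq> M. (-1) ^ card S * prod h M / G)"
      unfolding u_def
    proof (rule sum.cong)
      fix S assume "S \<in> {S. S \<in> DD \<and> L \<subseteq> S}"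
      then have "prod g S \<noteq> 0" using prod_g_pos[of S] DD_sub by auto
      then show "prod g S * lam S = (\<Sum>M | M \<in> DD \<and> S \<subseteq> M. (-1) ^ card S * prod h M / G)"
        by (simp add: lam_def sum_distrib_left sum_divide_distrib divide_simps)
    qed auto
    also have "\<dots> = (\<Sum>M | M \<in> DD \<and> L \<subseteq> M. \<Sum>S | L \<subseteq> S \<and> S \<subseteq> M. (-1) ^ card S * prod h M / G)"
    proof -
      have "(\<Sum>S | S \<in> DD \<and> L \<subseteq> S. \<Sum>M | M \<in> DD \<and> S \<subseteq> M. (-1) ^ card S * prod h M / G)
          = (\<Sum>(S, M)\<in>(SIGMA S:{S. S \<in> DD \<and> L \<subseteq> S}. {M. M \<in> DD \<and> S \<subseteq> M}). (-1) ^ card S * prod h M / G)"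
        using finDD by (intro sum.Sigma) auto
      also have "\<dots> = (\<Sum>(M, S)\<in>(SIGMA M:{M. M \<in> DD \<and> L \<subseteq> M}. {S. L \<subseteq> S \<and> S \<subseteq> M}). (-1) ^ card S * prod h M / G)"
        by (rule sum.reindex_bij_witness[where i = "\<lambda>(a, b). (b, a)" and j = "\<lambda>(a, b). (b, a)"]) (use DD_down in auto)
      also have "\<dots> = (\<Sum>M | M \<in> DD \<and> L \<subseteq> M. \<Sum>S | L \<subseteq> S \<and> S \<subseteq> M. (-1) ^ card S * prod h M / G)"
        using finDD finS by (intro sum.Sigma[symmetric]) (auto intro: finite_subset[of _ "Pow M" for M])
      finally show ?thesis .
    qed
    also have "\<dots> = (\<Sum>M | M \<in> DD \<and> L \<subseteq> M. prod h M / G * (if L = M then (-1) ^ card M else 0))"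
    proof (rule sum.cong)
      fix M assume M: "M \<in> {M. M \<in> DD \<and> L \<subseteq> M}"
      have "(\<Sum>S | L \<subseteq> S \<and> S \<subseteq> M. (-1) ^ card S * prod h M / G) = prod h M / G * (\<Sum>S | L \<subseteq> S \<and> S \<subseteq> M. (-1) ^ card S)"
        by (simp add: sum_distrib_left mult_ac)
      then show "(\<Sum>S | L \<subseteq> S \<and> S \<subseteq> M. (-1) ^ card S * prod h M / G) = prod h M / G * (if L = M then (-1) ^ card M else 0)"
        using sum_alternating[of M L] M finS by simp
    qed auto
    also have "\<dots> = (\<Sum>M\<in>{L}. prod h M / G * (-1) ^ card M)"
      using L finDD by (intro sum.mono_neutral_cong_right) auto
    finally show ?thesis by simp
  qed
  have gU: "prod g (S \<union> R) = prod g S * prod g R * (\<Sum>L\<in>Pow (S \<inter> R). 1 / prod h L)" if "S \<in> DD" "R \<in> DD" for S R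
  proof -
    have f: "finite S" "finite R" using finS that by auto
    have sub: "S \<inter> R \<subseteq> T" using DD_sub[OF that(1)] by auto
    have "(\<Sum>L\<in>Pow (S \<inter> R). 1 / prod h L) = (\<Sum>L\<in>Pow (S \<inter> R). (\<Prod>p\<in>L. 1 / h p) * (\<Prod>p\<in>S \<inter> R - L. 1))"
      by (simp add: prod_dividef)
    also have "\<dots> = (\<Prod>p\<in>S \<inter> R. 1 / h p + 1)" using f by (subst prod_add) auto
    also have "\<dots> = (\<Prod>p\<in>S \<inter> R. 1 / g p)"
    proof (rule prod.cong)
      fix p assume "p \<in> S \<inter> R"
      then have "0 < g p" "g p < 1" using sub g_pos g_lt1 by auto
      then show "1 / h p + 1 = 1 / g p" by (simp add: h_def field_simps)
    qed auto
    finally have e: "(\<Sum>L\<in>Pow (S \<inter> R). 1 / prod h L) = 1 / prod g (S \<inter> R)" by (simp add: prod_dividef)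
    have "prod g (S \<union> R) * prod g (S \<inter> R) = prod g S * prod g R"
      using f by (rule prod.union_inter)
    moreover have "prod g (S \<inter> R) \<noteq> 0" using prod_g_pos[OF sub] by simp
    ultimately show ?thesis unfolding e by (simp add: field_simps)
  qed
  have "(\<Sum>S\<in>DD. \<Sum>R\<in>DD. lam S * lam R * prod g (S \<union> R))
      = (\<Sum>S\<in>DD. \<Sum>R\<in>DD. \<Sum>L\<in>DD. (if L \<subseteq> S \<and> L \<subseteq> R then (prod g S * lam S) * (prod g R * lam R) / prod h L else 0))"
  proof (intro sum.cong refl)
    fix S R assume SR: "S \<in> DD" "R \<in> DD"
    have "(\<Sum>L\<in>Pow (S \<inter> R). (prod g S * lam S) * (prod g R * lam R) / prod h L)
        = (\<Sum>L\<in>DD. (if L \<subseteq> S \<and> L \<subseteq> R then (prod g S * lam S) * (prod g R * lam R) / prod h L else 0))"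
      using SR DD_down finDD by (intro sum.mono_neutral_cong_left) auto
    then show "lam S * lam R * prod g (S \<union> R) = (\<Sum>L\<in>DD. (if L \<subseteq> S \<and> L \<subseteq> R then (prod g S * lam S) * (prod g R * lam R) / prod h L else 0))"
      unfolding gU[OF SR] by (simp add: sum_distrib_left mult_ac)
  qed
  also have "\<dots> = (\<Sum>S\<in>DD. \<Sum>L\<in>DD. \<Sum>R\<in>DD. (if L \<subseteq> S \<and> L \<subseteq> R then (prod g S * lam S) * (prod g R * lam R) / prod h L else 0))"
    by (rule sum.cong[OF refl sum.swap])
  also have "\<dots> = (\<Sum>L\<in>DD. \<Sum>S\<in>DD. \<Sum>R\<in>DD. (if L \<subseteq> S \<and> L \<subseteq> R then (prod g S * lam S) * (prod g R * lam R) / prod h L else 0))"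
    by (rule sum.swap)
  also have "\<dots> = (\<Sum>L\<in>DD. u L * u L / prod h L)"
  proof (rule sum.cong[OF refl])
    fix L
    have "u L * u L / prod h L = (\<Sum>S | S \<in> DD \<and> L \<subseteq> S. \<Sum>R | R \<in> DD \<and> L \<subseteq> R. (prod g S * lam S) * (prod g R * lam R) / prod h L)"
      by (simp add: u_def sum_product sum_divide_distrib)
    also have "\<dots> = (\<Sum>S\<in>DD. if L \<subseteq> S then (\<Sum>R\<in>DD. if L \<subseteq> R then (prod g S * lam S) * (prod g R * lam R) / prod h L else 0) else 0)"
      using finDD by (simp add: sum.inter_filter)
    also have "\<dots> = (\<Sum>S\<in>DD. \<Sum>R\<in>DD. (if L \<subseteq> S \<and> L \<subseteq> R then (prod g S * lam S) * (prod g R * lam R) / prod h L else 0))"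
      by (intro sum.cong refl) auto
    finally show "(\<Sum>S\<in>DD. \<Sum>R\<in>DD. (if L \<subseteq> S \<and> L \<subseteq> R then (prod g S * lam S) * (prod g R * lam R) / prod h L else 0)) = u L * u L / prod h L" ..
  qed
  also have "\<dots> = (\<Sum>L\<in>DD. prod h L / G\<^sup>2)"
  proof (rule sum.cong[OF refl])
    fix L assume L: "L \<in> DD"
    have "((-1) ^ card L * (-1) ^ card L :: real) = 1" by (simp flip: power_add)
    then show "u L * u L / prod h L = prod h L / G\<^sup>2"
      unfolding u[OF L] using prod_h_pos[OF L] by (simp add: power2_eq_square field_simps)
  qed
  also have "\<dots> = G / G\<^sup>2" by (simp add: G_def sum_divide_distrib)
  finally show ?thesis using G_ge_1 by (simp add: power2_eq_square)
qed

text \<open>The indicator of the sifted elements is at most the square of the sum of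
  \<open>lam S\<close> over S contained in \<open>bad n\<close>, which is \<open>lam {} = 1\<close>
  on these elements. Expanding the square leaves the quadratic form as main term.\<close>

theorem sieve:
  fixes bad :: "nat \<Rightarrow> 'a set" and A :: "nat set" and X :: real and r :: "'a set \<Rightarrow> real"
  assumes finA: "finite A"
    and count: "\<And>S. S \<subseteq> T \<Longrightarrow> real (card {n \<in> A. S \<subseteq> bad n}) \<le> X * prod g S + r S"
       "\<And>S. S \<subseteq> T \<Longrightarrow> real (card {n \<in> A. S \<subseteq> bad n}) \<ge> X * prod g S - r S"
  shows "real (card {n \<in> A. bad n \<inter> T = {}}) \<le> X / G + (\<Sum>S\<in>DD. \<Sum>R\<in>DD. \<bar>lam S\<bar> * \<bar>lam R\<bar> * r (S \<union> R))"
proof -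
  define w where "w = (\<lambda>n. \<Sum>S | S \<in> DD \<and> S \<subseteq> bad n. lam S)"
  have "real (card {n \<in> A. bad n \<inter> T = {}}) = (\<Sum>n | n \<in> A \<and> bad n \<inter> T = {}. (w n)\<^sup>2)"
  proof -
    have "w n = 1" if "bad n \<inter> T = {}" for n
    proof -
      have "{S. S \<in> DD \<and> S \<subseteq> bad n} = {{}}" using that DD_sub DD_empty by auto
      then show ?thesis by (simp add: w_def lam_empty)
    qed
    then show ?thesis by simp
  qed
  also have "\<dots> \<le> (\<Sum>n\<in>A. (w n)\<^sup>2)" using finA by (intro sum_mono2) auto
  also have "\<dots> = (\<Sum>n\<in>A. \<Sum>S\<in>DD. \<Sum>R\<in>DD. if S \<union> R \<subseteq> bad n then lam S * lam R else 0)"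
  proof (rule sum.cong[OF refl])
    fix n
    have "(w n)\<^sup>2 = (\<Sum>S\<in>DD. \<Sum>R\<in>DD. (if S \<subseteq> bad n then lam S else 0) * (if R \<subseteq> bad n then lam R else 0))"
      using finDD by (simp add: w_def power2_eq_square sum.inter_filter sum_product)
    also have "\<dots> = (\<Sum>S\<in>DD. \<Sum>R\<in>DD. if S \<union> R \<subseteq> bad n then lam S * lam R else 0)"
      by (intro sum.cong refl) auto
    finally show "(w n)\<^sup>2 = \<dots>" .
  qed
  also have "\<dots> = (\<Sum>S\<in>DD. \<Sum>R\<in>DD. \<Sum>n\<in>A. if S \<union> R \<subseteq> bad n then lam S * lam R else 0)"
    by (subst sum.swap) (rule sum.cong[OF refl sum.swap])
  also have "\<dots> = (\<Sum>S\<in>DD. \<Sum>R\<in>DD. lam S * lam R * real (card {n \<in> A. S \<union> R \<subseteq> bad n}))"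
    using finA by (intro sum.cong refl) (simp add: sum.inter_filter[symmetric] mult.commute)
  also have "\<dots> \<le> (\<Sum>S\<in>DD. \<Sum>R\<in>DD. X * (lam S * lam R * prod g (S \<union> R)) + \<bar>lam S\<bar> * \<bar>lam R\<bar> * r (S \<union> R))"
  proof (intro sum_mono)
    fix S R assume "S \<in> DD" "R \<in> DD"
    then have SR: "S \<union> R \<subseteq> T" using DD_sub by auto
    define c where "c = real (card {n \<in> A. S \<union> R \<subseteq> bad n}) - X * prod g (S \<union> R)"
    have "\<bar>c\<bar> \<le> r (S \<union> R)" using count[OF SR] by (auto simp: c_def abs_le_iff)
    then have "\<bar>lam S * lam R\<bar> * \<bar>c\<bar> \<le> \<bar>lam S * lam R\<bar> * r (S \<union> R)" by (intro mult_left_mono) auto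
    then have "lam S * lam R * c \<le> \<bar>lam S\<bar> * \<bar>lam R\<bar> * r (S \<union> R)"
      using abs_ge_self[of "lam S * lam R * c"] by (simp add: abs_mult)
    then show "lam S * lam R * real (card {n \<in> A. S \<union> R \<subseteq> bad n}) \<le> X * (lam S * lam R * prod g (S \<union> R)) + \<bar>lam S\<bar> * \<bar>lam R\<bar> * r (S \<union> R)"
      by (simp add: c_def algebra_simps)
  qed
  also have "\<dots> = X * (\<Sum>S\<in>DD. \<Sum>R\<in>DD. lam S * lam R * prod g (S \<union> R)) + (\<Sum>S\<in>DD. \<Sum>R\<in>DD. \<bar>lam S\<bar> * \<bar>lam R\<bar> * r (S \<union> R))"
    by (simp add: sum.distrib sum_distrib_left)
  finally show ?thesis unfolding quadratic_form by simp
qed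

end

section \<open>Counting in residue classes\<close>


lemma card_filter_split:
  "card {n \<in> {1..a + m}. Q n} = card {n \<in> {1..a::nat}. Q n} + card {n \<in> {a<..a + m}. Q n}"
proof -
  have "{n \<in> {1..a + m}. Q n} = {n \<in> {1..a}. Q n} \<union> {n \<in> {a<..a + m}. Q n}" by auto
  then show ?thesis by (simp add: card_Un_disjoint disjoint_iff)
qed

lemma card_residue_class_full:
  fixes m q r :: nat
  assumes "r < m"
  shows "card {n \<in> {1..m * q}. n mod m = r} = q"
proof (induction q)
  case (Suc q)
  \<comment> \<open>The block of length m starts just after m q, so the residue 0 occurs at its
    right end.\<close>
  have single: "{n \<in> {m * q<..m * q + m}. n mod m = r} = {if r = 0 then m * q + m else m * q + r}"
  proof (rule Set.set_eqI, rule iffI)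
    fix n assume "n \<in> {n \<in> {m * q<..m * q + m}. n mod m = r}"
    then have n: "m * q < n" "n \<le> m * q + m" "n mod m = r" by auto
    define k where "k = n - m * q"
    have k: "n = m * q + k" "0 < k" "k \<le> m" using n by (auto simp: k_def)
    have "k mod m = r" using n(3) by (simp add: k(1))
    then show "n \<in> {if r = 0 then m * q + m else m * q + r}" using k by (cases "k = m") auto
  qed (use assms in auto)
  have "card {n \<in> {1..m * Suc q}. n mod m = r} = card {n \<in> {1..m * q}. n mod m = r} + card {n \<in> {m * q<..m * q + m}. n mod m = r}"
    using card_filter_split[of "m * q" m "\<lambda>n. n mod m = r"] by (simp only: mult_Suc_right add.commute)
  also have "card {n \<in> {m * q<..m * q + m}. n mod m = r} = 1" unfolding single by simp
  finally show ?case using Suc by linarith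
qed auto

lemma card_residue_class:
  fixes m N r :: nat
  assumes "r < m"
  shows "\<bar>real (card {n \<in> {1..N}. n mod m = r}) - real N / real m\<bar> \<le> 1"
proof -
  define q where "q = N div m"
  have m: "m > 0" using assms by simp
  have "N = m * q + N mod m" by (simp add: q_def)
  moreover have "N mod m < m" using m by simp
  ultimately have q: "m * q \<le> N" "N < m * Suc q" unfolding mult_Suc_right by linarith+
  have "card {n \<in> {1..m * q}. n mod m = r} \<le> card {n \<in> {1..N}. n mod m = r}"
    using q by (intro card_mono) auto
  moreover have "card {n \<in> {1..N}. n mod m = r} \<le> card {n \<in> {1..m * Suc q}. n mod m = r}"
    using q by (intro card_mono) auto
  ultimately have c: "q \<le> card {n \<in> {1..N}. n mod m = r}" "card {n \<in> {1..N}. n mod m = r} \<le> q + 1"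
    using card_residue_class_full[OF assms, of q] card_residue_class_full[OF assms, of "Suc q"] by linarith+
  have "real m * real q \<le> real N" "real N \<le> real m * (real q + 1)"
  proof -
    have "real (m * q) \<le> real N" "real N \<le> real (m * Suc q)" using q unfolding of_nat_le_iff by auto
    then show "real m * real q \<le> real N" "real N \<le> real m * (real q + 1)" by (simp_all add: algebra_simps)
  qed
  then have "real q \<le> real N / real m" "real N / real m \<le> real q + 1" using m by (auto simp: field_simps)
  with c show ?thesis by linarith
qed

text \<open>The Chinese remainder theorem merges both conditions into one residue class modulo a b,
  so the error is 1 rather than the product of two errors.\<close>

lemma card_two_congruences:
  fixes a b N :: nat and s :: int
  assumes "a > 0" "b > 0" "coprime a b"
  shows "\<bar>real (card {n \<in> {1..N}. a dvd n \<and> int b dvd int n + s}) - real N / (real a * real b)\<bar> \<le> 1"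
proof -
  \<comment> \<open>The shift has either sign; reducing -s modulo b gives the natural number
    required by the remainder theorem.\<close>
  obtain r0 where r0: "[r0 = 0] (mod a)" "[r0 = nat ((-s) mod int b)] (mod b)"
    using binary_chinese_remainder_nat[OF assms(3)] by blast
  define r where "r = r0 mod (a * b)"
  have r: "r < a * b" using assms by (simp add: r_def)
  have b0: "int b dvd int r0 + s"
  proof -
    have "[int r0 = int (nat ((-s) mod int b))] (mod int b)" using r0(2) by (simp only: cong_int_iff)
    also have "int (nat ((-s) mod int b)) = (-s) mod int b" using pos_mod_sign[of "int b" "-s"] assms by simp
    finally have "[int r0 = - s] (mod int b)" by (simp add: cong_def)
    then have "int b dvd int r0 - (- s)" by (simp only: cong_iff_dvd_diff)
    then show ?thesis by simp
  qed
  have "a dvd n \<and> int b dvd int n + s \<longleftrightarrow> n mod (a * b) = r" for n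
  proof -
    have "a dvd n \<longleftrightarrow> [n = r0] (mod a)"
      using r0(1) by (auto simp: cong_def dvd_eq_mod_eq_0)
    moreover have "int b dvd int n + s \<longleftrightarrow> [n = r0] (mod b)"
    proof -
      have "int b dvd int n + s \<longleftrightarrow> int b dvd (int n + s) - (int r0 + s)"
        using b0 by (metis dvd_diff dvd_diffD diff_add_cancel dvd_add)
      also have "\<dots> \<longleftrightarrow> [int n = int r0] (mod int b)" by (simp add: cong_iff_dvd_diff)
      finally show ?thesis by (simp add: cong_int_iff)
    qed
    moreover have "[n = r0] (mod a) \<and> [n = r0] (mod b) \<longleftrightarrow> [n = r0] (mod (a * b))"
      using assms(3) coprime_cong_mult_nat cong_modulus_mult_nat by (metis mult.commute)
    ultimately show ?thesis by (simp add: cong_def r_def)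
  qed
  then show ?thesis using card_residue_class[OF r, of N] by simp
qed

lemma coprime_prod_primes:
  fixes A B :: "nat set"
  assumes "finite A" "finite B" "\<And>p. p \<in> A \<union> B \<Longrightarrow> prime p" "A \<inter> B = {}"
  shows "coprime (\<Prod>A) (\<Prod>B)"
proof (intro prod_coprime_left prod_coprime_right)
  fix p q assume "p \<in> A" "q \<in> B"
  then show "coprime p q" using assms by (metis UnI1 UnI2 disjoint_iff primes_coprime)
qed

lemma prod_primes_dvd:
  fixes A :: "nat set"
  assumes "finite A" "\<And>p. p \<in> A \<Longrightarrow> prime p"
  shows "int (\<Prod>A) dvd k \<longleftrightarrow> (\<forall>p\<in>A. int p dvd k)"
  using assms
proof (induction A rule: finite_induct)
  case (insert p A)
  have cop: "coprime (int p) (int (\<Prod>A))"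
    using coprime_prod_primes[of "{p}" A] insert by (simp del: of_nat_prod)
  have "int (\<Prod>(insert p A)) dvd k \<longleftrightarrow> int p * int (\<Prod>A) dvd k" using insert by simp
  also have "\<dots> \<longleftrightarrow> int p dvd k \<and> int (\<Prod>A) dvd k"
    using cop by (meson divides_mult dvd_mult_left dvd_mult_right)
  finally show ?case using insert by simp
qed auto

text \<open>Each n determines the set B of those p at which the second alternative holds. The
  classes for different B are disjoint because the alternatives exclude each other.\<close>

lemma card_choice:
  fixes U V :: "'b \<Rightarrow> 'a \<Rightarrow> bool"
  assumes "finite A" "finite S" "\<And>p n. p \<in> S \<inter> P \<Longrightarrow> U p n \<Longrightarrow> V p n \<Longrightarrow> False"
  shows "card {n \<in> A. \<forall>p\<in>S. U p n \<or> p \<in> P \<and> V p n} = (\<Sum>B\<in>Pow (S \<inter> P). card {n \<in> A. (\<forall>p\<in>S - B. U p n) \<and> (\<forall>p\<in>B. V p n)})"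
proof -
  define K where "K = (\<lambda>B. {n \<in> A. (\<forall>p\<in>S - B. U p n) \<and> (\<forall>p\<in>B. V p n)})"
  have "{n \<in> A. \<forall>p\<in>S. U p n \<or> p \<in> P \<and> V p n} = (\<Union>B\<in>Pow (S \<inter> P). K B)"
  proof (rule Set.set_eqI, rule iffI)
    fix n assume n: "n \<in> {n \<in> A. \<forall>p\<in>S. U p n \<or> p \<in> P \<and> V p n}"
    then have nA: "n \<in> A" and nS: "\<And>p. p \<in> S \<Longrightarrow> U p n \<or> p \<in> P \<and> V p n" by simp_all
    define B where "B = {p \<in> S \<inter> P. V p n}"
    have "U p n" if "p \<in> S - B" for p using nS[of p] that by (simp add: B_def) argo
    moreover have "V p n" if "p \<in> B" for p using that by (simp add: B_def)
    ultimately have "n \<in> K B" using nA by (simp add: K_def)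
    moreover have "B \<in> Pow (S \<inter> P)" by (auto simp: B_def)
    ultimately show "n \<in> (\<Union>B\<in>Pow (S \<inter> P). K B)" by (rule UN_I[rotated])
  next
    fix n assume "n \<in> (\<Union>B\<in>Pow (S \<inter> P). K B)"
    then obtain B where B: "B \<subseteq> S \<inter> P" "n \<in> K B" by blast
    have "U p n \<or> p \<in> P \<and> V p n" if "p \<in> S" for p using that B unfolding K_def by (cases "p \<in> B") blast+
    then show "n \<in> {n \<in> A. \<forall>p\<in>S. U p n \<or> p \<in> P \<and> V p n}" using B unfolding K_def by blast
  qed
  also have "card \<dots> = (\<Sum>B\<in>Pow (S \<inter> P). card (K B))"
  proof (rule card_UN_disjoint)
    have aux: "B \<subseteq> C" if "n \<in> K B" "n \<in> K C" "B \<in> Pow (S \<inter> P)" "C \<in> Pow (S \<inter> P)" for n B C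
    proof
      fix p assume p: "p \<in> B"
      then have "p \<in> S \<inter> P" "V p n" using that unfolding K_def by blast+
      moreover have "U p n" if "p \<notin> C" using that \<open>p \<in> S \<inter> P\<close> \<open>n \<in> K C\<close> unfolding K_def by blast
      ultimately show "p \<in> C" using assms(3) by blast
    qed
    show "\<forall>B\<in>Pow (S \<inter> P). \<forall>C\<in>Pow (S \<inter> P). B \<noteq> C \<longrightarrow> K B \<inter> K C = {}"
      using aux by blast
  qed (use assms in \<open>auto simp: K_def\<close>)
  finally show ?thesis by (simp add: K_def)
qed

text \<open>Choosing one of the two classes at each prime of S in P splits the count into 2^(card (S
  Int P)) residue classes modulo the product of S, each with error at most 1. The classes 0 and -s
  modulo p differ since p does not divide s.\<close>

lemma card_bad:
  fixes S P :: "nat set" and s :: int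
  assumes fin: "finite S" and pr: "\<And>p. p \<in> S \<Longrightarrow> prime p" and Ps: "\<And>p. p \<in> P \<Longrightarrow> \<not> int p dvd s"
  shows "\<bar>real (card {n \<in> {1..N}. \<forall>p\<in>S. p dvd n \<or> p \<in> P \<and> int p dvd int n + s})
     - real N * (\<Prod>p\<in>S. (if p \<in> P then 2 else 1) / real p)\<bar> \<le> (\<Prod>p\<in>S. if p \<in> P then 2 else 1)"
proof -
  define K where "K = (\<lambda>B. {n \<in> {1..N}. \<Prod>(S - B) dvd n \<and> int (\<Prod>B) dvd int n + s})"
  have finB: "finite B" "finite (S - B)" if "B \<in> Pow (S \<inter> P)" for B using that fin finite_subset by auto
  have K: "K B = {n \<in> {1..N}. (\<forall>p\<in>S - B. p dvd n) \<and> (\<forall>p\<in>B. int p dvd int n + s)}" if B: "B \<in> Pow (S \<inter> P)" for B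
  proof -
    have "\<Prod>(S - B) dvd n \<longleftrightarrow> (\<forall>p\<in>S - B. p dvd n)" for n
      using prod_primes_dvd[OF finB(2)[OF B], of "int n"] pr by (simp del: of_nat_prod)
    moreover have "int (\<Prod>B) dvd k \<longleftrightarrow> (\<forall>p\<in>B. int p dvd k)" for k
      using B pr by (intro prod_primes_dvd finB) auto
    ultimately show ?thesis by (simp add: K_def)
  qed
  have "card {n \<in> {1..N}. \<forall>p\<in>S. p dvd n \<or> p \<in> P \<and> int p dvd int n + s}
      = (\<Sum>B\<in>Pow (S \<inter> P). card {n \<in> {1..N}. (\<forall>p\<in>S - B. p dvd n) \<and> (\<forall>p\<in>B. int p dvd int n + s)})"
  proof (rule card_choice[OF _ fin])
    fix p n assume p: "p \<in> S \<inter> P" and d: "p dvd n" "int p dvd int n + s"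
    have "int p dvd s" using d by (metis dvd_add_right_iff int_dvd_int_iff)
    then show False using Ps[of p] p by blast
  qed simp
  also have "\<dots> = (\<Sum>B\<in>Pow (S \<inter> P). card (K B))" by (intro sum.cong refl arg_cong[of _ _ card] K[symmetric])
  finally have c0: "card {n \<in> {1..N}. \<forall>p\<in>S. p dvd n \<or> p \<in> P \<and> int p dvd int n + s} = (\<Sum>B\<in>Pow (S \<inter> P). card (K B))" .
  have c1: "real (card {n \<in> {1..N}. \<forall>p\<in>S. p dvd n \<or> p \<in> P \<and> int p dvd int n + s}) = (\<Sum>B\<in>Pow (S \<inter> P). real (card (K B)))"
    unfolding c0 by simp
  have two: "(\<Prod>p\<in>S. if p \<in> P then 2 else 1::real) = 2 ^ card (S \<inter> P)"
    using fin by (simp add: prod.If_cases Int_def)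
  have "real N * (\<Prod>p\<in>S. (if p \<in> P then 2 else 1) / real p) = 2 ^ card (S \<inter> P) * (real N / real (\<Prod>S))"
    unfolding prod_dividef two by simp
  also have "\<dots> = (\<Sum>B\<in>Pow (S \<inter> P). real N / real (\<Prod>S))" using fin by (simp add: card_Pow del: Pow_Int_eq)
  finally have c2: "real N * (\<Prod>p\<in>S. (if p \<in> P then 2 else 1) / real p) = (\<Sum>B\<in>Pow (S \<inter> P). real N / real (\<Prod>S))" .
  have "\<bar>(\<Sum>B\<in>Pow (S \<inter> P). real (card (K B))) - (\<Sum>B\<in>Pow (S \<inter> P). real N / real (\<Prod>S))\<bar>
      \<le> (\<Sum>B\<in>Pow (S \<inter> P). \<bar>real (card (K B)) - real N / real (\<Prod>S)\<bar>)"
    unfolding sum_subtractf[symmetric] by (rule sum_abs)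
  also have "\<dots> \<le> (\<Sum>B\<in>Pow (S \<inter> P). 1)"
  proof (rule sum_mono)
    fix B assume B: "B \<in> Pow (S \<inter> P)"
    have "\<Prod>S = \<Prod>(S - B) * \<Prod>B" using B fin by (intro prod.subset_diff) auto
    then have "real (\<Prod>S) = real (\<Prod>(S - B)) * real (\<Prod>B)" by (simp del: of_nat_prod)
    moreover have "\<bar>real (card (K B)) - real N / (real (\<Prod>(S - B)) * real (\<Prod>B))\<bar> \<le> 1"
      unfolding K_def
    proof (rule card_two_congruences)
      show "\<Prod>(S - B) > 0" "\<Prod>B > 0" using B pr prime_gt_0_nat by (auto intro!: prod_pos)
      show "coprime (\<Prod>(S - B)) (\<Prod>B)" using B pr finB by (intro coprime_prod_primes) auto
    qed
    ultimately show "\<bar>real (card (K B)) - real N / real (\<Prod>S)\<bar> \<le> 1" by simp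
  qed
  also have "\<dots> = 2 ^ card (S \<inter> P)" using fin by (simp add: card_Pow del: Pow_Int_eq)
  finally show ?thesis unfolding c1 c2 two .
qed

section \<open>Mertens' product\<close>


text \<open>Removing the multiples of p from such a sum takes away at most the fraction 1/p: a
  removed b is p k with k again in the set. Truncation at M only helps, since k ranges below M /
  p.\<close>

lemma sieve_harmonic:
  fixes Q :: "nat set"
  assumes "finite Q" "\<And>p. p \<in> Q \<Longrightarrow> prime p"
  shows "(\<Prod>p\<in>Q. 1 - 1 / real p) * (\<Sum>c=1..M. 1 / real c) \<le> (\<Sum>b | b \<in> {1..M} \<and> (\<forall>p\<in>Q. \<not> p dvd b). 1 / real b)"
  using assms
proof (induction Q rule: finite_induct)
  case (insert p Q)
  define S where "S = (\<Sum>b | b \<in> {1..M} \<and> (\<forall>p\<in>Q. \<not> p dvd b). 1 / real b)"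
  have p: "prime p" "p \<ge> 2" using insert prime_ge_2_nat by auto
  have "S = (\<Sum>b | b \<in> {1..M} \<and> (\<forall>p\<in>insert p Q. \<not> p dvd b). 1 / real b)
      + (\<Sum>b | b \<in> {1..M} \<and> (\<forall>p\<in>Q. \<not> p dvd b) \<and> p dvd b. 1 / real b)"
    unfolding S_def by (subst sum.union_disjoint[symmetric]) (auto intro!: sum.cong)
  also have "(\<Sum>b | b \<in> {1..M} \<and> (\<forall>p\<in>Q. \<not> p dvd b) \<and> p dvd b. 1 / real b) \<le> (\<Sum>b\<in>(*) p ` {b \<in> {1..M}. \<forall>p\<in>Q. \<not> p dvd b}. 1 / real b)"
  proof (rule sum_mono2)
    show "{b \<in> {1..M}. (\<forall>p\<in>Q. \<not> p dvd b) \<and> p dvd b} \<subseteq> (*) p ` {b \<in> {1..M}. \<forall>p\<in>Q. \<not> p dvd b}"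
    proof
      fix b assume b: "b \<in> {b \<in> {1..M}. (\<forall>p\<in>Q. \<not> p dvd b) \<and> p dvd b}"
      then obtain k where k: "b = p * k" by auto
      have "k \<le> p * k" using p by simp
      moreover have "p * k \<le> M" "p * k \<ge> 1" using b k by auto
      ultimately have "k \<le> M" "k \<ge> 1" by (linarith, cases k) auto
      then have "k \<in> {b \<in> {1..M}. \<forall>p\<in>Q. \<not> p dvd b}" using b k by auto
      then show "b \<in> (*) p ` {b \<in> {1..M}. \<forall>p\<in>Q. \<not> p dvd b}" using k by blast
    qed
  qed auto
  also have "(\<Sum>b\<in>(*) p ` {b \<in> {1..M}. \<forall>p\<in>Q. \<not> p dvd b}. 1 / real b) = 1 / real p * S"
    using p by (subst sum.reindex) (auto simp: inj_on_def S_def sum_distrib_left)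
  finally have "S * (1 - 1 / real p) \<le> (\<Sum>b | b \<in> {1..M} \<and> (\<forall>p\<in>insert p Q. \<not> p dvd b). 1 / real b)"
    by (simp add: algebra_simps)
  moreover have "(\<Prod>p\<in>Q. 1 - 1 / real p) * (\<Sum>c=1..M. 1 / real c) \<le> S"
    using insert unfolding S_def by simp
  then have "(\<Prod>p\<in>Q. 1 - 1 / real p) * (\<Sum>c=1..M. 1 / real c) * (1 - 1 / real p) \<le> S * (1 - 1 / real p)"
    using p by (intro mult_right_mono) auto
  ultimately show ?case using insert by (simp add: mult_ac)
next
  case empty
  have "{b \<in> {1..M}. \<forall>p\<in>{}. \<not> p dvd b} = {1..M}" by auto
  then show ?case by simp
qed

text \<open>The same removal for the full series is exact and yields a finite Euler product. What
  remains contains the term n = 1, and is therefore at least 1.\<close>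

lemma sieve_zeta:
  fixes Q :: "nat set" and \<sigma> :: real
  assumes s: "\<sigma> > 1" and "finite Q" "\<And>p. p \<in> Q \<Longrightarrow> prime p"
  shows "1 \<le> (\<Sum>n. real n powr (-\<sigma>)) * (\<Prod>p\<in>Q. 1 - real p powr (-\<sigma>))"
proof -
  define u where "u = (\<lambda>Q n. if \<forall>p\<in>Q. \<not> p dvd n then real n powr (-\<sigma>) else 0)"
  have sm: "summable (\<lambda>n. real n powr (-\<sigma>))" using s by (simp add: summable_real_powr_iff)
  have smu: "summable (u Q)" for Q
    by (rule summable_comparison_test[OF _ sm]) (auto simp: u_def)
  have "suminf (u Q) \<le> (\<Sum>n. real n powr (-\<sigma>)) * (\<Prod>p\<in>Q. 1 - real p powr (-\<sigma>))"
    using assms(2,3)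
  proof (induction Q rule: finite_induct)
    case (insert p Q)
    have p: "prime p" "p \<ge> 2" using insert prime_ge_2_nat by auto
    define f where "f = (\<lambda>n. if p dvd n then u Q n else 0)"
    have smf: "summable f"
      by (rule summable_comparison_test[OF _ sm]) (auto simp: u_def f_def)
    have "suminf (\<lambda>n. f (p * n)) = suminf f"
      using p by (intro suminf_mono_reindex) (auto simp: strict_mono_def f_def elim!: dvdE)
    moreover have "suminf (\<lambda>n. f (p * n)) = real p powr (-\<sigma>) * suminf (u Q)"
    proof -
      have "f (p * n) = real p powr (-\<sigma>) * u Q n" for n
      proof -
        have "q dvd p * n \<longleftrightarrow> q dvd n" if "q \<in> Q" for q
          using that insert p by (metis insertI1 insertI2 prime_dvd_mult_nat primes_dvd_imp_eq dvd_mult)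
        then show ?thesis by (auto simp: f_def u_def powr_mult)
      qed
      then show ?thesis using suminf_mult[OF smu] by simp
    qed
    moreover have "suminf (u (insert p Q)) = suminf (u Q) - suminf f"
    proof -
      have "u (insert p Q) = (\<lambda>n. u Q n - f n)" by (auto simp: u_def f_def fun_eq_iff)
      then show ?thesis using suminf_diff[OF smu smf] by simp
    qed
    ultimately have "suminf (u (insert p Q)) = suminf (u Q) * (1 - real p powr (-\<sigma>))" by (simp add: algebra_simps)
    also have "\<dots> \<le> ((\<Sum>n. real n powr (-\<sigma>)) * (\<Prod>p\<in>Q. 1 - real p powr (-\<sigma>))) * (1 - real p powr (-\<sigma>))"
    proof (intro mult_right_mono)
      have "real p powr (-\<sigma>) \<le> 1" using p s powr_mono[of "-\<sigma>" 0 "real p"] by simp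
      then show "0 \<le> 1 - real p powr (-\<sigma>)" by simp
    qed (use insert in auto)
    finally show ?case using insert by (simp add: mult_ac)
  qed (simp add: u_def)
  moreover have "1 \<le> suminf (u Q)"
  proof -
    have "sum (u Q) {1} \<le> suminf (u Q)" by (rule sum_le_suminf[OF smu]) (auto simp: u_def)
    moreover have "u Q 1 = 1" using assms(3)[of "Suc 0"] by (auto simp: u_def)
    ultimately show ?thesis by simp
  qed
  ultimately show ?thesis by linarith
qed

text \<open>Chebyshev's argument: summing ln m = sum of Lambda(d) over d dividing m up to N counts
  each d with weight floor(N / d), which is at least N / (2 d) for d <= N.\<close>

lemma sum_mangoldt_over_n: "N \<ge> 1 \<Longrightarrow> (\<Sum>n=1..N. mangoldt n / real n) \<le> 2 * ln (real N)"
proof -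
  assume N: "N \<ge> 1"
  have "(\<Sum>n=1..N. mangoldt n * (real N / (2 * real n))) \<le> (\<Sum>d=1..N. mangoldt d * real (card {m \<in> {1..N}. d dvd m}))"
  proof (intro sum_mono mult_left_mono mangoldt_nonneg)
    fix d assume d: "d \<in> {1..N}"
    have "{m \<in> {1..N}. d dvd m} = (*) d ` {1..N div d}"
      using d by (auto simp: less_eq_div_iff_mult_less_eq mult.commute elim!: dvdE intro!: Suc_leI Nat.gr0I)
    then have "card {m \<in> {1..N}. d dvd m} = N div d"
      using d by (simp add: card_image inj_on_def)
    moreover have "N \<le> 2 * (d * (N div d))"
    proof -
      have "N = d * (N div d) + N mod d" by simp
      moreover have "N mod d < d" using d by simp
      moreover have "d * 1 \<le> d * (N div d)" using d by (intro mult_left_mono) (auto simp: Suc_le_eq div_greater_zero_iff)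
      ultimately show ?thesis by linarith
    qed
    then have "real N \<le> 2 * (real d * real (N div d))" by (metis of_nat_le_iff of_nat_mult of_nat_numeral)
    then have "real N / (2 * real d) \<le> real (N div d)" using d by (simp add: field_simps)
    ultimately show "real N / (2 * real d) \<le> real (card {m \<in> {1..N}. d dvd m})" by simp
  qed
  also have "\<dots> = (\<Sum>d=1..N. \<Sum>m=1..N. if d dvd m then mangoldt d else 0)"
    by (simp add: sum.inter_filter[symmetric] mult.commute)
  also have "\<dots> = (\<Sum>m=1..N. \<Sum>d=1..N. if d dvd m then mangoldt d else 0)" by (rule sum.swap)
  also have "\<dots> = (\<Sum>m=1..N. ln (real m))"
  proof (rule sum.cong[OF refl])
    fix m assume m: "m \<in> {1..N}"
    have "(\<Sum>d=1..N. if d dvd m then mangoldt d else 0) = (\<Sum>d | d \<in> {1..N} \<and> d dvd m. mangoldt d :: real)"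
      by (rule sum.inter_filter[symmetric]) simp
    also have "{d. d \<in> {1..N} \<and> d dvd m} = {d. d dvd m}"
      using m by (auto dest: dvd_imp_le intro!: Suc_leI Nat.gr0I)
    finally show "(\<Sum>d=1..N. if d dvd m then mangoldt d else 0) = ln (real m)" using mangoldt_sum[of m, where 'a = real] m by simp
  qed
  also have "\<dots> \<le> (\<Sum>m=1..N. ln (real N))" by (intro sum_mono) auto
  finally have "real N / 2 * (\<Sum>n=1..N. mangoldt n / real n) \<le> real N * ln (real N)"
    by (simp add: sum_distrib_left mult_ac)
  then show ?thesis using N by (simp add: field_simps)
qed

lemma prod_antimono:
  fixes f :: "'a \<Rightarrow> real"
  assumes "finite B" "A \<subseteq> B" "\<And>x. x \<in> B \<Longrightarrow> 0 \<le> f x" "\<And>x. x \<in> B \<Longrightarrow> f x \<le> 1"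
  shows "prod f B \<le> prod f A"
proof -
  have "prod f B = prod f (B - A) * prod f A" using assms(1,2) by (intro prod.subset_diff) auto
  also have "\<dots> \<le> 1 * prod f A"
    using assms by (intro mult_right_mono prod_le_1 prod_nonneg) auto
  finally show ?thesis by simp
qed

text \<open>At sigma = 1 + 1 / ln Y, \<open>sieve_zeta\<close> and the pole bound show that the
  product of 1 - p^-sigma is at least 1 / (C ln Y). Replacing p^-sigma by 1/p costs the exponential
  of (2 / ln Y) times the sum of ln p / p, hence at most e^4.\<close>

lemma mertens_product:
  obtains c :: real where "c > 0" "\<And>y. y \<ge> 2 \<Longrightarrow> c / ln y \<le> (\<Prod>p | prime p \<and> real p \<le> y. 1 - 1 / real p)"
proof -
  obtain C where C: "C \<ge> 1" "\<And>\<sigma>. 1 < \<sigma> \<Longrightarrow> \<sigma> \<le> 2 \<Longrightarrow> norm (zeta (Complex \<sigma> 0)) \<le> C / (\<sigma> - 1)"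
    using zeta_real_le by blast
  have main: "exp (-4) / C / ln (real Y) \<le> (\<Prod>p | prime p \<and> p \<le> Y. 1 - 1 / real p)" if Y: "Y \<ge> 3" for Y :: nat
  proof -
    define Q where "Q = {p. prime p \<and> p \<le> Y}"
    have finQ: "finite Q" by (rule finite_subset[of _ "{..Y}"]) (auto simp: Q_def)
    define l where "l = ln (real Y)"
    have l: "l \<ge> 1" unfolding l_def using Y ln_ge_iff[of "real Y" 1] exp_le by (simp add: order.trans)
    define \<sigma> where "\<sigma> = 1 + 1 / l"
    have s: "1 < \<sigma>" "\<sigma> \<le> 2" using l by (auto simp: \<sigma>_def)
    have z: "(\<Sum>n. real n powr (-\<sigma>)) \<le> C * l"
    proof -
      have sm: "summable (\<lambda>n. real n powr (-\<sigma>))" using s by (simp add: summable_real_powr_iff)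
      have "zeta (Complex \<sigma> 0) = (\<Sum>n. of_real (real n powr (-\<sigma>)))"
        using s by (simp add: zeta_eq dser_def powr_of_real[symmetric] complex_eq_iff[of "Complex \<sigma> 0" "of_real \<sigma>"]
           Complex_eq flip: of_real_minus)
      also have "\<dots> = of_real (\<Sum>n. real n powr (-\<sigma>))" by (rule suminf_of_real[OF sm, symmetric])
      finally have "norm (zeta (Complex \<sigma> 0)) = \<bar>\<Sum>n. real n powr (-\<sigma>)\<bar>" by (simp only: norm_of_real)
      then show ?thesis using C(2)[OF s] l by (simp add: \<sigma>_def)
    qed
    have pge: "p \<ge> 2" if "p \<in> Q" for p using that prime_ge_2_nat by (auto simp: Q_def)
    have nn: "0 \<le> 1 - real p powr (-\<sigma>)" if "p \<in> Q" for p
      using pge[OF that] s powr_mono[of "-\<sigma>" 0 "real p"] by simp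
    \<comment> \<open>From e^-v >= 1 - v with v = ln p / l, the exponent changes p^-1 by at most v /
      p; the factor 2 makes up for 1 - 1/p >= 1/2.\<close>
    have factor_le: "1 - real p powr (-\<sigma>) \<le> (1 - 1 / real p) * exp (2 / l * (ln (real p) / real p))" if p: "p \<in> Q" for p
    proof -
      have p2: "real p \<ge> 2" using pge[OF p] by simp
      define v where "v = ln (real p) / l"
      have "1 - v \<le> exp (- v)" using exp_ge_add_one_self[of "- v"] by simp
      then have "1 / real p * (1 - v) \<le> 1 / real p * exp (-v)" using p2 by (intro mult_left_mono) auto
      also have "1 / real p * exp (-v) = real p powr (-\<sigma>)"
        using p2 by (simp add: powr_def \<sigma>_def v_def ring_distribs exp_add exp_minus divide_inverse exp_diff)
      finally have "1 - real p powr (-\<sigma>) \<le> (1 - 1 / real p) + v / real p" by (simp add: right_diff_distrib diff_divide_distrib)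
      also have "v / real p \<le> (1 - 1 / real p) * (2 / l * (ln (real p) / real p))"
      proof -
        have "1 / 2 \<le> 1 - 1 / real p" using p2 by (simp add: field_simps)
        then have "1 / 2 * (2 * (v / real p)) \<le> (1 - 1 / real p) * (2 * (v / real p))"
          using p2 l by (intro mult_right_mono) (auto simp: v_def)
        then show ?thesis by (simp add: v_def)
      qed
      also have "(1 - 1 / real p) + (1 - 1 / real p) * (2 / l * (ln (real p) / real p)) = (1 - 1 / real p) * (1 + 2 / l * (ln (real p) / real p))"
        by (simp add: algebra_simps)
      also have "\<dots> \<le> (1 - 1 / real p) * exp (2 / l * (ln (real p) / real p))"
        using p2 by (intro mult_left_mono exp_ge_add_one_self) auto
      finally show ?thesis by simp
    qed
    have P0: "0 \<le> (\<Prod>p\<in>Q. 1 - 1 / real p)" using pge by (intro prod_nonneg) (force simp: field_simps)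
    have "1 \<le> (\<Sum>n. real n powr (-\<sigma>)) * (\<Prod>p\<in>Q. 1 - real p powr (-\<sigma>))"
      using s finQ by (intro sieve_zeta) (auto simp: Q_def)
    also have "\<dots> \<le> (C * l) * (\<Prod>p\<in>Q. (1 - 1 / real p) * exp (2 / l * (ln (real p) / real p)))"
      using C l z factor_le nn by (intro mult_mono prod_mono prod_nonneg) auto
    also have "\<dots> = C * l * ((\<Prod>p\<in>Q. 1 - 1 / real p) * exp (2 / l * (\<Sum>p\<in>Q. ln (real p) / real p)))"
      using finQ by (simp add: prod.distrib exp_sum sum_distrib_left)
    also have "\<dots> \<le> C * l * ((\<Prod>p\<in>Q. 1 - 1 / real p) * exp 4)"
    proof -
      have "(\<Sum>p\<in>Q. ln (real p) / real p) = (\<Sum>p\<in>Q. mangoldt p / real p)" by (intro sum.cong) (auto simp: Q_def)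
      also have "\<dots> \<le> (\<Sum>n=1..Y. mangoldt n / real n)"
        by (intro sum_mono2) (auto simp: Q_def mangoldt_nonneg Suc_le_eq prime_gt_0_nat)
      also have "\<dots> \<le> 2 * l" unfolding l_def using Y by (intro sum_mangoldt_over_n) auto
      finally have "2 / l * (\<Sum>p\<in>Q. ln (real p) / real p) \<le> 2 / l * (2 * l)" using l by (intro mult_left_mono) auto
      then have "2 / l * (\<Sum>p\<in>Q. ln (real p) / real p) \<le> 4" using l by simp
      then show ?thesis using C l P0 by (intro mult_left_mono) auto
    qed
    finally have "exp (-4) / C / l \<le> (\<Prod>p\<in>Q. 1 - 1 / real p)"
      using C l by (simp add: exp_minus field_simps)
    then show ?thesis by (simp add: Q_def l_def)
  qed
  show ?thesis
  proof (rule that[of "exp (-4) / C / 2"])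
    fix y :: real assume y: "y \<ge> 2"
    \<comment> \<open>The estimate above needs Y >= 3. As Y <= y^2 for y >= 2, its logarithm is at
      most 2 ln y, which costs a factor 2.\<close>
    define Y where "Y = max 3 (nat \<lfloor>y\<rfloor>)"
    have finY: "finite {p. prime p \<and> p \<le> Y}" by (rule finite_subset[of _ "{..Y}"]) auto
    have "ln (real Y) \<le> 2 * ln y"
    proof -
      have "real Y \<le> y ^ 2"
      proof -
        have "2 * 2 \<le> y * y" using y by (intro mult_mono) auto
        moreover have "y * 1 \<le> y * y" using y by (intro mult_left_mono) auto
        moreover have "real (nat \<lfloor>y\<rfloor>) \<le> y" using y by (intro of_nat_floor) auto
        ultimately show ?thesis by (auto simp: Y_def power2_eq_square)
      qed
      then have "ln (real Y) \<le> ln (y ^ 2)" using y by (subst ln_le_cancel_iff) (auto simp: Y_def)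
      then show ?thesis using y by (simp add: ln_realpow)
    qed
    then have "exp (-4) / C / (2 * ln y) \<le> exp (-4) / C / ln (real Y)"
      using y C by (intro divide_left_mono) (auto simp: Y_def)
    also have "\<dots> \<le> (\<Prod>p | prime p \<and> p \<le> Y. 1 - 1 / real p)" by (rule main) (simp add: Y_def)
    also have "\<dots> \<le> (\<Prod>p | prime p \<and> real p \<le> y. 1 - 1 / real p)"
    proof (rule prod_antimono[OF finY])
      show "{p. prime p \<and> real p \<le> y} \<subseteq> {p. prime p \<and> p \<le> Y}"
        by (auto simp: Y_def le_max_iff_disj le_nat_floor)
      fix p assume "p \<in> {p. prime p \<and> p \<le> Y}"
      then have "real p \<ge> 2" using prime_ge_2_nat[of p] by simp
      then show "0 \<le> 1 - 1 / real p" "1 - 1 / real p \<le> 1" by (auto simp: field_simps)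
    qed
    finally show "exp (-4) / C / 2 / ln y \<le> (\<Prod>p | prime p \<and> real p \<le> y. 1 - 1 / real p)" by simp
  qed (use C in auto)
qed

section \<open>The sieve sum\<close>


text \<open>
  A pair \<open>(a, b)\<close> stands for a factorisation \<open>n = a * b\<close> where \<open>b\<close> is composed of the primes in \<open>P\<close>, from which
  two residue classes are removed: the sum over pairs factors, unlike the sum over \<open>n\<close>.
\<close>

definition pair_set :: "nat set \<Rightarrow> nat set \<Rightarrow> real \<Rightarrow> (nat \<times> nat) set" where
  "pair_set T P x = {(a, b). a > 0 \<and> b > 0 \<and> (\<forall>p. prime p \<longrightarrow> p dvd a \<longrightarrow> p \<in> T)
     \<and> (\<forall>p. prime p \<longrightarrow> p dvd b \<longrightarrow> p \<in> T \<inter> P) \<and> real a * real b \<le> x}"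

definition pair_sum :: "nat set \<Rightarrow> nat set \<Rightarrow> real \<Rightarrow> real" where
  "pair_sum T P x = (\<Sum>(a, b)\<in>pair_set T P x. 1 / (real a * real b))"

text \<open>For \<open>h = f / (1 - f)\<close> this is the quantity G of the Selberg sieve with
  level x.\<close>

definition subset_sum :: "nat set \<Rightarrow> (nat \<Rightarrow> real) \<Rightarrow> real \<Rightarrow> real" where
  "subset_sum T h x = (\<Sum>S | S \<subseteq> T \<and> real (\<Prod>S) \<le> x. prod h S)"

lemma finite_pair_set: "finite (pair_set T P x)"
proof (rule finite_subset)
  show "pair_set T P x \<subseteq> {..nat \<lfloor>x\<rfloor>} \<times> {..nat \<lfloor>x\<rfloor>}"
  proof
    fix ab assume ab: "ab \<in> pair_set T P x"
    obtain a b where [simp]: "ab = (a, b)" by force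
    have h: "a > 0" "b > 0" "real a * real b \<le> x" using ab by (auto simp: pair_set_def)
    have "real a * 1 \<le> real a * real b" "1 * real b \<le> real a * real b"
      using h by (auto intro!: mult_mono)
    then have "real a \<le> x" "real b \<le> x" using h(3) by linarith+
    then show "ab \<in> {..nat \<lfloor>x\<rfloor>} \<times> {..nat \<lfloor>x\<rfloor>}" using h by (auto intro!: le_nat_floor)
  qed
qed auto

lemma pair_sum_nonneg: "pair_sum T P x \<ge> 0"
  unfolding pair_sum_def by (intro sum_nonneg) auto

lemma pair_sum_mono: "x \<le> y \<Longrightarrow> pair_sum T P x \<le> pair_sum T P y"
  unfolding pair_sum_def by (intro sum_mono2 finite_pair_set) (auto simp: pair_set_def)

lemma pair_sum_less_1: "x < 1 \<Longrightarrow> pair_sum T P x = 0"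
proof -
  assume x: "x < 1"
  have "pair_set T P x = {}"
  proof -
    have "\<not> real a * real b \<le> x" if "a > 0" "b > 0" for a b :: nat
    proof -
      have "1 * 1 \<le> real a * real b" using that by (intro mult_mono) auto
      then show ?thesis using x by linarith
    qed
    then show ?thesis by (auto simp: pair_set_def)
  qed
  then show ?thesis by (simp add: pair_sum_def)
qed

lemma sum_union_le:
  fixes f :: "'a \<Rightarrow> real"
  assumes "finite A" "finite B" "\<And>x. f x \<ge> 0"
  shows "sum f (A \<union> B) \<le> sum f A + sum f B"
proof -
  have "sum f (A \<union> B) + sum f (A \<inter> B) = sum f A + sum f B" using assms by (intro sum.union_inter)
  moreover have "sum f (A \<inter> B) \<ge> 0" using assms by (intro sum_nonneg)
  ultimately show ?thesis by linarith
qed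

text \<open>A pair involving p arises from a smaller one by multiplying a, or b if p is in P, by p:
  one or two ways, each with factor 1/p. It is an inequality because a pair with p in both
  components is counted twice.\<close>

lemma pair_sum_insert:
  assumes p: "prime p"
  shows "pair_sum (insert p T) P x \<le> pair_sum T P x + (if p \<in> P then 2 else 1) / real p * pair_sum (insert p T) P (x / real p)"
proof -
  have p0: "p > 0" using p prime_gt_0_nat by blast
  define A where "A = pair_set (insert p T) P (x / real p)"
  define f where "f = (\<lambda>(a, b). 1 / (real a * real b))"
  define B1 where "B1 = (\<lambda>(a, b). (p * a, b)) ` A"
  define B2 where "B2 = (if p \<in> P then (\<lambda>(a, b). (a, p * b)) ` A else {})"
  have finA: "finite A" unfolding A_def by (rule finite_pair_set)
  have sub: "pair_set (insert p T) P x \<subseteq> pair_set T P x \<union> (B1 \<union> B2)"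
  proof
    fix ab assume ab: "ab \<in> pair_set (insert p T) P x"
    obtain a b where abe: "ab = (a, b)" by force
    have pos: "a > 0" "b > 0" and qa: "\<And>q. prime q \<Longrightarrow> q dvd a \<Longrightarrow> q \<in> insert p T"
      and qb: "\<And>q. prime q \<Longrightarrow> q dvd b \<Longrightarrow> q \<in> insert p T \<inter> P" and le: "real a * real b \<le> x"
      using ab unfolding abe pair_set_def by blast+
    consider "p dvd a" | "p dvd b" | "\<not> p dvd a" "\<not> p dvd b" by blast
    then show "ab \<in> pair_set T P x \<union> (B1 \<union> B2)"
    proof cases
      case 1
      then obtain k where k: "a = p * k" by auto
      have "k > 0" using pos k by auto
      moreover have "real k * real b \<le> x / real p" using le p0 by (simp add: k field_simps)
      moreover have "q \<in> insert p T" if "prime q" "q dvd k" for q using that qa[of q] k by simp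
      ultimately have "(k, b) \<in> A" unfolding A_def pair_set_def using pos qb by blast
      then have "ab \<in> B1" unfolding B1_def abe k by force
      then show ?thesis by blast
    next
      case 2
      then obtain k where k: "b = p * k" by auto
      have "k > 0" using pos k by auto
      moreover have "real a * real k \<le> x / real p" using le p0 by (simp add: k field_simps)
      moreover have "q \<in> insert p T \<inter> P" if "prime q" "q dvd k" for q using that qb[of q] k by simp
      ultimately have "(a, k) \<in> A" unfolding A_def pair_set_def using pos qa by blast
      moreover have "p \<in> P" using qb[OF p 2] by blast
      ultimately have "ab \<in> B2" unfolding B2_def abe k by force
      then show ?thesis by blast
    next
      case 3
      have "q \<in> T" if "prime q" "q dvd a" for q using qa[OF that] 3 that by blast
      moreover have "q \<in> T \<inter> P" if "prime q" "q dvd b" for q using qb[OF that] 3 that by blast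
      ultimately have "ab \<in> pair_set T P x" unfolding abe pair_set_def using pos le by blast
      then show ?thesis by blast
    qed
  qed
  have fin: "finite B1" "finite B2" using finA by (auto simp: B1_def B2_def)
  have f0: "f ab \<ge> 0" for ab by (auto simp: f_def split: prod.split)
  have sA: "sum f A = pair_sum (insert p T) P (x / real p)" by (simp add: A_def f_def pair_sum_def)
  have s1: "sum f B1 = 1 / real p * sum f A"
    unfolding B1_def using p0 by (subst sum.reindex) (auto simp: inj_on_def f_def sum_distrib_left intro!: sum.cong)
  have s2: "sum f B2 = (if p \<in> P then 1 else 0) / real p * sum f A"
  proof (cases "p \<in> P")
    case True
    then have "sum f B2 = sum f ((\<lambda>(a, b). (a, p * b)) ` A)" by (simp add: B2_def)
    also have "\<dots> = 1 / real p * sum f A"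
      using p0 by (subst sum.reindex) (auto simp: inj_on_def f_def sum_distrib_left intro!: sum.cong)
    finally show ?thesis using True by simp
  qed (simp add: B2_def)
  have "pair_sum (insert p T) P x = sum f (pair_set (insert p T) P x)" by (simp add: f_def pair_sum_def)
  also have "\<dots> \<le> sum f (pair_set T P x \<union> (B1 \<union> B2))"
    using fin finite_pair_set f0 sub by (intro sum_mono2) auto
  also have "\<dots> \<le> sum f (pair_set T P x) + (sum f B1 + sum f B2)"
    using sum_union_le[of "pair_set T P x" "B1 \<union> B2" f] sum_union_le[of B1 B2 f] fin finite_pair_set f0 by fastforce
  also have "sum f (pair_set T P x) = pair_sum T P x" by (simp add: f_def pair_sum_def)
  finally show ?thesis unfolding s1 s2 sA by (cases "p \<in> P") (auto simp: algebra_simps)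
qed

lemma subset_sum_insert:
  assumes "finite T" "p \<notin> T" "p > 0"
  shows "subset_sum (insert p T) h x = subset_sum T h x + h p * subset_sum T h (x / real p)"
proof -
  have fS: "finite S" if "S \<subseteq> T" for S using that assms(1) finite_subset by blast
  have eq: "{S. S \<subseteq> insert p T \<and> real (\<Prod>S) \<le> x} = {S. S \<subseteq> T \<and> real (\<Prod>S) \<le> x} \<union> insert p ` {S. S \<subseteq> T \<and> real (\<Prod>S) \<le> x / real p}"
    (is "?L = ?A \<union> ?B")
  proof (rule Set.set_eqI, rule iffI)
    fix S assume S: "S \<in> ?L"
    show "S \<in> ?A \<union> ?B"
    proof (cases "p \<in> S")
      case True
      then have e: "S = insert p (S - {p})" by auto
      have sub: "S - {p} \<subseteq> T" using S by auto
      have "finite S" using fS[OF sub] by simp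
      then have "\<Prod>S = p * \<Prod>(S - {p})" using True by (rule prod.remove)
      then have "real (\<Prod>S) = real p * real (\<Prod>(S - {p}))" by (simp only: of_nat_mult)
      then have "real (\<Prod>(S - {p})) \<le> x / real p" using S assms by (simp add: field_simps del: of_nat_prod)
      then show ?thesis using sub e by blast
    next
      case False
      then show ?thesis using S by auto
    qed
  next
    fix S assume "S \<in> ?A \<union> ?B"
    then show "S \<in> ?L"
    proof
      assume "S \<in> ?B"
      then obtain R where R: "S = insert p R" "R \<subseteq> T" "real (\<Prod>R) \<le> x / real p" by auto
      have "p \<notin> R" using R assms by auto
      then have "real (\<Prod>S) = real p * real (\<Prod>R)" using fS[OF R(2)] by (simp add: R(1) del: of_nat_prod)
      then have "real (\<Prod>S) \<le> x" using R(3) assms by (simp add: field_simps del: of_nat_prod)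
      then show ?thesis using R by auto
    qed auto
  qed
  have fin: "finite {S. S \<subseteq> T \<and> real (\<Prod>S) \<le> y}" for y
    using assms(1) by (intro finite_subset[of "{S. S \<subseteq> T \<and> real (\<Prod>S) \<le> y}" "Pow T"]) auto
  have "subset_sum (insert p T) h x = sum (prod h) {S. S \<subseteq> T \<and> real (\<Prod>S) \<le> x} + sum (prod h) (insert p ` {S. S \<subseteq> T \<and> real (\<Prod>S) \<le> x / real p})"
    unfolding subset_sum_def eq using assms fin by (intro sum.union_disjoint) auto
  also have "sum (prod h) (insert p ` {S. S \<subseteq> T \<and> real (\<Prod>S) \<le> x / real p}) = (\<Sum>S | S \<subseteq> T \<and> real (\<Prod>S) \<le> x / real p. prod h (insert p S))"
    using assms(2) by (subst sum.reindex) (auto simp: inj_on_def)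
  also have "\<dots> = (\<Sum>S | S \<subseteq> T \<and> real (\<Prod>S) \<le> x / real p. h p * prod h S)"
    using assms fS by (intro sum.cong) (auto intro!: prod.insert)
  finally show ?thesis by (simp add: subset_sum_def sum_distrib_left)
qed

text \<open>Since f / (1 - f) is the sum of the powers f^j with j >= 1, the squarefree sum has room
  for all higher powers of each prime. Prime by prime, \<open>pair_sum_insert\<close> is iterated:
  the arguments x / p^j with j >= 1 are replaced by x / p, and the geometric series gives the factor
  \<open>k\<close>.\<close>

lemma pair_sum_le_subset_sum:
  assumes "finite T" "\<And>p. p \<in> T \<Longrightarrow> prime p" "\<And>p. p \<in> T \<Longrightarrow> f p = (if p \<in> P then 2 else 1) / real p"
    "\<And>p. p \<in> T \<Longrightarrow> f p < 1"
  shows "pair_sum T P x \<le> subset_sum T (\<lambda>p. f p / (1 - f p)) x"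
  using assms
proof (induction T arbitrary: x rule: finite_induct)
  case empty
  have one: "n = 1" if "n > 0" "\<And>p. prime p \<Longrightarrow> \<not> p dvd n" for n :: nat
    using that prime_factor_nat[of n] by auto
  show ?case
  proof (cases "x < 1")
    case True
    then show ?thesis by (simp add: pair_sum_less_1 subset_sum_def)
  next
    case False
    have "pair_set {} P x \<subseteq> {(1, 1)}" using one by (auto simp: pair_set_def)
    then have "pair_sum {} P x \<le> (\<Sum>(a, b)\<in>{(1::nat, 1::nat)}. 1 / (real a * real b))"
      unfolding pair_sum_def by (intro sum_mono2) auto
    moreover have "{S::nat set. S \<subseteq> {} \<and> real (\<Prod>S) \<le> x} = {{}}" using False by auto
    ultimately show ?thesis by (simp add: subset_sum_def)
  qed
next
  case (insert p T)
  have p: "prime p" "p > 0" "p \<ge> 2" using insert prime_gt_0_nat prime_ge_2_nat by auto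
  define e where "e = f p"
  have e: "0 < e" "e < 1" using insert.prems(2)[of p] insert.prems(3)[of p] p by (auto simp: e_def)
  define k where "k = e / (1 - e)"
  have k: "k \<ge> 0" "e * (1 + k) = k" using e by (auto simp: k_def field_simps)
  have step: "pair_sum (insert p T) P y \<le> pair_sum T P y + e * pair_sum (insert p T) P (y / real p)" for y
    using pair_sum_insert[OF p(1), of T P y] insert.prems(2)[of p] by (simp add: e_def)
  \<comment> \<open>Dividing by p at least halves x, so the recursion ends after n steps, when x < 1
    and the sum is empty.\<close>
  have claim: "x < 2 ^ n \<Longrightarrow> pair_sum (insert p T) P x \<le> pair_sum T P x + k * pair_sum T P (x / real p)" for n x
  proof (induction n arbitrary: x)
    case 0
    then show ?case using k pair_sum_nonneg by (simp add: pair_sum_less_1)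
  next
    case (Suc n)
    show ?case
    proof (cases "x < 1")
      case True
      then show ?thesis using k pair_sum_nonneg by (simp add: pair_sum_less_1)
    next
      case False
      have "x / real p \<le> x / 2" using False p by (intro divide_left_mono) auto
      then have xp: "x / real p < 2 ^ n" using Suc.prems unfolding power_Suc by linarith
      have xpp: "x / real p / real p \<le> x / real p" using False p by (simp add: field_simps)
      have "pair_sum (insert p T) P x \<le> pair_sum T P x + e * pair_sum (insert p T) P (x / real p)" by (rule step)
      also have "\<dots> \<le> pair_sum T P x + e * (pair_sum T P (x / real p) + k * pair_sum T P (x / real p / real p))"
        using Suc.IH[OF xp] e by (intro add_left_mono mult_left_mono) auto
      also have "\<dots> \<le> pair_sum T P x + e * (pair_sum T P (x / real p) + k * pair_sum T P (x / real p))"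
        using e k pair_sum_mono[OF xpp] by (intro add_left_mono mult_left_mono) auto
      also have "\<dots> = pair_sum T P x + (e * (1 + k)) * pair_sum T P (x / real p)" by (simp add: algebra_simps)
      finally show ?thesis unfolding k(2) .
    qed
  qed
  obtain n where "x < 2 ^ n" using real_arch_pow[of 2 x] by auto
  from claim[OF this] have "pair_sum (insert p T) P x \<le> pair_sum T P x + k * pair_sum T P (x / real p)" .
  also have "\<dots> \<le> subset_sum T (\<lambda>p. f p / (1 - f p)) x + k * subset_sum T (\<lambda>p. f p / (1 - f p)) (x / real p)"
    using insert k by (intro add_mono mult_left_mono insert.IH) auto
  also have "\<dots> = subset_sum (insert p T) (\<lambda>p. f p / (1 - f p)) x"
    using insert p by (subst subset_sum_insert) (auto simp: k_def e_def)
  finally show ?case .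
qed

text \<open>A full rectangle of pairs fits below x, so the sum splits into a product. In the second
  factor b avoids Q, which forces its primes into P.\<close>

lemma pair_sum_ge:
  fixes Q :: "nat set"
  assumes Q: "finite Q" "\<And>p. p \<in> Q \<Longrightarrow> prime p"
    and T: "\<And>p. prime p \<Longrightarrow> p \<le> max K M \<Longrightarrow> p \<in> T" and P: "\<And>p. prime p \<Longrightarrow> p \<le> M \<Longrightarrow> p \<notin> Q \<Longrightarrow> p \<in> P"
    and le: "real K * real M \<le> x"
  shows "(\<Sum>a=1..K. 1 / real a) * ((\<Prod>p\<in>Q. 1 - 1 / real p) * (\<Sum>c=1..M. 1 / real c)) \<le> pair_sum T P x"
proof -
  define B where "B = {b \<in> {1..M}. \<forall>p\<in>Q. \<not> p dvd b}"
  have "(\<Sum>a=1..K. 1 / real a) * ((\<Prod>p\<in>Q. 1 - 1 / real p) * (\<Sum>c=1..M. 1 / real c)) \<le> (\<Sum>a=1..K. 1 / real a) * (\<Sum>b\<in>B. 1 / real b)"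
    unfolding B_def using Q by (intro mult_left_mono sieve_harmonic sum_nonneg) auto
  also have "\<dots> = (\<Sum>(a, b)\<in>{1..K} \<times> B. 1 / (real a * real b))"
    by (simp add: sum_product sum.cartesian_product)
  also have "\<dots> \<le> pair_sum T P x"
    unfolding pair_sum_def
  proof (rule sum_mono2[OF finite_pair_set])
    show "{1..K} \<times> B \<subseteq> pair_set T P x"
    proof
      fix ab assume ab: "ab \<in> {1..K} \<times> B"
      obtain a b where abe: "ab = (a, b)" by force
      have a: "a > 0" "a \<le> K" and b: "b > 0" "b \<le> M" "\<forall>p\<in>Q. \<not> p dvd b" using ab unfolding abe B_def by auto
      have "p \<in> T" if "prime p" "p dvd a" for p using T[OF that(1)] dvd_imp_le[OF that(2)] a by auto
      moreover have "p \<in> T \<inter> P" if "prime p" "p dvd b" for p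
        using T[OF that(1)] P[OF that(1)] dvd_imp_le[OF that(2)] b that by auto
      moreover have "real a * real b \<le> real K * real M" using a b by (intro mult_mono) auto
      ultimately show "ab \<in> pair_set T P x" unfolding abe pair_set_def using a b le by auto
    qed
  qed auto
  finally show ?thesis .
qed

section \<open>Primes whose shift has no divisor in an interval\<close>


lemma inj_on_Prod_primes: "inj_on (\<lambda>S. \<Prod>S) {S::nat set. finite S \<and> (\<forall>p\<in>S. prime p)}"
proof (rule inj_onI)
  have key: "S = {p. prime p \<and> p dvd \<Prod>S}" if S: "finite S" "\<forall>p\<in>S. prime p" for S :: "nat set"
  proof (rule Set.set_eqI, rule iffI)
    fix p assume "p \<in> S"
    then show "p \<in> {p. prime p \<and> p dvd \<Prod>S}" using S dvd_prodI[of S p "\<lambda>x. x"] by auto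
  next
    fix p assume p: "p \<in> {p. prime p \<and> p dvd \<Prod>S}"
    then obtain q where "q \<in> S" "p dvd q" using S prime_dvd_prod_iff[of S p "\<lambda>x. x"] by auto
    then show "p \<in> S" using S p primes_dvd_imp_eq by auto
  qed
  fix S R :: "nat set"
  assume "S \<in> {S. finite S \<and> (\<forall>p\<in>S. prime p)}" "R \<in> {S. finite S \<and> (\<forall>p\<in>S. prime p)}" "\<Prod>S = \<Prod>R"
  then show "S = R" using key[of S] key[of R] by simp
qed

text \<open>The remainder D^6 is a product of crude bounds: at most D sets S and at most D sets R,
  each weight at most D, and a counting error at most D^2. The exclusion of 2 from P keeps f 2 at
  1/2; two classes modulo 2 would leave nothing.\<close>

lemma prime_sieve_abstract:
  fixes T P :: "nat set" and s :: int and D :: real and N :: nat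
  assumes D: "D \<ge> 1" and finT: "finite T" and T: "\<And>p. p \<in> T \<Longrightarrow> prime p" and P: "\<And>p. p \<in> P \<Longrightarrow> \<not> int p dvd s" "2 \<notin> P"
    and G: "0 < G0" "G0 \<le> pair_sum T P D"
  shows "real (card {n \<in> {1..N}. \<forall>p\<in>T. \<not> p dvd n \<and> (p \<in> P \<longrightarrow> \<not> int p dvd int n + s)}) \<le> real N / G0 + D ^ 6"
proof -
  define \<rho> where "\<rho> = (\<lambda>p. if p \<in> P then 2 else 1::real)"
  define f where "f = (\<lambda>p. \<rho> p / real p)"
  define DD where "DD = {S. S \<subseteq> T \<and> real (\<Prod>S) \<le> D}"
  have p2: "p \<ge> 2" if "p \<in> T" for p using T[OF that] prime_ge_2_nat by blast
  have \<rho>p: "\<rho> p + 1 \<le> real p" if "p \<in> T" for p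
  proof -
    have "p \<noteq> 2" if "p \<in> P" using that P(2) by auto
    then show ?thesis using p2[OF that] by (cases "p \<in> P") (auto simp: \<rho>_def)
  qed
  have \<rho>1: "\<rho> p \<ge> 1" for p by (simp add: \<rho>_def)
  have f: "0 < f p" "f p < 1" if "p \<in> T" for p
    using p2[OF that] \<rho>p[OF that] \<rho>1[of p] by (auto simp: f_def)
  have sub_pr: "finite S" "\<forall>p\<in>S. prime p" if "S \<subseteq> T" for S using that finT T finite_subset by blast+
  interpret selberg_sieve T f DD
  proof
    fix S R assume S: "S \<in> DD" and R: "R \<subseteq> S"
    then have ST: "S \<subseteq> T" by (simp add: DD_def)
    have "\<Prod>R dvd \<Prod>S" using sub_pr[OF ST] R by (intro prod_dvd_prod_subset)
    moreover have "\<Prod>S > 0" using sub_pr[OF ST] prime_gt_0_nat by (intro prod_pos) auto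
    ultimately have "\<Prod>R \<le> \<Prod>S" by (intro dvd_imp_le)
    then have "real (\<Prod>R) \<le> real (\<Prod>S)" unfolding of_nat_le_iff .
    then show "R \<in> DD" using S R by (auto simp: DD_def simp del: of_nat_prod)
  qed (use finT f D in \<open>auto simp: DD_def\<close>)
  have GG: "G0 \<le> G"
  proof -
    have "pair_sum T P D \<le> subset_sum T (\<lambda>p. f p / (1 - f p)) D"
      using finT T f by (intro pair_sum_le_subset_sum) (auto simp: f_def \<rho>_def)
    also have "(\<lambda>p. f p / (1 - f p)) = h" by (simp add: h_def[abs_def])
    also have "subset_sum T h D = G" unfolding subset_sum_def G_def by (simp only: DD_def)
    finally show ?thesis using G by linarith
  qed
  define bad where "bad = (\<lambda>n. {p \<in> T. p dvd n \<or> p \<in> P \<and> int p dvd int n + s})"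
  define r where "r = (\<lambda>S. \<Prod>p\<in>S. \<rho> p)"
  have cnt: "\<bar>real (card {n \<in> {1..N}. S \<subseteq> bad n}) - real N * prod f S\<bar> \<le> r S" if S: "S \<subseteq> T" for S
  proof -
    have "{n \<in> {1..N}. S \<subseteq> bad n} = {n \<in> {1..N}. \<forall>p\<in>S. p dvd n \<or> p \<in> P \<and> int p dvd int n + s}"
      using S unfolding bad_def by blast
    then show ?thesis using card_bad[of S P s N] sub_pr[OF S] P(1) unfolding r_def f_def \<rho>_def by simp
  qed
  have "real (card {n \<in> {1..N}. bad n \<inter> T = {}}) \<le> real N / G + (\<Sum>S\<in>DD. \<Sum>R\<in>DD. \<bar>lam S\<bar> * \<bar>lam R\<bar> * r (S \<union> R))"
  proof (rule sieve)
    fix S assume "S \<subseteq> T"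
    from cnt[OF this] show "real (card {n \<in> {1..N}. S \<subseteq> bad n}) \<le> real N * prod f S + r S"
      "real (card {n \<in> {1..N}. S \<subseteq> bad n}) \<ge> real N * prod f S - r S" by (simp_all add: abs_le_iff)
  qed simp
  also have "real N / G \<le> real N / G0" using GG G by (intro divide_left_mono) auto
  also have "(\<Sum>S\<in>DD. \<Sum>R\<in>DD. \<bar>lam S\<bar> * \<bar>lam R\<bar> * r (S \<union> R)) \<le> (\<Sum>S\<in>DD. \<Sum>R\<in>DD. D * D * (D * D))"
  proof (intro sum_mono mult_mono)
    have lamD: "\<bar>lam S\<bar> \<le> D" if S: "S \<in> DD" for S
    proof -
      have ST: "S \<subseteq> T" using S by (simp add: DD_def)
      have "\<bar>lam S\<bar> \<le> (\<Prod>p\<in>S. 1 / (1 - f p))" by (rule abs_lam_le[OF S])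
      also have "\<dots> \<le> (\<Prod>p\<in>S. real p)"
      proof (intro prod_mono conjI)
        fix p assume "p \<in> S"
        then have p: "p \<in> T" using ST by auto
        \<comment> \<open>This is the inequality rho p + 1 <= p divided by p.\<close>
        have "1 / real p \<le> 1 - f p" using \<rho>p[OF p] p2[OF p] by (simp add: f_def field_simps)
        then have "1 / (1 - f p) \<le> 1 / (1 / real p)" using p2[OF p] f[OF p] by (intro divide_left_mono) auto
        then show "1 / (1 - f p) \<le> real p" by simp
        show "0 \<le> 1 / (1 - f p)" using f[OF p] by simp
      qed
      also have "\<dots> = real (\<Prod>S)" by simp
      also have "\<dots> \<le> D" using S by (simp add: DD_def del: of_nat_prod)
      finally show ?thesis .
    qed
    fix S R assume S: "S \<in> DD" and R: "R \<in> DD"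
    show "\<bar>lam S\<bar> \<le> D" "\<bar>lam R\<bar> \<le> D" using lamD S R by auto
    have ST: "S \<subseteq> T" "R \<subseteq> T" using S R by (auto simp: DD_def)
    note fS = sub_pr(1)[OF ST(1)] sub_pr(1)[OF ST(2)]
    have "r (S \<union> R) * 1 \<le> r (S \<union> R) * r (S \<inter> R)"
      unfolding r_def using \<rho>1 by (intro mult_left_mono prod_ge_1 prod_nonneg) (auto intro: order.trans[OF zero_le_one])
    also have "\<dots> = r S * r R" unfolding r_def using fS by (rule prod.union_inter)
    also have "\<dots> \<le> real (\<Prod>S) * real (\<Prod>R)"
    proof -
      have le: "r S \<le> real (\<Prod>S)" if "S \<subseteq> T" for S
        unfolding r_def of_nat_prod using that \<rho>p \<rho>1 by (intro prod_mono conjI) (force intro: order.trans[OF zero_le_one])+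
      have "0 \<le> r S" for S unfolding r_def using \<rho>1 by (intro prod_nonneg) (auto intro: order.trans[OF zero_le_one])
      then show ?thesis using le ST by (intro mult_mono) (auto simp del: of_nat_prod)
    qed
    also have "\<dots> \<le> D * D" using S R D by (intro mult_mono) (auto simp: DD_def simp del: of_nat_prod)
    finally show "r (S \<union> R) \<le> D * D" by simp
  qed (use D \<rho>1 in \<open>auto simp: r_def intro!: prod_nonneg intro: order.trans[OF zero_le_one]\<close>)
  also have "\<dots> = real (card DD) * real (card DD) * (D * D * (D * D))" by simp
  also have "\<dots> \<le> D * D * (D * D * (D * D))"
  proof -
    have "card DD = card ((\<lambda>S. \<Prod>S) ` DD)"
      by (rule card_image[symmetric], rule inj_on_subset[OF inj_on_Prod_primes]) (use sub_pr in \<open>auto simp: DD_def\<close>)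
    also have "\<dots> \<le> card {1..nat \<lfloor>D\<rfloor>}"
    proof (intro card_mono)
      show "(\<lambda>S. \<Prod>S) ` DD \<subseteq> {1..nat \<lfloor>D\<rfloor>}"
      proof
        fix n assume "n \<in> (\<lambda>S. \<Prod>S) ` DD"
        then obtain S where S: "n = \<Prod>S" "S \<subseteq> T" "real (\<Prod>S) \<le> D" by (auto simp: DD_def)
        have "n > 0" unfolding S(1) using sub_pr[OF S(2)] prime_gt_0_nat by (intro prod_pos) auto
        then show "n \<in> {1..nat \<lfloor>D\<rfloor>}" using S(1,3) le_nat_floor[of n D] by simp
      qed
    qed simp
    finally have "real (card DD) \<le> real (nat \<lfloor>D\<rfloor>)" by simp
    also have "\<dots> \<le> D" using D by (intro of_nat_floor) auto
    finally show ?thesis using D by (intro mult_mono) auto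
  qed
  also have "D * D * (D * D * (D * D)) = D ^ 6" by (simp add: eval_nat_numeral)
  finally have "real (card {n \<in> {1..N}. bad n \<inter> T = {}}) \<le> real N / G0 + D ^ 6" by simp
  moreover have "{n \<in> {1..N}. bad n \<inter> T = {}} = {n \<in> {1..N}. \<forall>p\<in>T. \<not> p dvd n \<and> (p \<in> P \<longrightarrow> \<not> int p dvd int n + s)}"
    unfolding bad_def by blast
  ultimately show ?thesis by simp
qed

lemma sum_inverse_ge_ln: "ln (real (Suc n)) \<le> (\<Sum>a=1..n. 1 / real a)"
  using ln_le_harm[of n] by (simp add: harm_def divide_inverse add.commute)

text \<open>Divisibility is taken over the integers because q + s may be negative.\<close>

definition exceptional_primes :: "int \<Rightarrow> real \<Rightarrow> real \<Rightarrow> nat \<Rightarrow> nat set" where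
  "exceptional_primes s y z N = {q \<in> {1..N}. prime q \<and> (\<forall>d. y < real d \<longrightarrow> real d \<le> z \<longrightarrow> \<not> int d dvd int q + s)}"

text \<open>The sieve bound N / G0 has the required order because G0 is a multiple of ln x ln z / ln
  y; the remainder and the small primes together are at most 2 sqrt x. The slack in N is harmless
  because x + |s| is at most (1 + |s|) x.\<close>

lemma card_exceptional_primes:
  fixes s :: int
  assumes s: "s \<noteq> 0"
  obtains C :: real where "C > 0"
    "\<And>x y z N. 2 \<le> y \<Longrightarrow> y \<le> z \<Longrightarrow> z \<le> x \<Longrightarrow> real N \<le> x + \<bar>real_of_int s\<bar> \<Longrightarrow>
      real (card (exceptional_primes s y z N))
       \<le> C * (x / ln x * (ln y / ln z))"
proof -
  obtain c where c: "c > 0" "\<And>y. y \<ge> 2 \<Longrightarrow> c / ln y \<le> (\<Prod>p | prime p \<and> real p \<le> y. 1 - 1 / real p)"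
    using mertens_product by blast
  define Qs where "Qs = {p::nat. prime p \<and> int p dvd s}"
  have finQs: "finite Qs"
  proof (rule finite_subset)
    show "Qs \<subseteq> {..nat \<bar>s\<bar>}" using s by (auto simp: Qs_def dest!: dvd_imp_le_int)
  qed simp
  \<comment> \<open>The price for the primes dividing s, which carry a single residue class; it
    depends on s only.\<close>
  define cs where "cs = (\<Prod>p\<in>Qs. 1 - 1 / real p)"
  have half: "1 / 2 \<le> 1 - 1 / real p" "1 - 1 / real p \<le> 1" if "prime p" for p
    using prime_ge_2_nat[OF that] by (auto simp: field_simps)
  have cs: "cs > 0" unfolding cs_def
  proof (rule prod_pos)
    fix p assume "p \<in> Qs"
    then have "1 / 2 \<le> 1 - 1 / real p" by (intro half) (simp add: Qs_def)
    then show "0 < 1 - 1 / real p" by linarith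
  qed
  define C where "C = 576 * (1 + \<bar>real_of_int s\<bar>) / (c * cs) + 64"
  show ?thesis
  proof (rule that[of C])
    show "C > 0" using c cs by (auto simp: C_def intro!: add_nonneg_pos divide_nonneg_pos)
    fix x y z :: real and N :: nat
    assume y: "2 \<le> y" and yz: "y \<le> z" and zx: "z \<le> x" and N: "real N \<le> x + \<bar>real_of_int s\<bar>"
    have x: "x \<ge> 2" using y yz zx by linarith
    have lx: "ln x > 0" and ly: "ln y > 0" and lz: "ln z > 0" and lzx: "ln z \<le> ln x" and ly2: "ln 2 \<le> ln y"
      using x y yz zx by auto
    \<comment> \<open>Both components of the pairs run up to w, so the level is w^2 = x^(1/12) and
      the sieve remainder is its sixth power, sqrt x. The constant 576 in \<open>C\<close> is 24^2,
      from ln w = ln x / 24 and ln u >= ln z / 24.\<close>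
    define w where "w = x powr (1/24)"
    have w1: "w \<ge> 1" unfolding w_def using x by (intro ge_one_powr_ge_zero) auto
    define D where "D = w ^ 2"
    have D1: "D \<ge> 1" unfolding D_def using w1 by (intro one_le_power)
    have wD: "w \<le> D" using power_increasing[of 1 2 w] w1 by (simp add: D_def)
    have D6: "D ^ 6 = sqrt x" using x by (simp add: D_def w_def powr_power powr_half_sqrt flip: power_mult)
    have DS: "D \<le> sqrt x" using power_increasing[of 1 6 D] D1 D6 by simp
    define T where "T = {p. prime p \<and> real p \<le> D}"
    have finT: "finite T" by (rule finite_subset[of _ "{..nat \<lfloor>D\<rfloor>}"]) (auto simp: T_def le_nat_floor)
    define P where "P = {p. prime p \<and> y < real p \<and> real p \<le> z \<and> \<not> int p dvd s}"
    \<comment> \<open>The primes of b must not exceed z to lie in P, and b itself must not exceed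
      w.\<close>
    define u where "u = min z w"
    define M where "M = nat \<lfloor>u\<rfloor>"
    define K where "K = nat \<lfloor>w\<rfloor>"
    have u1: "u \<ge> 1" using w1 y yz by (simp add: u_def)
    have Mu: "real M \<le> u" "u \<le> real (Suc M)" using u1 by (auto simp: M_def of_nat_floor) linarith
    have Kw: "real K \<le> w" "w \<le> real (Suc K)" using w1 by (auto simp: K_def of_nat_floor) linarith
    define Qy where "Qy = {p. prime p \<and> real p \<le> y}"
    have finQy: "finite Qy" by (rule finite_subset[of _ "{..nat \<lfloor>y\<rfloor>}"]) (auto simp: Qy_def le_nat_floor)
    define G0 where "G0 = (ln x / 24) * ((c / ln y * cs) * (ln z / 24))"
    have G0: "G0 > 0" using lx ly lz c cs by (simp add: G0_def)
    have "G0 \<le> (\<Sum>a=1..K. 1 / real a) * ((\<Prod>p\<in>Qy \<union> Qs. 1 - 1 / real p) * (\<Sum>c=1..M. 1 / real c))"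
      unfolding G0_def
    proof (intro mult_mono)
      have "ln x / 24 = ln w" using x by (simp add: w_def ln_powr)
      also have "\<dots> \<le> ln (real (Suc K))" using Kw w1 by (subst ln_le_cancel_iff) auto
      also have "\<dots> \<le> (\<Sum>a=1..K. 1 / real a)" by (rule sum_inverse_ge_ln)
      finally show "ln x / 24 \<le> (\<Sum>a=1..K. 1 / real a)" .
      have "ln z / 24 \<le> ln u"
      proof (cases "z \<le> w")
        case True
        then show ?thesis using lz by (simp add: u_def)
      next
        case False
        then show ?thesis using x lzx by (simp add: u_def w_def ln_powr)
      qed
      also have "\<dots> \<le> ln (real (Suc M))" using Mu u1 by (subst ln_le_cancel_iff) auto
      also have "\<dots> \<le> (\<Sum>c=1..M. 1 / real c)" by (rule sum_inverse_ge_ln)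
      finally show "ln z / 24 \<le> (\<Sum>c=1..M. 1 / real c)" .
      let ?g = "\<lambda>p::nat. 1 - 1 / real p"
      have nn: "0 \<le> ?g p" if "prime p" for p using half[OF that] by linarith
      have "c / ln y * cs \<le> prod ?g Qy * prod ?g Qs"
        unfolding cs_def using c(2)[OF y] nn by (intro mult_right_mono prod_nonneg) (auto simp: Qy_def Qs_def)
      also have "\<dots> = prod ?g (Qy \<union> Qs) * prod ?g (Qy \<inter> Qs)" by (rule prod.union_inter[symmetric]) fact+
      also have "\<dots> \<le> prod ?g (Qy \<union> Qs) * 1"
        using nn half(2) by (intro mult_left_mono prod_le_1 prod_nonneg) (auto simp: Qy_def Qs_def)
      finally show "c / ln y * cs \<le> prod ?g (Qy \<union> Qs)" by simp
      show "0 \<le> prod ?g (Qy \<union> Qs)" using nn by (intro prod_nonneg) (auto simp: Qy_def Qs_def)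
    qed (use lx ly lz c cs in \<open>auto intro!: sum_nonneg mult_nonneg_nonneg\<close>)
    also have "\<dots> \<le> pair_sum T P D"
    proof (rule pair_sum_ge)
      fix p :: nat assume p: "prime p" "p \<le> max K M"
      have "real p \<le> real (max K M)" using p by simp
      also have "\<dots> \<le> w" using Kw Mu by (auto simp: u_def)
      finally show "p \<in> T" using p wD by (simp add: T_def)
    next
      fix p :: nat assume p: "prime p" "p \<le> M" "p \<notin> Qy \<union> Qs"
      have "real p \<le> real M" using p by simp
      then have "real p \<le> z" using Mu by (simp add: u_def)
      then show "p \<in> P" using p by (auto simp: P_def Qy_def Qs_def)
    next
      have "real K * real M \<le> w * w" using Kw Mu by (intro mult_mono) (auto simp: u_def)
      then show "real K * real M \<le> D" by (simp add: D_def power2_eq_square)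
    qed (use finQy finQs in \<open>auto simp: Qy_def Qs_def\<close>)
    finally have GT: "G0 \<le> pair_sum T P D" .
    define A where "A = {n \<in> {1..N}. \<forall>p\<in>T. \<not> p dvd n \<and> (p \<in> P \<longrightarrow> \<not> int p dvd int n + s)}"
    have cA: "real (card A) \<le> real N / G0 + D ^ 6"
      unfolding A_def using D1 finT G0 GT y by (intro prime_sieve_abstract) (auto simp: T_def P_def)
    define E where "E = exceptional_primes s y z N"
    \<comment> \<open>A prime up to D belongs to T and is sifted out by itself, so these primes are
      counted separately.\<close>
    have sub: "E \<subseteq> A \<union> {1..nat \<lfloor>D\<rfloor>}"
    proof
      fix q assume q: "q \<in> E"
      show "q \<in> A \<union> {1..nat \<lfloor>D\<rfloor>}"
      proof (cases "real q \<le> D")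
        case True
        then show ?thesis using q by (auto simp: E_def exceptional_primes_def le_nat_floor)
      next
        case False
        have "\<not> p dvd q" if "p \<in> T" for p
        proof
          assume "p dvd q"
          then have "p = q" using that q primes_dvd_imp_eq by (auto simp: T_def E_def exceptional_primes_def)
          then show False using that False by (simp add: T_def)
        qed
        moreover have "\<not> int p dvd int q + s" if "p \<in> P" for p using that q unfolding P_def E_def exceptional_primes_def by blast
        ultimately have "q \<in> A" using q unfolding A_def E_def exceptional_primes_def by blast
        then show ?thesis by blast
      qed
    qed
    have "card E \<le> card (A \<union> {1..nat \<lfloor>D\<rfloor>})" using sub by (intro card_mono) (auto simp: A_def)
    also have "\<dots> \<le> card A + nat \<lfloor>D\<rfloor>" using card_Un_le[of A "{1..nat \<lfloor>D\<rfloor>}"] by simp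
    finally have "real (card E) \<le> real (card A) + real (nat \<lfloor>D\<rfloor>)" by linarith
    moreover have "real (nat \<lfloor>D\<rfloor>) \<le> D" using D1 by (intro of_nat_floor) auto
    ultimately have E1: "real (card E) \<le> real N / G0 + 2 * sqrt x" using cA DS D6 by linarith
    define m where "m = x / ln x * (ln y / ln z)"
    have "real N \<le> (1 + \<bar>real_of_int s\<bar>) * x"
    proof -
      have "\<bar>real_of_int s\<bar> * 1 \<le> \<bar>real_of_int s\<bar> * x" using x by (intro mult_left_mono) auto
      then show ?thesis using N by (simp add: algebra_simps)
    qed
    then have "real N / G0 \<le> (1 + \<bar>real_of_int s\<bar>) * x / G0" using G0 by (intro divide_right_mono) auto
    also have "\<dots> = 576 * (1 + \<bar>real_of_int s\<bar>) / (c * cs) * m"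
      using lx ly lz c cs by (simp add: G0_def m_def field_simps)
    finally have E2: "real N / G0 \<le> 576 * (1 + \<bar>real_of_int s\<bar>) / (c * cs) * m" .
    have E3: "2 * sqrt x \<le> 64 * m"
    proof -
      have "sqrt x * (ln x)\<^sup>2 \<le> sqrt x * (16 * sqrt x)" using x by (intro mult_left_mono ln_sq_le_sqrt) auto
      also have "\<dots> = 16 * x" using x by simp
      finally have a: "sqrt x \<le> 16 * (x / (ln x)\<^sup>2)" using lx by (simp add: field_simps)
      have "1 / 2 \<le> ln y" using ly2 ln2_ge_two_thirds by linarith
      then have "(1/2) / ln x \<le> ln y / ln z" using lx lz ly lzx by (intro frac_le) auto
      then have "x / ln x * ((1/2) / ln x) \<le> m" unfolding m_def using x lx by (intro mult_left_mono) auto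
      then have "x / (ln x)\<^sup>2 \<le> 2 * m" by (simp add: power2_eq_square)
      then show ?thesis using a by linarith
    qed
    \<comment> \<open>The 64 in \<open>C\<close> comes from E3: sqrt x <= 16 x / (ln x)^2, doubled,
      and x / (ln x)^2 <= 2 m.\<close>
    have "real (card E) \<le> C * m" using E1 E2 E3 by (simp add: C_def algebra_simps)
    then show "real (card (exceptional_primes s y z N)) \<le> C * (x / ln x * (ln y / ln z))"
      unfolding E_def m_def .
  qed
qed

section \<open>Shifted primes with a divisor in an interval\<close>


text \<open>Lets the bounded number of primes lost through the shift be absorbed in the error of the
  prime number theorem.\<close>

lemma one_le_div_ln_sq:
  fixes x :: real
  assumes x: "x \<ge> 2"
  shows "1 \<le> 16 * (x / (ln x)\<^sup>2)"
proof -
  have "(ln x)\<^sup>2 \<le> 16 * sqrt x" using x by (intro ln_sq_le_sqrt) auto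
  also have "sqrt x \<le> x" using x self_le_power[of x 2] by (intro real_le_lsqrt) auto
  finally show ?thesis using x by (simp add: field_simps)
qed

lemma prime_count_real:
  obtains C :: real where "C > 0"
    "\<And>x. x \<ge> 2 \<Longrightarrow> \<bar>prime_count (nat \<lfloor>x\<rfloor>) - x / ln x\<bar> \<le> C * (x / (ln x)\<^sup>2)"
proof -
  obtain C1 where C1: "C1 > 0" "\<And>N. N \<ge> 2 \<Longrightarrow> prime_count N \<ge> real N / ln (real N) - C1 * (real N / (ln (real N))\<^sup>2)"
    using prime_count_lower by blast
  obtain C2 where C2: "C2 > 0" "\<And>N. N \<ge> 2 \<Longrightarrow> prime_count N \<le> real N / ln (real N) + C2 * (real N / (ln (real N))\<^sup>2)"
    using prime_count_upper by blast
  show ?thesis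
  proof (rule that[of "2 + 4 * C1 + 4 * C2"])
    fix x :: real assume x: "x \<ge> 2"
    define N where "N = nat \<lfloor>x\<rfloor>"
    have N2: "N \<ge> 2" using x by (simp add: N_def le_nat_floor)
    have Nx: "real N \<le> x" "x < real N + 1" using x by (auto simp: N_def of_nat_floor)
    define L l where "L = ln x" and "l = ln (real N)"
    have l0: "l > 0" using N2 by (simp add: l_def)
    have lL: "l \<le> L" using Nx N2 by (simp add: l_def L_def)
    have L0: "L > 0" using l0 lL by linarith
    have L2: "L \<le> 2 * l"
    proof -
      have "2 * real N \<le> real N * real N" using N2 by (intro mult_right_mono) auto
      then have "x \<le> real N ^ 2" using Nx N2 unfolding power2_eq_square by linarith
      then have "L \<le> ln (real N ^ 2)" unfolding L_def using x N2 by (subst ln_le_cancel_iff) auto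
      then show ?thesis using N2 by (simp add: l_def ln_realpow)
    qed
    \<comment> \<open>Rounding x down moves the logarithm by at most 1/N, so N / l and N / L differ
      by O(1 / L^2).\<close>
    have LN: "L - l \<le> 1 / real N"
    proof -
      have "L \<le> ln (real (Suc N))" unfolding L_def using Nx x by (subst ln_le_cancel_iff) auto
      then show ?thesis using ln_Suc_diff_le[of N] N2 by (simp add: l_def)
    qed
    define m where "m = x / L\<^sup>2"
    have m0: "m \<ge> 0" using x by (simp add: m_def)
    have sq: "real N / l\<^sup>2 \<le> 4 * m"
    proof -
      have "(L / 2)\<^sup>2 \<le> l\<^sup>2" using L2 L0 by (intro power_mono) auto
      then have "real N / l\<^sup>2 \<le> x / (L / 2)\<^sup>2" using Nx L0 by (intro frac_le) auto
      then show ?thesis by (simp add: m_def power_divide mult.commute)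
    qed
    have up: "real N / l \<le> x / L + 2 * m"
    proof -
      have "real N / l - real N / L = real N * (L - l) / (l * L)" using l0 L0 by (simp add: field_simps)
      also have "\<dots> \<le> 1 / ((L / 2) * L)"
        using LN N2 L2 L0 l0 by (intro frac_le mult_right_mono) (auto simp: field_simps)
      also have "\<dots> = 2 * (1 / L\<^sup>2)" by (simp add: power2_eq_square)
      also have "\<dots> \<le> 2 * m" unfolding m_def using x by (intro mult_left_mono divide_right_mono) auto
      finally have "real N / l \<le> real N / L + 2 * m" by simp
      also have "real N / L \<le> x / L" using Nx L0 by (intro divide_right_mono) auto
      finally show ?thesis by simp
    qed
    have low: "real N / l \<ge> x / L - m"
    proof -
      have "L \<le> x" using ln_bound[of x] x by (simp add: L_def)
      then have "1 / L \<le> m" using L0 by (simp add: m_def field_simps power2_eq_square)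
      moreover have "(x - 1) / L \<le> real N / l" using Nx l0 lL x by (intro frac_le) auto
      ultimately show ?thesis by (simp add: diff_divide_distrib)
    qed
    have "C1 * (real N / l\<^sup>2) \<le> C1 * (4 * m)" "C2 * (real N / l\<^sup>2) \<le> C2 * (4 * m)"
      using mult_left_mono[OF sq less_imp_le[OF C1(1)]] mult_left_mono[OF sq less_imp_le[OF C2(1)]] by simp_all
    moreover have "prime_count N \<ge> real N / l - C1 * (real N / l\<^sup>2)" "prime_count N \<le> real N / l + C2 * (real N / l\<^sup>2)"
      using C1(2)[OF N2] C2(2)[OF N2] by (auto simp: l_def)
    moreover have "0 \<le> C1 * m" "0 \<le> C2 * m" using C1 C2 m0 by auto
    ultimately have "\<bar>prime_count N - x / L\<bar> \<le> (2 + 4 * C1 + 4 * C2) * m"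
      using up low m0 by (simp add: abs_le_iff algebra_simps)
    then show "\<bar>prime_count (nat \<lfloor>x\<rfloor>) - x / ln x\<bar> \<le> (2 + 4 * C1 + 4 * C2) * (x / (ln x)\<^sup>2)"
      by (simp add: N_def L_def m_def)
  qed (use C1 C2 in auto)
qed

text \<open>A shifted prime up to x comes from a prime up to N + |s|; beyond N every integer is
  counted, which costs |s|.\<close>

lemma H_shifted_le:
  assumes "x \<ge> 2"
  shows "real (H x y z (shifted_primes s)) \<le> prime_count (nat \<lfloor>x\<rfloor>) + \<bar>real_of_int s\<bar>"
proof -
  define N where "N = nat \<lfloor>x\<rfloor>"
  define k where "k = nat \<bar>s\<bar>"
  define W where "W = {p. prime p \<and> p \<le> N} \<union> {N<..N + k}"
  have "{n \<in> shifted_primes s. real n \<le> x \<and> (\<exists>d. y < real d \<and> real d \<le> z \<and> d dvd n)} \<subseteq> (\<lambda>p. nat (int p + s)) ` W"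
  proof
    fix n assume n: "n \<in> {n \<in> shifted_primes s. real n \<le> x \<and> (\<exists>d. y < real d \<and> real d \<le> z \<and> d dvd n)}"
    then obtain p where p: "prime p" "int n = int p + s" by (auto simp: shifted_primes_def)
    have "n \<le> N" using n by (simp add: N_def le_nat_floor)
    then have "p \<le> N + k" using p(2) by (simp add: k_def)
    then have "p \<in> W" using p by (auto simp: W_def)
    moreover have "n = nat (int p + s)" using p(2) by simp
    ultimately show "n \<in> (\<lambda>p. nat (int p + s)) ` W" by blast
  qed
  moreover have finW: "finite W" by (auto simp: W_def intro: finite_subset[of _ "{..N}"])
  ultimately have "H x y z (shifted_primes s) \<le> card ((\<lambda>p. nat (int p + s)) ` W)"
    unfolding H_def by (intro card_mono) auto
  also have "\<dots> \<le> card W" using finW by (rule card_image_le)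
  also have "\<dots> \<le> card {p. prime p \<and> p \<le> N} + card {N<..N + k}" unfolding W_def by (rule card_Un_le)
  finally have "real (H x y z (shifted_primes s)) \<le> real (card {p. prime p \<and> p \<le> N}) + real k" by simp
  then show ?thesis by (simp add: prime_count_def N_def k_def)
qed

text \<open>A prime up to N whose shift leaves [0,N] lies below |s| or within |s| of N, at most 2|s|
  + 1 cases. The others are exceptional or counted by \<open>H\<close>; a shift with value 0 fits,
  as both definitions let every d divide it.\<close>

lemma H_shifted_ge:
  assumes "x \<ge> 2"
  shows "prime_count (nat \<lfloor>x\<rfloor>) \<le> real (H x y z (shifted_primes s)) + (2 * \<bar>real_of_int s\<bar> + 1)
     + real (card (exceptional_primes s y z (nat \<lfloor>x\<rfloor>)))"
proof -
  define N where "N = nat \<lfloor>x\<rfloor>"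
  define k where "k = nat \<bar>s\<bar>"
  define E where "E = exceptional_primes s y z N"
  define B where "B = {n \<in> shifted_primes s. real n \<le> x \<and> (\<exists>d. y < real d \<and> real d \<le> z \<and> d dvd n)}"
  define V where "V = {p. prime p \<and> p \<le> N \<and> 0 \<le> int p + s \<and> nat (int p + s) \<in> B}"
  have Nx: "real N \<le> x" using assms by (simp add: N_def of_nat_floor)
  have finB: "finite B" by (rule finite_subset[of _ "{..N}"]) (auto simp: B_def N_def le_nat_floor)
  have "{p. prime p \<and> p \<le> N} \<subseteq> V \<union> E \<union> ({..<k} \<union> {N - k..N})"
  proof
    fix p assume p: "p \<in> {p. prime p \<and> p \<le> N}"
    show "p \<in> V \<union> E \<union> ({..<k} \<union> {N - k..N})"
    proof (cases "int p + s < 0 \<or> int p + s > int N")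
      case True
      then have "p < k \<or> N - k \<le> p" unfolding k_def by linarith
      then show ?thesis using p by auto
    next
      case False
      define n where "n = nat (int p + s)"
      have n: "int n = int p + s" "n \<le> N" using False by (auto simp: n_def)
      show ?thesis
      proof (cases "\<exists>d. y < real d \<and> real d \<le> z \<and> d dvd n")
        case True
        have "real n \<le> x" using n(2) Nx by linarith
        then have "n \<in> B" using True n p by (auto simp: B_def shifted_primes_def)
        then show ?thesis using p False by (auto simp: V_def n_def)
      next
        case nd: False
        have "p \<in> E" unfolding E_def exceptional_primes_def using p nd n(1)[symmetric] by (auto simp: Suc_le_eq prime_gt_0_nat)
        then show ?thesis by blast
      qed
    qed
  qed
  moreover have finV: "finite V" by (rule finite_subset[of _ "{..N}"]) (auto simp: V_def)
  moreover have finE: "finite E" by (simp add: E_def exceptional_primes_def)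
  ultimately have "card {p. prime p \<and> p \<le> N} \<le> card (V \<union> E \<union> ({..<k} \<union> {N - k..N}))"
    by (intro card_mono) auto
  also have "\<dots> \<le> card (V \<union> E) + card ({..<k} \<union> {N - k..N})" by (rule card_Un_le)
  also have "\<dots> \<le> (card V + card E) + (card {..<k} + card {N - k..N})" by (intro add_mono card_Un_le)
  also have "card {N - k..N} \<le> k + 1" by auto
  also have "card V \<le> card B"
  proof (rule card_inj_on_le[of "\<lambda>p. nat (int p + s)"])
    show "inj_on (\<lambda>p. nat (int p + s)) V" by (auto simp: inj_on_def V_def)
  qed (use finB in \<open>auto simp: V_def\<close>)
  finally have "card {p. prime p \<and> p \<le> N} \<le> card B + card E + (2 * k + 1)" by simp
  then have "real (card {p. prime p \<and> p \<le> N}) \<le> real (card B) + real (card E) + (2 * real k + 1)" by linarith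
  then show ?thesis unfolding prime_count_def H_def B_def E_def N_def k_def by simp
qed

theorem theorem1p8:
  fixes s :: int
  assumes "s \<noteq> 0"
  shows "\<exists>C::real. \<forall>x y z::real. 2 \<le> y \<and> y \<le> z \<and> z \<le> x \<longrightarrow>
    (\<exists>E::real. \<bar>E\<bar> \<le> C * (ln y / ln z) \<and>
      real (H x y z (shifted_primes s)) = x / ln x * (1 + E))"
proof -
  obtain C1 where C1: "C1 > 0" "\<And>x. x \<ge> 2 \<Longrightarrow> \<bar>prime_count (nat \<lfloor>x\<rfloor>) - x / ln x\<bar> \<le> C1 * (x / (ln x)\<^sup>2)"
    using prime_count_real by blast
  obtain C2 where C2: "C2 > 0"
    "\<And>x y z N. 2 \<le> y \<Longrightarrow> y \<le> z \<Longrightarrow> z \<le> x \<Longrightarrow> real N \<le> x + \<bar>real_of_int s\<bar> \<Longrightarrow>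
      real (card (exceptional_primes s y z N))
       \<le> C2 * (x / ln x * (ln y / ln z))"
    using card_exceptional_primes[OF assms] by blast
  define b where "b = 2 * \<bar>real_of_int s\<bar> + 1"
  have b: "b \<ge> 0" by (simp add: b_def)
  \<comment> \<open>\<open>C2\<close> bounds the exceptional primes. The rest is the error of the
    prime number theorem plus the boundary term \<open>b\<close>, where 16 comes from
    \<open>one_le_div_ln_sq\<close> and 2 from the comparison with \<open>m\<close>.\<close>
  define C where "C = 2 * (C1 + 16 * b) + C2"
  show ?thesis
  proof (rule exI[of _ C], intro allI impI)
    fix x y z :: real assume a: "2 \<le> y \<and> y \<le> z \<and> z \<le> x"
    have x: "x \<ge> 2" using a by linarith
    have lx: "ln x > 0" and lz: "ln z > 0" and lzx: "ln z \<le> ln x" and ly: "ln y \<ge> ln 2" using a by auto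
    define h where "h = real (H x y z (shifted_primes s))"
    define m where "m = x / ln x * (ln y / ln z)"
    have ly2: "1 / 2 \<le> ln y" using ly ln2_ge_two_thirds by linarith
    \<comment> \<open>The comparison of the two error scales: ln y >= 1/2 and ln z <= ln x give ln y
      / ln z >= (1/2) / ln x.\<close>
    have m: "x / (ln x)\<^sup>2 \<le> 2 * m"
    proof -
      have "(1/2) / ln x \<le> ln y / ln z" using lx lz ly2 lzx by (intro frac_le) auto
      then have "x / ln x * ((1/2) / ln x) \<le> m" unfolding m_def using x lx by (intro mult_left_mono) auto
      then show ?thesis by (simp add: power2_eq_square)
    qed
    have m0: "m \<ge> 0" using x lx lz ly2 by (simp add: m_def)
    have bm: "b * 1 \<le> b * (16 * (x / (ln x)\<^sup>2))" using b one_le_div_ln_sq[OF x] by (intro mult_left_mono)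
    have main: "C1 * (x / (ln x)\<^sup>2) + b \<le> 2 * (C1 + 16 * b) * m"
    proof -
      have "C1 * (x / (ln x)\<^sup>2) + b \<le> (C1 + 16 * b) * (x / (ln x)\<^sup>2)" using bm by (simp add: algebra_simps)
      also have "\<dots> \<le> (C1 + 16 * b) * (2 * m)" using m C1(1) b by (intro mult_left_mono) auto
      finally show ?thesis by (simp only: mult_ac)
    qed
    have "h \<le> x / ln x + (C1 * (x / (ln x)\<^sup>2) + b)"
      using H_shifted_le[OF x, of y z s] C1(2)[OF x] unfolding h_def b_def by linarith
    moreover have "h \<ge> x / ln x - (C1 * (x / (ln x)\<^sup>2) + b) - C2 * m"
    proof -
      have "real (card (exceptional_primes s y z (nat \<lfloor>x\<rfloor>))) \<le> C2 * m"
      proof -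
        have "real (nat \<lfloor>x\<rfloor>) \<le> x + \<bar>real_of_int s\<bar>" using of_nat_floor[of x] x by linarith
        then show ?thesis unfolding m_def using a by (intro C2(2)) auto
      qed
      then show ?thesis using H_shifted_ge[OF x, of y z s] C1(2)[OF x] unfolding h_def b_def by linarith
    qed
    moreover have "0 \<le> C2 * m" using C2 m0 by simp
    ultimately have hm: "\<bar>h - x / ln x\<bar> \<le> C * m" using main by (simp add: C_def algebra_simps abs_le_iff)
    define E where "E = (h - x / ln x) * (ln x / x)"
    have "\<bar>E\<bar> = \<bar>h - x / ln x\<bar> * (ln x / x)" using x lx by (simp add: E_def abs_mult)
    also have "\<dots> \<le> C * m * (ln x / x)" using hm x lx by (intro mult_right_mono) auto
    also have "\<dots> = C * (ln y / ln z)" using x lx by (simp add: m_def)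
    finally have "\<bar>E\<bar> \<le> C * (ln y / ln z)" .
    moreover have "h = x / ln x * (1 + E)" using x lx by (simp add: E_def field_simps)
    ultimately show "\<exists>E. \<bar>E\<bar> \<le> C * (ln y / ln z) \<and> real (H x y z (shifted_primes s)) = x / ln x * (1 + E)"
      unfolding h_def by blast
  qed
qed

end
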